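(* For every exponentiation invariant generalized limit $\omega$ on $L_\infty(0,\infty)$, the weight $$\mathrm{Tr}_\omega(T):=\omega\left(\frac{1}{\log(1+t)}\int_0^t\mu(s,T)\,ds\right),\qquad 0\le T\in\mathcal M_{1,\infty},$$ extends to a non-normal trace on $\mathcal M_{1,\infty}$.
   Context: $L_\infty=L_\infty(0,\infty)$ is the space of real-valued bounded Lebesgue measurable functions on $(0,\infty)$ with the essential supremum norm. A generalized limit is a positive linear functional $\omega$ on $L_\infty$, normalized ($\omega(1)=1$), which equals the ordinary limit on functions convergent at $+\infty$. It is exponentiation invariant if $\omega(P^ax)=\omega(x)$ for all $x\in L_\infty$ and all $a>0$, where $(P^ax)(t)=x(t^a)$. In $\omega(\cdots)$ the argument is regarded as a function of $t\in(0,\infty)$. $H$ is a separable infinite-dimensional (complex) Hilbert space, $B(H)$ the algebra of bounded linear operators on $H$, $\mathrm{Tr}$ the standard trace. For $T\in B(H)$ the generalized singular value function is $\mu(t,T)=\inf\{\|Tp\| : p\in B(H)\text{ a projection with }\mathrm{Tr}(1-p)\le t\}$, so that for compact $T$, $\mu(\cdot,T)=\sum_{n\ge0}\mu(n,T)\chi_{[n,n+1)}$ with $\mu(k-1,T)$ the $k$-th largest eigenvalue of $|T|$. The Dixmier ideal is $$\mathcal M_{1,\infty}=\left\{T\in B(H):\ \sup_{t>0}\frac1{\log(1+t)}\int_0^t\mu(s,T)\,ds<\infty\right\}.$$ A trace on $\mathcal M_{1,\infty}$ is a positive linear functional on $\mathcal M_{1,\infty}$ that is unitarily invariant; it is normal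 if it preserves suprema of bounded increasing nets of positive operators (with supremum in $\mathcal M_{1,\infty}$), and non-normal otherwise. *)

theory Defs
  imports "HOL-Analysis.Analysis"
begin

section \<open>Complex Hilbert spaces\<close>

text \<open>The real structure underlying a complex Hilbert space is a real Hilbert space whose inner
  product is the real part of the complex one; hence building on \<open>real_inner\<close> loses no generality.
  The norm is the usual one, since \<open>norm x = sqrt (inner x x)\<close> and \<open>cinner x x\<close> is real.
  The complex inner product is linear in its second argument.\<close>

class complex_hilbert_space = real_inner + complete_space +
  fixes scaleC :: "complex \<Rightarrow> 'a \<Rightarrow> 'a" (infixr "*\<^sub>C" 75)
    and cinner :: "'a \<Rightarrow> 'a \<Rightarrow> complex"
  assumes scaleC_add_right: "a *\<^sub>C (x + y) = a *\<^sub>C x + a *\<^sub>C y"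
    and scaleC_add_left: "(a + b) *\<^sub>C x = a *\<^sub>C x + b *\<^sub>C x"
    and scaleC_scaleC: "a *\<^sub>C b *\<^sub>C x = (a * b) *\<^sub>C x"
    and scaleC_of_real: "complex_of_real r *\<^sub>C x = r *\<^sub>R x"
    and cinner_commute: "cinner x y = cnj (cinner y x)"
    and cinner_add_right: "cinner x (y + z) = cinner x y + cinner x z"
    and cinner_scaleC_right: "cinner x (a *\<^sub>C y) = a * cinner x y"
    and inner_eq_Re_cinner: "inner x y = Re (cinner x y)"

interpretation complex_vector: vector_space "scaleC :: complex \<Rightarrow> 'a \<Rightarrow> 'a::complex_hilbert_space"
proof
  fix x :: 'a
  show "1 *\<^sub>C x = x"
    using scaleC_of_real[of 1 x] by simp
qed (simp_all add: scaleC_add_right scaleC_add_left scaleC_scaleC)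

lemma cinner_self: "cinner x x = complex_of_real ((norm x)\<^sup>2)" for x :: "'a::complex_hilbert_space"
proof (rule complex_eqI)
  show "Re (cinner x x) = Re (complex_of_real ((norm x)\<^sup>2))"
    by (simp add: inner_eq_Re_cinner[symmetric] power2_norm_eq_inner)
  have "Im (cinner x x) = - Im (cinner x x)"
    using cinner_commute[of x x] by (metis cnj.simps(2))
  then show "Im (cinner x x) = Im (complex_of_real ((norm x)\<^sup>2))"
    by simp
qed

lemma norm_scaleC: "norm (a *\<^sub>C x) = cmod a * norm x" for x :: "'a::complex_hilbert_space"
proof -
  have "cinner (a *\<^sub>C x) (a *\<^sub>C x) = a * cnj (a * cinner x x)"
    by (metis cinner_commute cinner_scaleC_right)
  then have "cinner (a *\<^sub>C x) (a *\<^sub>C x) = (a * cnj a) * complex_of_real ((norm x)\<^sup>2)"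
    by (simp add: cinner_self)
  then have "complex_of_real ((norm (a *\<^sub>C x))\<^sup>2) = complex_of_real ((cmod a * norm x)\<^sup>2)"
    unfolding cinner_self complex_norm_square[symmetric]
    by (simp add: power_mult_distrib)
  then have "(norm (a *\<^sub>C x))\<^sup>2 = (cmod a * norm x)\<^sup>2"
    using of_real_eq_iff by blast
  then show ?thesis
    by (simp add: power2_eq_iff_nonneg)
qed

definition orthonormal_basis :: "'h::complex_hilbert_space set \<Rightarrow> bool" where
  "orthonormal_basis B \<longleftrightarrow>
     (\<forall>e\<in>B. norm e = 1) \<and> pairwise (\<lambda>e f. cinner e f = 0) B \<and>
     closure (complex_vector.span B) = UNIV"


section \<open>Bounded operators\<close>

text \<open>The library type \<open>'h \<Rightarrow>\<^sub>L 'h\<close> consists of the bounded real-linear maps with the operator norm;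
  the algebra of all bounded complex-linear operators is the following subset of it.\<close>

definition bounded_ops :: "('h::complex_hilbert_space \<Rightarrow>\<^sub>L 'h) set" where
  "bounded_ops = {T. \<forall>c x. blinfun_apply T (c *\<^sub>C x) = c *\<^sub>C T x}"

lift_definition scaleC_op :: "complex \<Rightarrow> ('h \<Rightarrow>\<^sub>L 'h) \<Rightarrow> ('h::complex_hilbert_space \<Rightarrow>\<^sub>L 'h)"
  is "\<lambda>c T x. c *\<^sub>C T x"
proof -
  fix c and T :: "'h \<Rightarrow> 'h"
  assume "bounded_linear T"
  moreover have "bounded_linear (\<lambda>x::'h. c *\<^sub>C x)"
  proof (rule bounded_linear_intro)
    show "c *\<^sub>C (r *\<^sub>R x) = r *\<^sub>R c *\<^sub>C x" for r and x :: 'h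
      by (simp add: scaleC_of_real[symmetric] scaleC_scaleC mult.commute)
    show "norm (c *\<^sub>C x) \<le> norm x * cmod c" for x :: 'h
      by (simp add: norm_scaleC)
  qed (simp add: scaleC_add_right)
  ultimately show "bounded_linear (\<lambda>x. c *\<^sub>C T x)"
    using bounded_linear_compose by blast
qed

definition adjoint :: "('h::complex_hilbert_space \<Rightarrow>\<^sub>L 'h) \<Rightarrow> ('h \<Rightarrow>\<^sub>L 'h)" where
  "adjoint T = (THE S. S \<in> bounded_ops \<and> (\<forall>x y. cinner (S x) y = cinner x (T y)))"

definition unitary_op :: "('h::complex_hilbert_space \<Rightarrow>\<^sub>L 'h) \<Rightarrow> bool" where
  "unitary_op U \<longleftrightarrow>
     U \<in> bounded_ops \<and> adjoint U o\<^sub>L U = id_blinfun \<and> U o\<^sub>L adjoint U = id_blinfun"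

definition projection_op :: "('h::complex_hilbert_space \<Rightarrow>\<^sub>L 'h) \<Rightarrow> bool" where
  "projection_op p \<longleftrightarrow> p \<in> bounded_ops \<and> p o\<^sub>L p = p \<and> adjoint p = p"

definition positive_op :: "('h::complex_hilbert_space \<Rightarrow>\<^sub>L 'h) \<Rightarrow> bool" where
  "positive_op T \<longleftrightarrow> T \<in> bounded_ops \<and> (\<forall>x. cinner x (T x) \<in> \<real>\<^sub>\<ge>\<^sub>0)"

definition op_le :: "('h::complex_hilbert_space \<Rightarrow>\<^sub>L 'h) \<Rightarrow> ('h \<Rightarrow>\<^sub>L 'h) \<Rightarrow> bool" where
  "op_le S T \<longleftrightarrow> positive_op (T - S)"

text \<open>The standard trace, as a \<open>[0,\<infinity>]\<close>-valued function of positive operators; its value does not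
  depend on the orthonormal basis.\<close>

definition op_trace :: "('h::complex_hilbert_space \<Rightarrow>\<^sub>L 'h) \<Rightarrow> ennreal" where
  "op_trace T =
     (\<Sum>\<^sub>\<infinity>e\<in>(SOME B. orthonormal_basis B). ennreal (Re (cinner e (T e))))"


section \<open>Singular value function and the Dixmier ideal\<close>

definition sing_val :: "real \<Rightarrow> ('h::complex_hilbert_space \<Rightarrow>\<^sub>L 'h) \<Rightarrow> real" where
  "sing_val t T =
     Inf {norm (T o\<^sub>L p) | p. projection_op p \<and> op_trace (id_blinfun - p) \<le> ennreal t}"

definition log_mean :: "('h::complex_hilbert_space \<Rightarrow>\<^sub>L 'h) \<Rightarrow> real \<Rightarrow> real" where
  "log_mean T t = 1 / ln (1 + t) * integral {0..t} (\<lambda>s. sing_val s T)"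

definition dixmier_ideal :: "('h::complex_hilbert_space \<Rightarrow>\<^sub>L 'h) set" where
  "dixmier_ideal = {T \<in> bounded_ops. bdd_above (log_mean T ` {0<..})}"


section \<open>Traces on the Dixmier ideal\<close>

text \<open>A linear functional on the ideal is represented by a function on all of \<open>'h \<Rightarrow>\<^sub>L 'h\<close>, of which
  only the values on the ideal are relevant.\<close>

definition dixmier_ideal_trace :: "(('h::complex_hilbert_space \<Rightarrow>\<^sub>L 'h) \<Rightarrow> complex) \<Rightarrow> bool" where
  "dixmier_ideal_trace \<phi> \<longleftrightarrow>
     (\<forall>S\<in>dixmier_ideal. \<forall>T\<in>dixmier_ideal. \<phi> (S + T) = \<phi> S + \<phi> T) \<and>
     (\<forall>c. \<forall>T\<in>dixmier_ideal. \<phi> (scaleC_op c T) = c * \<phi> T) \<and>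
     (\<forall>T\<in>dixmier_ideal. positive_op T \<longrightarrow> \<phi> T \<in> \<real>\<^sub>\<ge>\<^sub>0) \<and>
     (\<forall>T\<in>dixmier_ideal. \<forall>U. unitary_op U \<longrightarrow> \<phi> (adjoint U o\<^sub>L T o\<^sub>L U) = \<phi> T)"

text \<open>Least upper bounds are taken for the operator order. An upper bound of a nonempty set of positive
  operators is again positive, so \<open>S\<close> ranges over operators, not just self-adjoint ones.\<close>

definition op_supremum :: "('h::complex_hilbert_space \<Rightarrow>\<^sub>L 'h) set \<Rightarrow> ('h \<Rightarrow>\<^sub>L 'h) \<Rightarrow> bool" where
  "op_supremum D T \<longleftrightarrow>
     T \<in> bounded_ops \<and> (\<forall>S\<in>D. op_le S T) \<and>
     (\<forall>R\<in>bounded_ops. (\<forall>S\<in>D. op_le S R) \<longrightarrow> op_le T R)"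

text \<open>An increasing net enters only through its range, which is an upward directed set; conversely
  an upward directed set is an increasing net indexed by itself. Boundedness of the net is implied
  by the existence of the supremum.\<close>

definition normal_functional :: "(('h::complex_hilbert_space \<Rightarrow>\<^sub>L 'h) \<Rightarrow> complex) \<Rightarrow> bool" where
  "normal_functional \<phi> \<longleftrightarrow>
     (\<forall>D T. D \<noteq> {} \<longrightarrow> D \<subseteq> dixmier_ideal \<longrightarrow> (\<forall>S\<in>D. positive_op S) \<longrightarrow>
        (\<forall>R\<in>D. \<forall>S\<in>D. \<exists>Q\<in>D. op_le R Q \<and> op_le S Q) \<longrightarrow>
        op_supremum D T \<longrightarrow> T \<in> dixmier_ideal \<longrightarrow>
        \<phi> T = complex_of_real (SUP S\<in>D. Re (\<phi> S)))"


section \<open>Generalized limits\<close>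

definition L_infty :: "(real \<Rightarrow> real) set" where
  "L_infty = {x \<in> borel_measurable (lebesgue_on {0<..}). bounded (x ` {0<..})}"

text \<open>Functions are not identified modulo null sets, but positivity for the almost everywhere order,
  together with linearity, forces \<open>\<omega>\<close> to agree on functions that are equal almost everywhere on
  \<open>(0,\<infinity>)\<close>. So these are exactly the functionals on the space of equivalence classes.\<close>

definition generalized_limit :: "((real \<Rightarrow> real) \<Rightarrow> real) \<Rightarrow> bool" where
  "generalized_limit \<omega> \<longleftrightarrow>
     (\<forall>x\<in>L_infty. \<forall>y\<in>L_infty. \<omega> (\<lambda>t. x t + y t) = \<omega> x + \<omega> y) \<and>
     (\<forall>c. \<forall>x\<in>L_infty. \<omega> (\<lambda>t. c * x t) = c * \<omega> x) \<and>
     (\<forall>x\<in>L_infty. (AE t in lebesgue_on {0<..}. 0 \<le> x t) \<longrightarrow> 0 \<le> \<omega> x) \<and>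
     \<omega> (\<lambda>t. 1) = 1 \<and>
     (\<forall>x\<in>L_infty. \<forall>l. (x \<longlongrightarrow> l) at_top \<longrightarrow> \<omega> x = l)"

definition exponentiation_invariant :: "((real \<Rightarrow> real) \<Rightarrow> real) \<Rightarrow> bool" where
  "exponentiation_invariant \<omega> \<longleftrightarrow>
     (\<forall>x\<in>L_infty. \<forall>a>0. \<omega> (\<lambda>t. x (t powr a)) = \<omega> x)"

definition Tr_weight :: "((real \<Rightarrow> real) \<Rightarrow> real) \<Rightarrow> ('h::complex_hilbert_space \<Rightarrow>\<^sub>L 'h) \<Rightarrow> real" where
  "Tr_weight \<omega> T = \<omega> (log_mean T)"

end

theory Submission
  imports Defs
begin

text \<open>
  The weight is additive on positive operators of the ideal, extends linearly because the ideal is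
  spanned by its positive elements, and fails normality on a diagonal operator.

  \<^emph>\<open>Singular numbers.\<close> For \<open>n \<le> t < n + 1\<close> the value \<open>\<mu>(t, T)\<close> is the infimum of all bounds of
  \<open>T\<close> on the orthogonal complement of a set of at most \<open>n\<close> vectors (lemma
  \<open>sing_val_eq_snum\<close>). In this form adjoint invariance and
  \<open>\<mu>(m + n, S + T) \<le> \<mu>(m, S) + \<mu>(n, T)\<close> are immediate. For positive \<open>T\<close>, a
  square root of \<open>T\<close> shows that the norm may be replaced by the quadratic form
  (\<open>snum_bound_positive_iff\<close>), so no spectral theorem is needed for the variational principle that
  \<open>\<mu>(0, T) + \<dots> + \<mu>(n - 1, T)\<close> is the supremum of \<open>\<Sum>\<^sub>e \<langle>e, T e\<rangle>\<close> over orthonormal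
  sets of at most \<open>n\<close> vectors (\<open>partial_trace_le_snum_sum\<close>, \<open>snum_sum_le_partial_trace\<close>).

  \<^emph>\<open>Additivity.\<close> Put \<open>\<Phi>\<^sub>T(t) = \<integral>\<^sub>0\<^sup>t \<mu>(s, T) ds\<close>. The variational principle yields, for positive
  \<open>S\<close> and \<open>T\<close>,
  \<open>\<Phi>\<^sub>S\<^sub>+\<^sub>T(t) \<le> \<Phi>\<^sub>S(t + 1) + \<Phi>\<^sub>T(t + 1)\<close> and \<open>\<Phi>\<^sub>S(t) + \<Phi>\<^sub>T(t) \<le> \<Phi>\<^sub>S\<^sub>+\<^sub>T(2 t + 2)\<close>.
  The shift of the argument is harmless: eventually \<open>2 t + 2 \<le> t\<^sup>1\<^sup>+\<^sup>\<epsilon>\<close>, the passage from \<open>t\<close> to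
  \<open>t\<^sup>1\<^sup>+\<^sup>\<epsilon>\<close> changes \<open>log (1 + t)\<close> by a factor close to \<open>1\<close>, and \<open>\<omega>\<close> is exponentiation
  invariant (\<open>exponentiation_invariant_le\<close>). Hence the weight is additive (\<open>Tr_weight_add\<close>).

  \<^emph>\<open>Extension.\<close> The ideal contains \<open>T\<^sup>*\<close> and, for self-adjoint \<open>T\<close>, also
  \<open>\<bar>T\<bar> = (T\<^sup>2)\<^sup>1\<^sup>/\<^sup>2\<close>. So every element is \<open>A - B + \<i> (C - D)\<close> with positive elements of the ideal,
  and additivity makes the extension well defined and linear. Unitary invariance is inherited
  from the singular numbers.

  \<^emph>\<open>Non-normality.\<close> The diagonal operator with eigenvalues \<open>1, 1/2, 1/3, \<dots>\<close> is the norm limit and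
  the supremum of its finite rank truncations. The trace vanishes on the truncations, since their
  functions \<open>\<Phi>\<close> are bounded, but not on the operator itself, whose function \<open>\<Phi>\<close> grows like the
  logarithm.
\<close>

section \<open>Complex Hilbert spaces\<close>

instance complex_hilbert_space \<subseteq> banach ..

lemma cinner_add_left: "cinner (x + y) z = cinner x z + cinner y z"
  for x :: "'h::complex_hilbert_space"
  by (metis cinner_commute cinner_add_right complex_cnj_add)

lemma cinner_scaleC_left: "cinner (a *\<^sub>C x) y = cnj a * cinner x y"
  for x :: "'h::complex_hilbert_space"
  by (metis cinner_commute cinner_scaleC_right complex_cnj_mult)

lemma cinner_scaleR_right: "cinner x (r *\<^sub>R y) = of_real r * cinner x y"
  for x :: "'h::complex_hilbert_space"
  by (metis scaleC_of_real cinner_scaleC_right)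

lemma cinner_scaleR_left: "cinner (r *\<^sub>R x) y = of_real r * cinner x y"
  for x :: "'h::complex_hilbert_space"
  by (metis scaleC_of_real cinner_scaleC_left complex_cnj_complex_of_real)

lemma cinner_minus_right: "cinner x (- y) = - cinner x y"
  for x :: "'h::complex_hilbert_space"
  using cinner_scaleR_right[of x "-1" y] by simp

lemma cinner_minus_left: "cinner (- x) y = - cinner x y"
  for x :: "'h::complex_hilbert_space"
  using cinner_scaleR_left[of "-1" x y] by simp

lemma cinner_diff_right: "cinner x (y - z) = cinner x y - cinner x z"
  for x :: "'h::complex_hilbert_space"
  using cinner_add_right[of x y "- z"] by (simp add: cinner_minus_right)

lemma cinner_diff_left: "cinner (x - y) z = cinner x z - cinner y z"
  for x :: "'h::complex_hilbert_space"
  using cinner_add_left[of x "- y" z] by (simp add: cinner_minus_left)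

lemma cinner_zero_right [simp]: "cinner x 0 = 0"
  for x :: "'h::complex_hilbert_space"
  using cinner_scaleR_right[of x 0 x] by simp

lemma cinner_zero_left [simp]: "cinner 0 x = 0"
  for x :: "'h::complex_hilbert_space"
  using cinner_scaleR_left[of 0 x x] by simp

lemma cinner_sum_right: "cinner x (\<Sum>i\<in>I. f i) = (\<Sum>i\<in>I. cinner x (f i))"
  for x :: "'h::complex_hilbert_space"
  by (induction I rule: infinite_finite_induct) (simp_all add: cinner_add_right)

lemma cinner_sum_left: "cinner (\<Sum>i\<in>I. f i) x = (\<Sum>i\<in>I. cinner (f i) x)"
  for x :: "'h::complex_hilbert_space"
  by (induction I rule: infinite_finite_induct) (simp_all add: cinner_add_left)

lemmas cinner_simps = cinner_add_left cinner_add_right cinner_diff_left cinner_diff_right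
  cinner_scaleC_left cinner_scaleC_right cinner_scaleR_left cinner_scaleR_right
  cinner_minus_left cinner_minus_right cinner_sum_left cinner_sum_right

lemma cinner_eq_0_commute: "cinner x y = 0 \<longleftrightarrow> cinner y x = 0"
  for x :: "'h::complex_hilbert_space"
  by (metis cinner_commute complex_cnj_zero)

lemma cinner_eq_0_imp_inner: "cinner x y = 0 \<Longrightarrow> inner x y = 0"
  for x :: "'h::complex_hilbert_space"
  by (simp add: inner_eq_Re_cinner)

lemma Im_cinner: "Im (cinner x y) = - inner x (\<i> *\<^sub>C y)"
  for x :: "'h::complex_hilbert_space"
  by (simp add: inner_eq_Re_cinner cinner_scaleC_right)

lemma inner_scaleC_swap: "inner (c *\<^sub>C x) y = inner x (cnj c *\<^sub>C y)"
  for x :: "'h::complex_hilbert_space"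
  by (simp add: inner_eq_Re_cinner cinner_simps)

lemma norm_cinner_le: "norm (cinner x y) \<le> norm x * norm y"
  for x :: "'h::complex_hilbert_space"
proof (cases "cinner x y = 0")
  case False
  define c where "c = cnj (cinner x y) / norm (cinner x y)"
  have c: "norm c = 1" using False by (simp add: c_def norm_divide)
  have "c * cinner x y = of_real (norm (cinner x y))"
    using False by (simp add: c_def complex_norm_square[symmetric] power2_eq_square mult.commute)
  then have "norm (cinner x y) = inner x (c *\<^sub>C y)"
    by (simp add: inner_eq_Re_cinner cinner_simps)
  also have "\<dots> \<le> norm x * norm (c *\<^sub>C y)" by (rule norm_cauchy_schwarz)
  finally show ?thesis by (simp add: norm_scaleC c)
qed simp

lemma scaleC_scaleR: "c *\<^sub>C (r *\<^sub>R x) = r *\<^sub>R (c *\<^sub>C x)"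
  for x :: "'h::complex_hilbert_space"
  by (simp add: scaleC_of_real[symmetric] scaleC_scaleC mult.commute)

lemma bounded_linear_scaleC: "bounded_linear (\<lambda>x::'h::complex_hilbert_space. c *\<^sub>C x)"
  by (rule bounded_linear_intro[of _ "cmod c"])
     (simp_all add: scaleC_add_right scaleC_scaleR norm_scaleC)

subsection \<open>Orthogonal projection onto a closed subspace and the Riesz representation\<close>

lemma parallelogram:
  fixes x y :: "'a::real_inner"
  shows "(norm (x + y))\<^sup>2 + (norm (x - y))\<^sup>2 = 2 * (norm x)\<^sup>2 + 2 * (norm y)\<^sup>2"
  unfolding power2_norm_eq_inner by (simp add: inner_simps inner_commute)

lemma subspace_closure:
  fixes V :: "'a::real_normed_vector set"
  assumes "subspace V"
  shows "subspace (closure V)"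
  unfolding subspace_def
proof (intro conjI ballI allI)
  show "0 \<in> closure V" using subspace_0[OF assms] closure_subset by blast
  fix x y and r :: real assume "x \<in> closure V" "y \<in> closure V"
  then obtain u v where u: "\<And>n. u n \<in> V" "u \<longlonglongrightarrow> x" and v: "\<And>n. v n \<in> V" "v \<longlonglongrightarrow> y"
    by (auto simp: closure_sequential)
  have "(\<lambda>n. u n + v n) \<longlonglongrightarrow> x + y" "(\<lambda>n. r *\<^sub>R u n) \<longlonglongrightarrow> r *\<^sub>R x"
    by (intro tendsto_intros u v)+
  moreover have "u n + v n \<in> V" "r *\<^sub>R u n \<in> V" for n
    using u v assms by (auto intro: subspace_add subspace_scale)
  ultimately show "x + y \<in> closure V" "r *\<^sub>R x \<in> closure V"
    unfolding closure_sequential by (metis (no_types, lifting))+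
qed

text \<open>A minimizing sequence for the distance from \<open>x\<close> to \<open>V\<close> is Cauchy by the parallelogram law; its
  limit \<open>y\<close> is a closest point, hence \<open>x - y\<close> is orthogonal to \<open>V\<close>.\<close>

lemma orthogonal_projection_exists:
  fixes V :: "'h::{real_inner, complete_space} set"
  assumes "subspace V" "closed V"
  obtains y where "y \<in> V" "\<And>v. v \<in> V \<Longrightarrow> inner (x - y) v = 0"
proof -
  define d where "d = infdist x V"
  have ne: "V \<noteq> {}" using subspace_0[OF assms(1)] by auto
  have d0: "d \<ge> 0" by (simp add: d_def infdist_nonneg)
  have d_le: "d \<le> dist x v" if "v \<in> V" for v
    unfolding d_def using infdist_le[OF that] .
  have "\<exists>y\<in>V. dist x y < d + 1 / Suc n" for n :: nat
  proof (rule ccontr)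
    assume "\<not> ?thesis"
    then have "d + 1 / Suc n \<le> infdist x V"
      unfolding infdist_def using ne by (auto intro!: cINF_greatest)
    moreover have "1 / real (Suc n) > 0" by simp
    ultimately show False using d_def by linarith
  qed
  then obtain y where yV: "\<And>n. y n \<in> V" and yd: "\<And>n. dist x (y n) < d + 1 / Suc n"
    by metis
  have lim0: "(\<lambda>n. d + 1 / real (Suc n)) \<longlonglongrightarrow> d"
    using LIMSEQ_inverse_real_of_nat_add[of d] by (simp add: inverse_eq_divide)
  have key: "(dist (y m) (y n))\<^sup>2 \<le> 4 * ((d + 1 / Suc N)\<^sup>2 - d\<^sup>2)" if "m \<ge> N" "n \<ge> N" for m n N
  proof -
    have *: "(norm (x - y k))\<^sup>2 \<le> (d + 1 / Suc N)\<^sup>2" if "k \<ge> N" for k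
    proof (rule power_mono)
      have "1 / real (Suc k) \<le> 1 / Suc N" using that by (intro divide_left_mono) auto
      then show "norm (x - y k) \<le> d + 1 / Suc N" using yd[of k] by (simp add: dist_norm)
    qed auto
    have mid: "(1/2) *\<^sub>R (y m + y n) \<in> V" using yV assms(1) by (simp add: subspace_add subspace_scale)
    have "(x - y m) + (x - y n) = 2 *\<^sub>R (x - (1/2) *\<^sub>R (y m + y n))"
      by (simp add: algebra_simps scaleR_2)
    then have "norm ((x - y m) + (x - y n)) = 2 * dist x ((1/2) *\<^sub>R (y m + y n))"
      by (simp add: dist_norm)
    then have "2 * d \<le> norm ((x - y m) + (x - y n))" using d_le[OF mid] by simp
    then have "(2 * d)\<^sup>2 \<le> (norm ((x - y m) + (x - y n)))\<^sup>2" using d0 by (intro power_mono) auto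
    moreover have "norm ((x - y m) - (x - y n)) = dist (y m) (y n)"
      by (simp add: dist_norm norm_minus_commute)
    ultimately show ?thesis
      using parallelogram[of "x - y m" "x - y n"] *[OF that(1)] *[OF that(2)]
      by (simp add: power_mult_distrib)
  qed
  have "Cauchy y"
  proof (rule metric_CauchyI)
    fix e :: real assume e: "e > 0"
    have "(\<lambda>n. 4 * ((d + 1 / real (Suc n))\<^sup>2 - d\<^sup>2)) \<longlonglongrightarrow> 4 * (d\<^sup>2 - d\<^sup>2)"
      by (intro tendsto_intros lim0)
    then have "\<forall>\<^sub>F n in sequentially. 4 * ((d + 1 / real (Suc n))\<^sup>2 - d\<^sup>2) < e\<^sup>2"
      using e by (intro order_tendstoD) auto
    then obtain N where N: "4 * ((d + 1 / real (Suc N))\<^sup>2 - d\<^sup>2) < e\<^sup>2"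
      by (auto simp: eventually_sequentially)
    have "dist (y m) (y n) < e" if "m \<ge> N" "n \<ge> N" for m n
      using key[OF that] N e power2_less_imp_less[of "dist (y m) (y n)" e] by linarith
    then show "\<exists>M. \<forall>m\<ge>M. \<forall>n\<ge>M. dist (y m) (y n) < e" by blast
  qed
  then obtain z where z: "y \<longlonglongrightarrow> z" using Cauchy_convergent_iff convergent_def by blast
  have zV: "z \<in> V" using closed_sequentially[OF assms(2)] yV z by blast
  have "dist x z \<le> d"
    by (rule LIMSEQ_le[OF tendsto_dist[OF tendsto_const z] lim0]) (use yd in \<open>auto intro: less_imp_le\<close>)
  have "inner (x - z) v = 0" if v: "v \<in> V" for v
  proof (rule ccontr)
    assume ne: "inner (x - z) v \<noteq> 0"
    then have v0: "v \<noteq> 0" by auto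
    \<comment> \<open>The value of \<open>t\<close> that minimizes the distance from \<open>x\<close> to \<open>z + t v\<close>.\<close>
    define t where "t = inner (x - z) v / inner v v"
    have "z + t *\<^sub>R v \<in> V" using zV v assms(1) by (simp add: subspace_add subspace_scale)
    then have "(dist x z)\<^sup>2 \<le> (norm ((x - z) - t *\<^sub>R v))\<^sup>2"
      using d_le[of "z + t *\<^sub>R v"] \<open>dist x z \<le> d\<close> by (intro power_mono) (auto simp: dist_norm algebra_simps)
    also have "\<dots> = (norm (x - z))\<^sup>2 - 2 * t * inner (x - z) v + t * t * inner v v"
      unfolding power2_norm_eq_inner by (simp add: inner_simps inner_commute algebra_simps)
    also have "\<dots> = (norm (x - z))\<^sup>2 - (inner (x - z) v)\<^sup>2 / inner v v"
      using v0 by (simp add: t_def field_simps power2_eq_square)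
    finally have "(inner (x - z) v)\<^sup>2 / inner v v \<le> 0" by (simp add: dist_norm)
    then show False using ne v0 by (simp add: divide_le_0_iff flip: inner_gt_zero_iff)
  qed
  then show ?thesis using that zV by blast
qed

text \<open>The representing vector is a multiple of any nonzero vector orthogonal to the kernel.\<close>

lemma riesz_representation:
  fixes f :: "'h::{real_inner, complete_space} \<Rightarrow> real"
  assumes f: "bounded_linear f"
  obtains z where "\<And>y. f y = inner z y"
proof (cases "\<forall>y. f y = 0")
  case True
  then show ?thesis using that[of 0] by simp
next
  case False
  then obtain x where x: "f x \<noteq> 0" by blast
  interpret bounded_linear f by fact
  have "subspace {y. f y = 0}" by (auto simp: subspace_def add scaleR zero)
  moreover have "closed {y. f y = 0}"
    by (intro closed_Collect_eq continuous_on continuous_on_const) (auto intro!: tendsto tendsto_intros)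
  ultimately obtain y where y: "f y = 0" and orth: "\<And>v. f v = 0 \<Longrightarrow> inner (x - y) v = 0"
    using orthogonal_projection_exists[of "{y. f y = 0}" x] by auto
  define w where "w = x - y"
  have fw: "f w \<noteq> 0" using x y by (simp add: w_def diff)
  then have w0: "w \<noteq> 0" using zero by auto
  show ?thesis
  proof (rule that[of "(f w / inner w w) *\<^sub>R w"])
    fix u
    have "inner w (u - (f u / f w) *\<^sub>R w) = 0"
      unfolding w_def by (rule orth) (use fw in \<open>simp add: w_def[symmetric] diff scaleR\<close>)
    then have "inner w u = f u / f w * inner w w" by (simp add: inner_simps)
    then show "f u = inner ((f w / inner w w) *\<^sub>R w) u" using fw w0 by simp
  qed
qed

section \<open>Adjoints, symmetric and positive operators\<close>

lemma bounded_ops_scaleC: "T \<in> bounded_ops \<Longrightarrow> T (c *\<^sub>C x) = c *\<^sub>C T x"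
  by (simp add: bounded_ops_def)

lemma bounded_ops_add: "S \<in> bounded_ops \<Longrightarrow> T \<in> bounded_ops \<Longrightarrow> S + T \<in> bounded_ops"
  by (simp add: bounded_ops_def blinfun.bilinear_simps scaleC_add_right)

lemma bounded_ops_diff: "S \<in> bounded_ops \<Longrightarrow> T \<in> bounded_ops \<Longrightarrow> S - T \<in> bounded_ops"
  by (simp add: bounded_ops_def blinfun.bilinear_simps complex_vector.scale_right_diff_distrib)

lemma bounded_ops_scaleR: "T \<in> bounded_ops \<Longrightarrow> r *\<^sub>R T \<in> bounded_ops"
  by (simp add: bounded_ops_def blinfun.bilinear_simps scaleC_scaleR)

lemma bounded_ops_compose: "S \<in> bounded_ops \<Longrightarrow> T \<in> bounded_ops \<Longrightarrow> S o\<^sub>L T \<in> bounded_ops"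
  by (simp add: bounded_ops_def)

lemma bounded_ops_id: "id_blinfun \<in> bounded_ops"
  by (simp add: bounded_ops_def)

lemma bounded_ops_0: "0 \<in> bounded_ops"
  by (simp add: bounded_ops_def)

lemma scaleC_op_apply [simp]: "scaleC_op c T x = c *\<^sub>C T x"
  by (simp add: scaleC_op.rep_eq)

lemma bounded_ops_scaleC_op: "T \<in> bounded_ops \<Longrightarrow> scaleC_op c T \<in> bounded_ops"
  by (simp add: bounded_ops_def scaleC_scaleC mult.commute)

lemma bounded_ops_limit:
  assumes "\<And>n. Y n \<in> bounded_ops" "Y \<longlonglongrightarrow> T"
  shows "T \<in> bounded_ops"
proof -
  have "T (c *\<^sub>C x) = c *\<^sub>C T x" for c x
  proof (rule LIMSEQ_unique)
    show "(\<lambda>n. Y n (c *\<^sub>C x)) \<longlonglongrightarrow> T (c *\<^sub>C x)"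
      by (intro blinfun.tendsto assms tendsto_const)
    have "(\<lambda>n. c *\<^sub>C Y n x) \<longlonglongrightarrow> c *\<^sub>C T x"
      by (intro bounded_linear.tendsto[OF bounded_linear_scaleC] blinfun.tendsto assms tendsto_const)
    then show "(\<lambda>n. Y n (c *\<^sub>C x)) \<longlonglongrightarrow> c *\<^sub>C T x"
      by (simp add: bounded_ops_scaleC[OF assms(1)])
  qed
  then show ?thesis by (simp add: bounded_ops_def)
qed

text \<open>For complex-linear operators, adjointness for the real part of the inner product is the same
  as adjointness for the complex inner product. All symmetry and positivity arguments below
  therefore use only the real inner product.\<close>

lemma cinner_adjointI:
  assumes "S \<in> bounded_ops" "T \<in> bounded_ops" "\<And>x y. inner (S x) y = inner x (T y)"
  shows "cinner (S x) y = cinner x (T y)"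
proof (rule complex_eqI)
  show "Re (cinner (S x) y) = Re (cinner x (T y))"
    using assms(3)[of x y] by (simp add: inner_eq_Re_cinner)
  show "Im (cinner (S x) y) = Im (cinner x (T y))"
    using assms(3)[of x "\<i> *\<^sub>C y"] by (simp add: Im_cinner bounded_ops_scaleC[OF assms(2)])
qed

lemma adjoint_exists:
  fixes T :: "'h::complex_hilbert_space \<Rightarrow>\<^sub>L 'h"
  assumes T: "T \<in> bounded_ops"
  obtains S where "S \<in> bounded_ops" "\<And>x y. inner (S x) y = inner x (T y)"
proof -
  have "\<exists>z. \<forall>y. inner x (T y) = inner z y" for x
  proof -
    have "bounded_linear (\<lambda>y. inner x (T y))"
      by (intro bounded_linear_intros)
    then show ?thesis using riesz_representation by metis
  qed
  then obtain S where S: "\<And>x y. inner x (T y) = inner (S x) y" by metis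
  have eqI: "u = v" if "\<And>y. inner u y = inner v y" for u v :: 'h
    using that by (metis inner_eq_zero_iff inner_diff_left eq_iff_diff_eq_0)
  have bl: "bounded_linear S"
  proof (rule bounded_linear_intro[of _ "norm T"])
    show "S (x + y) = S x + S y" for x y
      by (rule eqI) (simp add: S[symmetric] inner_add_left)
    show "S (r *\<^sub>R x) = r *\<^sub>R S x" for r x
      by (rule eqI) (simp add: S[symmetric])
    show "norm (S x) \<le> norm x * norm T" for x
    proof -
      have "norm (S x) * norm (S x) = inner x (T (S x))"
        by (simp add: S power2_norm_eq_inner[symmetric] power2_eq_square)
      also have "\<dots> \<le> norm x * norm (T (S x))" by (rule norm_cauchy_schwarz)
      also have "\<dots> \<le> norm x * (norm T * norm (S x))"
        by (intro mult_left_mono norm_blinfun) auto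
      finally show ?thesis
        by (cases "norm (S x) = 0") (auto simp: mult.assoc[symmetric])
    qed
  qed
  have app: "blinfun_apply (Blinfun S) = S" by (rule bounded_linear_Blinfun_apply[OF bl])
  show ?thesis
  proof (rule that[of "Blinfun S"])
    have "S (c *\<^sub>C x) = c *\<^sub>C S x" for c x
    proof (rule eqI)
      fix y
      have "inner (S (c *\<^sub>C x)) y = inner x (cnj c *\<^sub>C T y)"
        by (simp add: S[symmetric] inner_scaleC_swap)
      also have "\<dots> = inner (S x) (cnj c *\<^sub>C y)"
        by (simp add: S[symmetric] bounded_ops_scaleC[OF T])
      finally show "inner (S (c *\<^sub>C x)) y = inner (c *\<^sub>C S x) y" by (simp add: inner_scaleC_swap)
    qed
    then show "Blinfun S \<in> bounded_ops" by (simp add: bounded_ops_def app)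
  qed (simp add: app S)
qed

lemma adjoint_eqI:
  fixes T :: "'h::complex_hilbert_space \<Rightarrow>\<^sub>L 'h"
  assumes "S \<in> bounded_ops" "T \<in> bounded_ops" "\<And>x y. inner (S x) y = inner x (T y)"
  shows "adjoint T = S"
  unfolding adjoint_def
proof (rule the_equality)
  show "S \<in> bounded_ops \<and> (\<forall>x y. cinner (S x) y = cinner x (T y))"
    using assms cinner_adjointI by blast
  fix R assume R: "R \<in> bounded_ops \<and> (\<forall>x y. cinner (R x) y = cinner x (T y))"
  show "R = S"
  proof (rule blinfun_eqI)
    fix x
    have "inner (R x) y = inner (S x) y" for y
      using R assms(3)[of x y] by (simp add: inner_eq_Re_cinner)
    then have "inner (R x - S x) (R x - S x) = 0" by (simp add: inner_diff_left)
    then show "R x = S x" by simp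
  qed
qed

lemma
  assumes "T \<in> bounded_ops"
  shows adjoint_in_bounded_ops: "adjoint T \<in> bounded_ops"
    and inner_adjoint: "inner (adjoint T x) y = inner x (T y)"
proof -
  obtain S where S: "S \<in> bounded_ops" "\<And>x y. inner (S x) y = inner x (T y)"
    using adjoint_exists[OF assms] by metis
  have "adjoint T = S" using adjoint_eqI[OF S(1) assms S(2)] .
  then show "adjoint T \<in> bounded_ops" "inner (adjoint T x) y = inner x (T y)"
    using S by auto
qed

lemma inner_adjoint': "T \<in> bounded_ops \<Longrightarrow> inner x (adjoint T y) = inner (T x) y"
  by (metis inner_adjoint inner_commute)

lemma cinner_adjoint: "T \<in> bounded_ops \<Longrightarrow> cinner (adjoint T x) y = cinner x (T y)"
  by (intro cinner_adjointI adjoint_in_bounded_ops inner_adjoint)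

text \<open>Self-adjointness, expressed through the real inner product.\<close>

definition symmetric_op :: "('h::complex_hilbert_space \<Rightarrow>\<^sub>L 'h) \<Rightarrow> bool" where
  "symmetric_op T \<longleftrightarrow> T \<in> bounded_ops \<and> (\<forall>x y. inner (T x) y = inner x (T y))"

lemma symmetric_op_bounded: "symmetric_op T \<Longrightarrow> T \<in> bounded_ops"
  by (simp add: symmetric_op_def)

lemma symmetric_op_inner: "symmetric_op T \<Longrightarrow> inner (T x) y = inner x (T y)"
  by (simp add: symmetric_op_def)

lemma symmetric_op_cinner: "symmetric_op T \<Longrightarrow> cinner (T x) y = cinner x (T y)"
  by (rule cinner_adjointI) (auto simp: symmetric_op_def)

lemma symmetric_op_add: "symmetric_op S \<Longrightarrow> symmetric_op T \<Longrightarrow> symmetric_op (S + T)"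
  by (simp add: symmetric_op_def bounded_ops_add blinfun.bilinear_simps inner_simps)

lemma symmetric_op_diff: "symmetric_op S \<Longrightarrow> symmetric_op T \<Longrightarrow> symmetric_op (S - T)"
  by (simp add: symmetric_op_def bounded_ops_diff blinfun.bilinear_simps inner_simps)

lemma symmetric_op_scaleR: "symmetric_op T \<Longrightarrow> symmetric_op (r *\<^sub>R T)"
  by (simp add: symmetric_op_def bounded_ops_scaleR blinfun.bilinear_simps)

lemma symmetric_op_id: "symmetric_op id_blinfun"
  by (simp add: symmetric_op_def bounded_ops_id)

lemma symmetric_op_0: "symmetric_op 0"
  by (simp add: symmetric_op_def bounded_ops_0)

lemma symmetric_op_square: "symmetric_op T \<Longrightarrow> symmetric_op (T o\<^sub>L T)"
  by (simp add: symmetric_op_def bounded_ops_compose)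

lemma symmetric_op_limit:
  assumes "\<And>n. symmetric_op (Y n)" "Y \<longlonglongrightarrow> T"
  shows "symmetric_op T"
  unfolding symmetric_op_def
proof (intro conjI allI)
  show "T \<in> bounded_ops" using assms bounded_ops_limit symmetric_op_bounded by metis
  fix x y
  have "(\<lambda>n. inner (Y n x) y) \<longlonglongrightarrow> inner (T x) y"
    by (intro tendsto_intros blinfun.tendsto assms)
  moreover have "(\<lambda>n. inner x (Y n y)) \<longlonglongrightarrow> inner x (T y)"
    by (intro tendsto_intros blinfun.tendsto assms)
  ultimately show "inner (T x) y = inner x (T y)"
    using LIMSEQ_unique symmetric_op_inner[OF assms(1)] by simp
qed

text \<open>By polarization, an operator with real quadratic form is symmetric.\<close>

lemma positive_op_iff: "positive_op T \<longleftrightarrow> symmetric_op T \<and> (\<forall>x. 0 \<le> inner x (T x))"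
proof
  assume pos: "positive_op T"
  then have T: "T \<in> bounded_ops" and nonneg: "\<And>x. cinner x (T x) \<in> \<real>\<^sub>\<ge>\<^sub>0"
    by (auto simp: positive_op_def)
  have im: "Im (cinner x (T x)) = 0" for x
    using nonneg[of x] by (simp add: complex_nonneg_Reals_iff)
  have "inner (T x) y = inner x (T y)" for x y
  proof -
    have "Im (cinner (x + \<i> *\<^sub>C y) (T (x + \<i> *\<^sub>C y))) = 0" by (rule im)
    then have "Re (cinner x (T y)) - Re (cinner y (T x)) = 0"
      using im[of x] im[of y]
      by (simp add: cinner_simps blinfun.bilinear_simps bounded_ops_scaleC[OF T])
    then show ?thesis by (simp add: inner_eq_Re_cinner[symmetric] inner_commute)
  qed
  moreover have "0 \<le> inner x (T x)" for x
    using nonneg[of x] by (simp add: complex_nonneg_Reals_iff inner_eq_Re_cinner)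
  ultimately show "symmetric_op T \<and> (\<forall>x. 0 \<le> inner x (T x))"
    using T by (simp add: symmetric_op_def)
next
  assume *: "symmetric_op T \<and> (\<forall>x. 0 \<le> inner x (T x))"
  have "cinner x (T x) \<in> \<real>\<^sub>\<ge>\<^sub>0" for x
  proof -
    have "cinner x (T x) = cnj (cinner x (T x))"
      using * symmetric_op_cinner[of T x x] cinner_commute[of x "T x"] by metis
    then have "Im (cinner x (T x)) = - Im (cinner x (T x))" by (metis cnj.simps(2))
    then show ?thesis using * by (simp add: complex_nonneg_Reals_iff inner_eq_Re_cinner)
  qed
  then show "positive_op T" using * by (simp add: positive_op_def symmetric_op_def)
qed

lemma positive_op_symmetric: "positive_op T \<Longrightarrow> symmetric_op T"
  by (simp add: positive_op_iff)

lemma positive_op_bounded: "positive_op T \<Longrightarrow> T \<in> bounded_ops"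
  by (simp add: positive_op_def)

lemma positive_op_nonneg: "positive_op T \<Longrightarrow> 0 \<le> inner x (T x)"
  by (simp add: positive_op_iff)

lemma positive_op_add: "positive_op S \<Longrightarrow> positive_op T \<Longrightarrow> positive_op (S + T)"
  by (simp add: positive_op_iff symmetric_op_add blinfun.bilinear_simps inner_add_right)

lemma positive_op_scaleR: "positive_op T \<Longrightarrow> 0 \<le> r \<Longrightarrow> positive_op (r *\<^sub>R T)"
  by (simp add: positive_op_iff symmetric_op_scaleR blinfun.bilinear_simps)

lemma positive_op_0: "positive_op 0"
  by (simp add: positive_op_iff symmetric_op_0)

lemma quadratic_form_limit_nonneg:
  fixes Y :: "nat \<Rightarrow> 'h::complex_hilbert_space \<Rightarrow>\<^sub>L 'h" and T :: "'h::complex_hilbert_space \<Rightarrow>\<^sub>L 'h"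
  assumes "\<forall>\<^sub>F n in sequentially. 0 \<le> inner x (Y n x)" "Y \<longlonglongrightarrow> T"
  shows "0 \<le> inner x (T x)"
proof (rule tendsto_lowerbound[OF _ assms(1)])
  show "(\<lambda>n. inner x (Y n x)) \<longlonglongrightarrow> inner x (T x)"
    by (intro tendsto_intros blinfun.tendsto assms(2))
qed simp

subsection \<open>The square root of a positive operator\<close>

text \<open>If \<open>0 \<le> T \<le> 1\<close> and \<open>X = 1 - T\<close>, the iteration \<open>Y\<^sub>0 = 0\<close>, \<open>Y\<^sub>n\<^sub>+\<^sub>1 = (X + Y\<^sub>n\<^sup>2) / 2\<close> converges in
  norm, being dominated by the scalar iteration with \<open>X\<close> replaced by \<open>1\<close>. Its limit satisfies
  \<open>(1 - Y)\<^sup>2 = T\<close>.\<close>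

fun sqrt_iter :: "('h::complex_hilbert_space \<Rightarrow>\<^sub>L 'h) \<Rightarrow> nat \<Rightarrow> ('h \<Rightarrow>\<^sub>L 'h)" where
  "sqrt_iter X 0 = 0"
| "sqrt_iter X (Suc n) = (1/2) *\<^sub>R (X + (sqrt_iter X n o\<^sub>L sqrt_iter X n))"

fun sqrt_iter_real :: "nat \<Rightarrow> real" where
  "sqrt_iter_real 0 = 0"
| "sqrt_iter_real (Suc n) = (1 + sqrt_iter_real n * sqrt_iter_real n) / 2"

lemma sqrt_iter_real_bounds: "0 \<le> sqrt_iter_real n \<and> sqrt_iter_real n \<le> 1"
proof (induction n)
  case (Suc n)
  then have "sqrt_iter_real n * sqrt_iter_real n \<le> 1 * 1" by (intro mult_mono) auto
  then show ?case using Suc by simp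
qed simp

lemma sqrt_iter_real_mono: "sqrt_iter_real n \<le> sqrt_iter_real (Suc n)"
proof -
  have "0 \<le> (1 - sqrt_iter_real n)\<^sup>2" by simp
  then show ?thesis by (simp add: power2_eq_square algebra_simps)
qed

lemma norm_sqrt_iter:
  assumes "norm X \<le> 1"
  shows "norm (sqrt_iter X n) \<le> sqrt_iter_real n"
proof (induction n)
  case (Suc n)
  have "norm (sqrt_iter X n o\<^sub>L sqrt_iter X n) \<le> sqrt_iter_real n * sqrt_iter_real n"
    by (rule order.trans[OF norm_blinfun_compose]) (use Suc sqrt_iter_real_bounds in \<open>auto intro: mult_mono\<close>)
  then show ?case using assms norm_triangle_ineq[of X "sqrt_iter X n o\<^sub>L sqrt_iter X n"] by simp
qed simp

lemma norm_sqrt_iter_diff: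
  assumes "norm X \<le> 1"
  shows "norm (sqrt_iter X (Suc n) - sqrt_iter X n) \<le> sqrt_iter_real (Suc n) - sqrt_iter_real n"
proof (induction n)
  case 0
  then show ?case using assms by simp
next
  case (Suc n)
  let ?Y = "sqrt_iter X (Suc n)" and ?Z = "sqrt_iter X n"
  let ?y = "sqrt_iter_real (Suc n)" and ?z = "sqrt_iter_real n"
  note B = sqrt_iter_real_bounds[of n] sqrt_iter_real_bounds[of "Suc n"]
  have "sqrt_iter X (Suc (Suc n)) - ?Y = (1/2) *\<^sub>R (X + (?Y o\<^sub>L ?Y)) - (1/2) *\<^sub>R (X + (?Z o\<^sub>L ?Z))"
    by simp
  also have "\<dots> = (1/2) *\<^sub>R ((?Y o\<^sub>L (?Y - ?Z)) + ((?Y - ?Z) o\<^sub>L ?Z))"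
    by (simp del: sqrt_iter.simps add: bounded_bilinear.diff_left[OF bounded_bilinear_blinfun_compose]
        bounded_bilinear.diff_right[OF bounded_bilinear_blinfun_compose] algebra_simps)
  finally have "norm (sqrt_iter X (Suc (Suc n)) - ?Y)
      = norm ((?Y o\<^sub>L (?Y - ?Z)) + ((?Y - ?Z) o\<^sub>L ?Z)) / 2" by simp
  also have "\<dots> \<le> (?y * (?y - ?z) + (?y - ?z) * ?z) / 2"
  proof -
    have "norm (?Y o\<^sub>L (?Y - ?Z)) \<le> ?y * (?y - ?z)"
      by (rule order.trans[OF norm_blinfun_compose])
         (intro mult_mono Suc norm_sqrt_iter[OF assms], use B in auto)
    moreover have "norm ((?Y - ?Z) o\<^sub>L ?Z) \<le> (?y - ?z) * ?z"
      by (rule order.trans[OF norm_blinfun_compose])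
         (intro mult_mono Suc norm_sqrt_iter[OF assms], use B sqrt_iter_real_mono[of n] in auto)
    ultimately show ?thesis
      using norm_triangle_ineq[of "?Y o\<^sub>L (?Y - ?Z)" "(?Y - ?Z) o\<^sub>L ?Z"] by argo
  qed
  also have "\<dots> = sqrt_iter_real (Suc (Suc n)) - ?y"
    by (simp add: field_simps)
  finally show ?case .
qed

lemma sqrt_iter_convergent:
  assumes "norm X \<le> 1"
  shows "convergent (sqrt_iter X)"
proof -
  have "convergent sqrt_iter_real"
    using sqrt_iter_real_bounds
    by (intro Bseq_monoseq_convergent BseqI'[of _ 1] mono_SucI1) (auto simp del: sqrt_iter_real.simps intro: sqrt_iter_real_mono)
  then have "Cauchy sqrt_iter_real" by (simp add: convergent_Cauchy)
  have dist: "norm (sqrt_iter X (m + k) - sqrt_iter X m) \<le> sqrt_iter_real (m + k) - sqrt_iter_real m" for m k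
  proof (induction k)
    case (Suc k)
    have "norm (sqrt_iter X (m + Suc k) - sqrt_iter X m)
      \<le> norm (sqrt_iter X (Suc (m + k)) - sqrt_iter X (m + k)) + norm (sqrt_iter X (m + k) - sqrt_iter X m)"
      using norm_triangle_ineq[of "sqrt_iter X (Suc (m + k)) - sqrt_iter X (m + k)"
            "sqrt_iter X (m + k) - sqrt_iter X m"] by simp
    then show ?case using Suc norm_sqrt_iter_diff[OF assms, of "m + k"] by (simp del: sqrt_iter.simps sqrt_iter_real.simps)
  qed simp
  have dist': "norm (sqrt_iter X n - sqrt_iter X m) \<le> \<bar>sqrt_iter_real n - sqrt_iter_real m\<bar>" for m n
    using dist[of m "n - m"] dist[of n "m - n"]
    by (cases "m \<le> n") (auto simp: norm_minus_commute abs_minus_commute)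
  have "Cauchy (sqrt_iter X)"
  proof (rule metric_CauchyI)
    fix e :: real assume "e > 0"
    then obtain M where "\<And>m n. m \<ge> M \<Longrightarrow> n \<ge> M \<Longrightarrow> dist (sqrt_iter_real m) (sqrt_iter_real n) < e"
      using \<open>Cauchy sqrt_iter_real\<close> metric_CauchyD by metis
    then show "\<exists>M. \<forall>m\<ge>M. \<forall>n\<ge>M. dist (sqrt_iter X m) (sqrt_iter X n) < e"
      using dist' by (metis dist_norm dist_real_def order_le_less_trans)
  qed
  then show ?thesis by (simp add: Cauchy_convergent_iff)
qed

text \<open>The Cauchy-Schwarz inequality for the form of a positive operator. It implies that a bound for
  the quadratic form is a bound for the norm.\<close>

lemma positive_op_cauchy_schwarz:
  assumes "positive_op T"
  shows "(inner x (T y))\<^sup>2 \<le> inner x (T x) * inner y (T y)"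
proof -
  note T = positive_op_nonneg[OF assms] symmetric_op_inner[OF positive_op_symmetric[OF assms]]
  have sym: "inner y (T x) = inner x (T y)" using T(2)[of y x] by (simp add: inner_commute)
  have quad: "0 \<le> inner x (T x) + 2 * t * inner x (T y) + t\<^sup>2 * inner y (T y)" for t
  proof -
    have "0 \<le> inner (x + t *\<^sub>R y) (T (x + t *\<^sub>R y))" by (rule T)
    also have "\<dots> = inner x (T x) + 2 * t * inner x (T y) + t\<^sup>2 * inner y (T y)"
      by (simp add: blinfun.bilinear_simps inner_simps sym power2_eq_square algebra_simps)
    finally show ?thesis .
  qed
  show ?thesis
  proof (cases "inner y (T y) = 0")
    case True
    have "inner x (T y) = 0"
    proof (rule ccontr)
      assume "inner x (T y) \<noteq> 0"
      then show False using quad[of "- (inner x (T x) + 1) / (2 * inner x (T y))"] True by (simp add: field_simps)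
    qed
    then show ?thesis using True by simp
  next
    case False
    then have "inner y (T y) > 0" using T(1)[of y] by simp
    then show ?thesis using quad[of "- inner x (T y) / inner y (T y)"]
      by (simp add: power2_eq_square field_simps)
  qed
qed

lemma norm_le_of_quadratic_form:
  assumes "positive_op T" "\<And>x. inner x (T x) \<le> c * (norm x)\<^sup>2"
  shows "norm (T x) \<le> c * norm x"
proof (cases "T x = 0")
  case False
  then have x0: "x \<noteq> 0" by auto
  have "0 \<le> c * (norm x)\<^sup>2" using positive_op_nonneg[OF assms(1), of x] assms(2)[of x] by linarith
  then have c0: "0 \<le> c" using x0 by (simp add: zero_le_mult_iff)
  have "(inner (T x) (T x))\<^sup>2 \<le> inner (T x) (T (T x)) * inner x (T x)"
    by (rule positive_op_cauchy_schwarz[OF assms(1)])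
  also have "\<dots> \<le> (c * (norm (T x))\<^sup>2) * (c * (norm x)\<^sup>2)"
    using positive_op_nonneg[OF assms(1)] c0 by (intro mult_mono assms) auto
  finally have "(norm (T x))\<^sup>2 * (norm (T x))\<^sup>2 \<le> (norm (T x))\<^sup>2 * (c * norm x)\<^sup>2"
    by (simp add: power2_norm_eq_inner[symmetric] power2_eq_square mult_ac)
  moreover have "0 < (norm (T x))\<^sup>2" using False by simp
  ultimately have "(norm (T x))\<^sup>2 \<le> (c * norm x)\<^sup>2" by (rule mult_left_le_imp_le)
  then show ?thesis by (rule power2_le_imp_le) (use c0 in auto)
next
  case True
  have "0 \<le> c * (norm x)\<^sup>2" using positive_op_nonneg[OF assms(1), of x] assms(2)[of x] by linarith
  moreover have "x = 0 \<or> 0 < (norm x)\<^sup>2" by auto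
  ultimately show ?thesis using True by (auto simp: zero_le_mult_iff)
qed

text \<open>The square root commutes with everything that commutes with \<open>T\<close>, because the iterates do.\<close>

lemma positive_sqrt_exists:
  fixes T :: "'h::complex_hilbert_space \<Rightarrow>\<^sub>L 'h"
  assumes T: "positive_op T"
  obtains A where "positive_op A" "A o\<^sub>L A = T" "\<And>S. S o\<^sub>L T = T o\<^sub>L S \<Longrightarrow> S o\<^sub>L A = A o\<^sub>L S"
proof -
  have main: thesis' if T: "positive_op T" and le: "norm T \<le> 1"
    and that': "\<And>A. positive_op A \<Longrightarrow> A o\<^sub>L A = T \<Longrightarrow> (\<And>S. S o\<^sub>L T = T o\<^sub>L S \<Longrightarrow> S o\<^sub>L A = A o\<^sub>L S) \<Longrightarrow> thesis'"
    for thesis' and T :: "'h \<Rightarrow>\<^sub>L 'h"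
  proof -
    define X where "X = id_blinfun - T"
    have symX: "symmetric_op X" unfolding X_def
      by (intro symmetric_op_diff symmetric_op_id positive_op_symmetric T)
    have form: "inner x (T x) \<le> inner x x" for x
    proof -
      have "inner x (T x) \<le> norm x * norm (T x)" by (rule norm_cauchy_schwarz)
      also have "\<dots> \<le> norm x * (norm T * norm x)" by (intro mult_left_mono norm_blinfun) auto
      also have "\<dots> \<le> norm x * (1 * norm x)" by (intro mult_left_mono mult_right_mono le) auto
      finally show ?thesis by (simp add: power2_norm_eq_inner[symmetric] power2_eq_square)
    qed
    have posX: "positive_op X"
      using symX form by (simp add: positive_op_iff X_def blinfun.bilinear_simps inner_simps)
    have "norm (X x) \<le> 1 * norm x" for x
      using positive_op_nonneg[OF T]
      by (intro norm_le_of_quadratic_form posX)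
        (simp add: X_def blinfun.bilinear_simps inner_simps power2_norm_eq_inner)
    then have nX: "norm X \<le> 1" by (intro norm_blinfun_bound) auto
    obtain Y where Y: "sqrt_iter X \<longlonglongrightarrow> Y"
      using sqrt_iter_convergent[OF nX] convergent_def by blast
    have "sqrt_iter X n o\<^sub>L S = S o\<^sub>L sqrt_iter X n" if "X o\<^sub>L S = S o\<^sub>L X" for n S
    proof (induction n)
      case (Suc n)
      have "X (S x) = S (X x)" "sqrt_iter X n (S x) = S (sqrt_iter X n x)" for x
        using that Suc blinfun_apply_blinfun_compose by metis+
      then show ?case by (intro blinfun_eqI) (simp add: blinfun.bilinear_simps)
    qed (auto intro: blinfun_eqI)
    then have commY: "Y o\<^sub>L S = S o\<^sub>L Y" if "X o\<^sub>L S = S o\<^sub>L X" for S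
      using that LIMSEQ_unique[OF
        bounded_bilinear.tendsto[OF bounded_bilinear_blinfun_compose Y tendsto_const[of S]]]
        bounded_bilinear.tendsto[OF bounded_bilinear_blinfun_compose tendsto_const[of S] Y] by simp
    have "symmetric_op (sqrt_iter X n)" for n
      by (induction n) (auto intro: symmetric_op_0 symmetric_op_scaleR symmetric_op_add symX symmetric_op_square)
    then have symY: "symmetric_op Y" using symmetric_op_limit Y by blast
    have "norm Y \<le> 1"
    proof (rule LIMSEQ_le_const2[OF tendsto_norm[OF Y]])
      show "\<exists>N. \<forall>n\<ge>N. norm (sqrt_iter X n) \<le> 1"
        using norm_sqrt_iter[OF nX] sqrt_iter_real_bounds order.trans by blast
    qed
    have formY: "inner x (Y x) \<le> inner x x" for x
    proof -
      have "inner x (Y x) \<le> norm x * norm (Y x)" by (rule norm_cauchy_schwarz)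
      also have "\<dots> \<le> norm x * (norm Y * norm x)" by (intro mult_left_mono norm_blinfun) auto
      also have "\<dots> \<le> norm x * (1 * norm x)"
        by (intro mult_left_mono mult_right_mono \<open>norm Y \<le> 1\<close>) auto
      finally show ?thesis by (simp add: power2_norm_eq_inner[symmetric] power2_eq_square)
    qed
    have "(\<lambda>n. (1/2) *\<^sub>R (X + (sqrt_iter X n o\<^sub>L sqrt_iter X n))) \<longlonglongrightarrow> (1/2) *\<^sub>R (X + (Y o\<^sub>L Y))"
      by (intro tendsto_intros bounded_bilinear.tendsto[OF bounded_bilinear_blinfun_compose] Y)
    moreover have "(\<lambda>n. (1/2) *\<^sub>R (X + (sqrt_iter X n o\<^sub>L sqrt_iter X n))) \<longlonglongrightarrow> Y"
      using LIMSEQ_Suc[OF Y] by simp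
    ultimately have fix_eq: "Y = (1/2) *\<^sub>R (X + (Y o\<^sub>L Y))" using LIMSEQ_unique by blast
    have eq2: "Y x + Y x = X x + Y (Y x)" for x
    proof -
      have "Y x = (1/2) *\<^sub>R (X x + Y (Y x))"
        using arg_cong[OF fix_eq, of "\<lambda>Z. blinfun_apply Z x"] by (simp add: blinfun.bilinear_simps)
      then have "2 *\<^sub>R Y x = X x + Y (Y x)" by (metis scaleR_half_double scaleR_2 scaleR_add_right)
      then show ?thesis by (simp add: scaleR_2)
    qed
    let ?A = "id_blinfun - Y"
    show thesis'
    proof (rule that')
      show "positive_op ?A"
        using formY by (simp add: positive_op_iff symmetric_op_diff symmetric_op_id symY
            blinfun.bilinear_simps inner_simps)
      show "?A o\<^sub>L ?A = T"
      proof (rule blinfun_eqI)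
        fix x
        have "(?A o\<^sub>L ?A) x = x - (Y x + Y x) + Y (Y x)"
          by (simp add: blinfun.bilinear_simps)
        also have "\<dots> = T x" unfolding eq2 by (simp add: X_def blinfun.bilinear_simps)
        finally show "(?A o\<^sub>L ?A) x = T x" .
      qed
      fix S assume "S o\<^sub>L T = T o\<^sub>L S"
      then have "T (S x) = S (T x)" for x using blinfun_apply_blinfun_compose by metis
      then have "X o\<^sub>L S = S o\<^sub>L X" by (intro blinfun_eqI) (simp add: X_def blinfun.bilinear_simps)
      then have "Y (S x) = S (Y x)" for x using commY blinfun_apply_blinfun_compose by metis
      then show "S o\<^sub>L ?A = ?A o\<^sub>L S" by (intro blinfun_eqI) (simp add: blinfun.bilinear_simps)
    qed
  qed
  \<comment> \<open>Reduction to norm at most \<open>1\<close>; the summand \<open>1\<close> avoids division by zero.\<close>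
  define r where "r = norm T + 1"
  have r: "r > 0" using norm_ge_zero[of T] by (simp add: r_def add_nonneg_pos)
  have pos: "positive_op ((1 / r) *\<^sub>R T)" using r by (intro positive_op_scaleR T) auto
  have le: "norm ((1 / r) *\<^sub>R T) \<le> 1" using r by (simp add: r_def)
  show ?thesis
  proof (rule main[OF pos le])
    fix A assume A: "positive_op A" "A o\<^sub>L A = (1 / r) *\<^sub>R T"
      "\<And>S. S o\<^sub>L (1 / r) *\<^sub>R T = (1 / r) *\<^sub>R T o\<^sub>L S \<Longrightarrow> S o\<^sub>L A = A o\<^sub>L S"
    have AA: "A (A x) = (1 / r) *\<^sub>R T x" for x
      using A(2) blinfun_apply_blinfun_compose by (metis blinfun.scaleR_left)
    show ?thesis
    proof (rule that[of "sqrt r *\<^sub>R A"])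
      show "positive_op (sqrt r *\<^sub>R A)" using r by (intro positive_op_scaleR A(1)) auto
      show "(sqrt r *\<^sub>R A) o\<^sub>L (sqrt r *\<^sub>R A) = T"
        by (intro blinfun_eqI) (use r in \<open>simp add: blinfun.bilinear_simps AA\<close>)
      fix S assume "S o\<^sub>L T = T o\<^sub>L S"
      then have "T (S x) = S (T x)" for x using blinfun_apply_blinfun_compose by metis
      then have "S o\<^sub>L (1 / r) *\<^sub>R T = (1 / r) *\<^sub>R T o\<^sub>L S"
        by (intro blinfun_eqI) (simp add: blinfun.bilinear_simps)
      then have "S o\<^sub>L A = A o\<^sub>L S" by (rule A(3))
      then have "A (S x) = S (A x)" for x using blinfun_apply_blinfun_compose by metis
      then show "S o\<^sub>L sqrt r *\<^sub>R A = sqrt r *\<^sub>R A o\<^sub>L S"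
        by (intro blinfun_eqI) (simp add: blinfun.bilinear_simps)
    qed
  qed
qed

text \<open>The operator \<open>A\<close> below is \<open>\<bar>T\<bar>\<close>, the square root of \<open>T\<^sup>2\<close>. Since \<open>P = A - T\<close> and
  \<open>Q = A + T\<close> satisfy \<open>PQ = QP = 0\<close> and \<open>P + Q \<ge> 0\<close>, the form of \<open>P\<close> is nonnegative on the range
  of \<open>P\<close>, and it vanishes on the orthogonal complement.\<close>

lemma absolute_value_exists:
  fixes T :: "'h::complex_hilbert_space \<Rightarrow>\<^sub>L 'h"
  assumes T: "symmetric_op T"
  obtains A where "positive_op A" "positive_op (A - T)" "positive_op (A + T)"
    "\<And>x. norm (A x) = norm (T x)"
proof -
  have "inner x (T (T x)) = inner (T x) (T x)" for x
    using symmetric_op_inner[OF T, of x "T x"] by simp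
  then have "positive_op (T o\<^sub>L T)"
    by (simp add: positive_op_iff symmetric_op_square[OF T])
  then obtain A where A: "positive_op A" "A o\<^sub>L A = T o\<^sub>L T"
    and comm: "\<And>S. S o\<^sub>L (T o\<^sub>L T) = (T o\<^sub>L T) o\<^sub>L S \<Longrightarrow> S o\<^sub>L A = A o\<^sub>L S"
    using positive_sqrt_exists by blast
  have symA: "symmetric_op A" by (rule positive_op_symmetric[OF A(1)])
  have "T o\<^sub>L A = A o\<^sub>L T" by (rule comm) (simp add: blinfun_eqI)
  then have TA: "T (A x) = A (T x)" for x using blinfun_apply_blinfun_compose by metis
  have AA: "A (A x) = T (T x)" for x using A(2) blinfun_apply_blinfun_compose by metis
  have pos: "0 \<le> inner x (P x)" if P: "symmetric_op P" and Q: "\<And>x. Q (P x) = 0"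
    and PQ: "P + Q = 2 *\<^sub>R A" for P Q :: "'h \<Rightarrow>\<^sub>L 'h" and x
  proof -
    define V where "V = closure (range P)"
    have "linear P" using blinfun.bounded_linear_right bounded_linear.linear by blast
    then have "subspace (range P)" by (intro linear_subspace_image) (auto simp: subspace_UNIV)
    then have "subspace V" unfolding V_def by (rule subspace_closure)
    then obtain u where u: "u \<in> V" "\<And>v. v \<in> V \<Longrightarrow> inner (x - u) v = 0"
      using orthogonal_projection_exists[of V x] by (auto simp: V_def)
    have "inner (P (x - u)) y = 0" for y
      using u(2)[of "P y"] closure_subset[of "range P"] by (auto simp: V_def symmetric_op_inner[OF P])
    then have "P (x - u) = 0" by (metis inner_eq_zero_iff)
    then have Pxu: "P x = P u" by (simp add: blinfun.bilinear_simps)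
    have "0 \<le> inner v (P v)" if "v \<in> V" for v
    proof -
      have "closed {v. 0 \<le> inner v (P v)}"
        by (intro closed_Collect_le continuous_intros)
      moreover have "range P \<subseteq> {v. 0 \<le> inner v (P v)}"
      proof clarify
        fix y
        have "inner (P y) (P (P y)) = inner (P y) ((P + Q) (P y))"
          by (simp add: blinfun.bilinear_simps Q)
        also have "\<dots> = 2 * inner (P y) (A (P y))" by (simp add: PQ blinfun.bilinear_simps)
        finally show "0 \<le> inner (P y) (P (P y))" using positive_op_nonneg[OF A(1)] by simp
      qed
      ultimately have "V \<subseteq> {v. 0 \<le> inner v (P v)}" unfolding V_def by (intro closure_minimal)
      then show ?thesis using that by blast
    qed
    then have "0 \<le> inner u (P u)" using u by blast
    also have "inner u (P u) = inner (P u) x" using symmetric_op_inner[OF P, of u x] by (simp add: Pxu)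
    also have "\<dots> = inner x (P x)" by (simp add: Pxu inner_commute)
    finally show ?thesis .
  qed
  show ?thesis
  proof (rule that[of A])
    have s: "symmetric_op (A - T)" "symmetric_op (A + T)"
      using symA T by (auto intro: symmetric_op_diff symmetric_op_add)
    have "0 \<le> inner x ((A - T) x)" for x
    proof (rule pos[where P = "A - T" and Q = "A + T"])
      show "(A + T) ((A - T) y) = 0" for y by (simp add: blinfun.bilinear_simps TA AA)
      show "(A - T) + (A + T) = 2 *\<^sub>R A" by (simp add: scaleR_2)
    qed (rule s)
    then show "positive_op (A - T)" using s by (simp add: positive_op_iff)
    have "0 \<le> inner x ((A + T) x)" for x
    proof (rule pos[where P = "A + T" and Q = "A - T"])
      show "(A - T) ((A + T) y) = 0" for y by (simp add: blinfun.bilinear_simps TA AA)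
      show "(A + T) + (A - T) = 2 *\<^sub>R A" by (simp add: scaleR_2)
    qed (rule s)
    then show "positive_op (A + T)" using s by (simp add: positive_op_iff)
    fix x
    have "inner (A x) (A x) = inner (T x) (T x)"
      by (simp add: symmetric_op_inner[OF symA] symmetric_op_inner[OF T] AA)
    then show "norm (A x) = norm (T x)" by (simp add: norm_eq_sqrt_inner)
  qed (rule A)
qed

section \<open>Finite orthonormal families and the trace\<close>

abbreviation cspan :: "'h::complex_hilbert_space set \<Rightarrow> 'h set" where
  "cspan \<equiv> complex_vector.span"

text \<open>Orthonormality for the complex inner product; the set may be infinite.\<close>

definition orthonormal :: "'h::complex_hilbert_space set \<Rightarrow> bool" where
  "orthonormal E \<longleftrightarrow> (\<forall>e\<in>E. norm e = 1) \<and> pairwise (\<lambda>e f. cinner e f = 0) E"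

text \<open>The orthogonal complement \<open>F\<^sup>\<bottom>\<close> of a set of vectors.\<close>

definition orth :: "'h::complex_hilbert_space set \<Rightarrow> 'h set" where
  "orth F = {x. \<forall>f\<in>F. cinner f x = 0}"

lemma orthD: "x \<in> orth F \<Longrightarrow> f \<in> F \<Longrightarrow> cinner f x = 0"
  by (simp add: orth_def)

lemma orthonormal_subset: "orthonormal E \<Longrightarrow> G \<subseteq> E \<Longrightarrow> orthonormal G"
  by (auto simp: orthonormal_def pairwise_def)

lemma orthonormal_empty: "orthonormal {}"
  by (simp add: orthonormal_def)

lemma orthonormal_cinner:
  assumes "orthonormal E" "e \<in> E" "f \<in> E"
  shows "cinner e f = (if e = f then 1 else 0)"
  using assms by (auto simp: orthonormal_def pairwise_def cinner_self)

lemma orthonormal_insert: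
  assumes "orthonormal E" "norm u = 1" "u \<in> orth E"
  shows "orthonormal (insert u E)" "u \<notin> E"
proof -
  show "orthonormal (insert u E)"
    using assms by (auto simp: orthonormal_def pairwise_def orth_def cinner_eq_0_commute)
  show "u \<notin> E"
    using assms orthD[of u E u] by (auto simp: cinner_self)
qed

lemma norm_sum_orthonormal:
  assumes "orthonormal E" "finite E"
  shows "(norm (\<Sum>e\<in>E. c e *\<^sub>C e))\<^sup>2 = (\<Sum>e\<in>E. (cmod (c e))\<^sup>2)"
proof -
  have "complex_of_real ((norm (\<Sum>e\<in>E. c e *\<^sub>C e))\<^sup>2) =
      (\<Sum>f\<in>E. \<Sum>e\<in>E. c f * (cnj (c e) * (if e = f then 1 else 0)))"
    unfolding cinner_self[symmetric] cinner_sum_left cinner_sum_right cinner_scaleC_left cinner_scaleC_right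
    by (intro sum.cong refl) (simp add: orthonormal_cinner[OF assms(1)] sum_distrib_left mult_ac)
  also have "\<dots> = (\<Sum>f\<in>E. complex_of_real ((cmod (c f))\<^sup>2))"
    unfolding complex_norm_square
    by (intro sum.cong refl) (simp add: assms(2) if_distrib sum.delta' cong: if_cong)
  finally have "complex_of_real ((norm (\<Sum>e\<in>E. c e *\<^sub>C e))\<^sup>2) = complex_of_real (\<Sum>f\<in>E. (cmod (c f))\<^sup>2)"
    by simp
  then show ?thesis using of_real_eq_iff by blast
qed

text \<open>The operator \<open>x \<mapsto> \<langle>e, x\<rangle> e\<close>, which for a unit vector \<open>e\<close> is the projection onto its span.\<close>

lift_definition rank_one :: "'h::complex_hilbert_space \<Rightarrow> 'h \<Rightarrow>\<^sub>L 'h" is "\<lambda>e x. cinner e x *\<^sub>C e"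
proof -
  fix e :: 'h
  show "bounded_linear (\<lambda>x. cinner e x *\<^sub>C e)"
  proof (rule bounded_linear_intro[of _ "norm e * norm e"])
    show "norm (cinner e x *\<^sub>C e) \<le> norm x * (norm e * norm e)" for x
      using mult_right_mono[OF norm_cinner_le[of e x], of "norm e"] by (simp add: norm_scaleC mult_ac)
  qed (simp_all add: cinner_simps scaleC_add_left scaleC_scaleC scaleC_of_real flip: scaleC_of_real)
qed

lemma symmetric_op_rank_one: "symmetric_op (rank_one e)"
  unfolding symmetric_op_def bounded_ops_def
proof (intro conjI CollectI allI)
  show "rank_one e (c *\<^sub>C x) = c *\<^sub>C rank_one e x" for c x
    by (simp add: rank_one.rep_eq cinner_simps scaleC_scaleC)
  fix x y
  have "cinner (rank_one e x) y = cinner x (rank_one e y)"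
    by (simp add: rank_one.rep_eq cinner_simps flip: cinner_commute)
  then show "inner (rank_one e x) y = inner x (rank_one e y)" by (simp add: inner_eq_Re_cinner)
qed

lemma inner_rank_one: "inner x (rank_one e x) = (cmod (cinner e x))\<^sup>2"
proof -
  have "cinner e x * cinner x e = complex_of_real ((cmod (cinner e x))\<^sup>2)"
    by (metis cinner_commute complex_norm_square)
  then show ?thesis by (simp add: rank_one.rep_eq inner_eq_Re_cinner cinner_simps)
qed

text \<open>For a finite orthonormal set \<open>E\<close> this is the orthogonal projection onto the span of \<open>E\<close>.\<close>

definition onproj :: "'h::complex_hilbert_space set \<Rightarrow> 'h \<Rightarrow>\<^sub>L 'h" where
  "onproj E = (\<Sum>e\<in>E. rank_one e)"

lemma onproj_apply: "onproj E x = (\<Sum>e\<in>E. cinner e x *\<^sub>C e)"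
  by (simp add: onproj_def blinfun.sum_left rank_one.rep_eq)

lemma symmetric_op_onproj: "symmetric_op (onproj E)"
  unfolding onproj_def
  by (induction E rule: infinite_finite_induct)
     (simp_all add: symmetric_op_0 symmetric_op_add symmetric_op_rank_one)

lemma onproj_in_span: "onproj E x \<in> cspan E"
  unfolding onproj_apply
  by (intro complex_vector.span_sum complex_vector.span_scale complex_vector.span_base)

lemma inner_onproj: "inner x (onproj E x) = (\<Sum>e\<in>E. (cmod (cinner e x))\<^sup>2)"
  by (simp add: onproj_def blinfun.sum_left inner_sum_right inner_rank_one)

lemma norm_onproj:
  assumes "orthonormal E" "finite E"
  shows "(norm (onproj E x))\<^sup>2 = (\<Sum>e\<in>E. (cmod (cinner e x))\<^sup>2)"
  unfolding onproj_apply by (rule norm_sum_orthonormal[OF assms])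

lemma cinner_onproj:
  assumes "orthonormal E" "finite E" "e \<in> E"
  shows "cinner e (onproj E x) = cinner e x"
proof -
  have "cinner e (onproj E x) = (\<Sum>f\<in>E. cinner f x * (if e = f then 1 else 0))"
    unfolding onproj_apply cinner_sum_right cinner_scaleC_right
    by (intro sum.cong refl) (simp add: orthonormal_cinner[OF assms(1) assms(3)])
  also have "\<dots> = cinner e x" using assms by (simp add: if_distrib cong: if_cong)
  finally show ?thesis .
qed

lemma diff_onproj_orth:
  assumes "orthonormal E" "finite E"
  shows "x - onproj E x \<in> orth E"
  using assms by (simp add: orth_def cinner_simps cinner_onproj)

lemma onproj_id_on_span:
  assumes E: "orthonormal E" "finite E" and x: "x \<in> cspan E"
  shows "onproj E x = x"
proof -
  have lin: "onproj E \<in> bounded_ops" by (rule symmetric_op_bounded[OF symmetric_op_onproj])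
  have "complex_vector.subspace {x. onproj E x = x}"
    by (auto simp: complex_vector.subspace_def blinfun.bilinear_simps bounded_ops_scaleC[OF lin])
  moreover have "E \<subseteq> {x. onproj E x = x}"
  proof
    fix e assume e: "e \<in> E"
    have "onproj E e = (\<Sum>f\<in>E. if f = e then e else 0)"
      unfolding onproj_apply by (intro sum.cong refl) (auto simp: orthonormal_cinner[OF E(1) _ e])
    then show "e \<in> {x. onproj E x = x}" using E(2) e by simp
  qed
  ultimately show ?thesis using complex_vector.span_minimal x by blast
qed

lemma bessel:
  assumes "orthonormal E" "finite E"
  shows "norm (onproj E x) \<le> norm x"
proof -
  have "norm (onproj E x) * norm (onproj E x) = inner x (onproj E x)"
    by (simp add: norm_onproj[OF assms] inner_onproj flip: power2_eq_square)
  also have "\<dots> \<le> norm x * norm (onproj E x)" by (rule norm_cauchy_schwarz)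
  finally show ?thesis by (cases "norm (onproj E x) = 0") auto
qed

lemma norm_diff_onproj:
  assumes "orthonormal E" "finite E"
  shows "(norm (x - onproj E x))\<^sup>2 = (norm x)\<^sup>2 - (norm (onproj E x))\<^sup>2"
proof -
  have "inner x (onproj E x) = (norm (onproj E x))\<^sup>2"
    by (simp add: norm_onproj[OF assms] inner_onproj)
  then show ?thesis
    by (simp add: power2_norm_eq_inner inner_simps inner_commute)
qed

lemma orth_span:
  assumes "x \<in> orth F" "f \<in> cspan F"
  shows "cinner f x = 0"
proof -
  have "complex_vector.subspace {f. cinner f x = 0}"
    by (auto simp: complex_vector.subspace_def cinner_simps)
  moreover have "F \<subseteq> {f. cinner f x = 0}" using assms(1) by (auto simp: orth_def)
  ultimately show ?thesis using complex_vector.span_minimal assms(2) by blast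
qed

lemma orthonormal_independent:
  assumes E: "orthonormal E"
  shows "complex_vector.independent E"
  unfolding complex_vector.dependent_def
proof safe
  fix e assume e: "e \<in> E" "e \<in> cspan (E - {e})"
  have "e \<in> orth (E - {e})"
    using orthonormal_cinner[OF E] e(1) by (auto simp: orth_def)
  then have "cinner e e = 0" using e(2) by (rule orth_span)
  then show False using orthonormal_cinner[OF E e(1) e(1)] by simp
qed

lemma orthonormal_card_le:
  assumes "orthonormal E" "finite B" "E \<subseteq> cspan B"
  shows "finite E" "card E \<le> card B"
  using complex_vector.independent_span_bound[OF assms(2) orthonormal_independent[OF assms(1)] assms(3)]
  by auto

lemma gram_schmidt_step:
  assumes G: "orthonormal G" "finite G" and v: "v \<notin> cspan G"
  obtains u where "u \<notin> G" "orthonormal (insert u G)" "u \<in> cspan (insert v G)"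
proof -
  define w where "w = v - onproj G v"
  define u where "u = complex_of_real (1 / norm w) *\<^sub>C w"
  have w0: "w \<noteq> 0" using v onproj_in_span[of G v] by (auto simp: w_def)
  have "w \<in> orth G" unfolding w_def by (rule diff_onproj_orth[OF G])
  then have "u \<in> orth G" by (simp add: u_def orth_def cinner_simps)
  moreover have "norm u = 1" using w0 by (simp add: u_def norm_scaleC norm_divide)
  moreover have "onproj G v \<in> cspan (insert v G)"
    using onproj_in_span[of G v] complex_vector.span_mono[of G "insert v G"] by blast
  then have "w \<in> cspan (insert v G)"
    unfolding w_def using complex_vector.span_base[of v "insert v G"]
    by (intro complex_vector.span_diff) auto
  then have "u \<in> cspan (insert v G)"
    unfolding u_def by (rule complex_vector.span_scale)
  ultimately show ?thesis using that orthonormal_insert[OF G(1)] by blast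
qed

text \<open>Inside the span of a finite set, every orthonormal set of maximal cardinality spans everything.\<close>

lemma orthonormal_extend:
  assumes B: "finite B" and G: "orthonormal G" "G \<subseteq> cspan B"
  obtains G' where "finite G'" "orthonormal G'" "G \<subseteq> G'" "cspan G' = cspan B"
proof -
  define P where "P = (\<lambda>k. \<exists>G'. orthonormal G' \<and> G \<subseteq> G' \<and> G' \<subseteq> cspan B \<and> card G' = k)"
  have "P (card G)" using G by (auto simp: P_def)
  moreover have "\<forall>k. P k \<longrightarrow> k \<le> card B" using orthonormal_card_le[OF _ B] by (auto simp: P_def)
  ultimately obtain k where k: "P k" "\<And>j. P j \<Longrightarrow> j \<le> k"
    using Greatest_le_nat[of P _ "card B"] GreatestI_nat[of P _ "card B"] by metis
  then obtain G' where G': "orthonormal G'" "G \<subseteq> G'" "G' \<subseteq> cspan B" "card G' = k"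
    by (auto simp: P_def)
  have fin: "finite G'" using orthonormal_card_le[OF G'(1) B G'(3)] by simp
  have "B \<subseteq> cspan G'"
  proof (rule ccontr)
    assume "\<not> ?thesis"
    then obtain v where v: "v \<in> B" "v \<notin> cspan G'" by blast
    then obtain u where u: "u \<notin> G'" "orthonormal (insert u G')" "u \<in> cspan (insert v G')"
      using gram_schmidt_step[OF G'(1) fin] by blast
    have "insert v G' \<subseteq> cspan B" using v G' complex_vector.span_base by blast
    then have "cspan (insert v G') \<subseteq> cspan B"
      by (intro complex_vector.span_minimal complex_vector.subspace_span)
    then have "P (Suc k)" using u G' fin unfolding P_def
      by (intro exI[of _ "insert u G'"]) auto
    then show False using k(2)[of "Suc k"] by simp
  qed
  then have "cspan G' = cspan B" using G'(3) complex_vector.span_eq by blast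
  then show ?thesis using that fin G' by blast
qed

lemma orthonormal_card_eq:
  assumes "orthonormal E" "orthonormal G" "finite E" "finite G" "cspan E = cspan G"
  shows "card E = card G"
proof (rule antisym)
  show "card E \<le> card G"
    by (rule orthonormal_card_le(2)[OF assms(1,4)]) (use assms(5) complex_vector.span_superset[of E] in auto)
  show "card G \<le> card E"
    by (rule orthonormal_card_le(2)[OF assms(2,3)]) (use assms(5) complex_vector.span_superset[of G] in auto)
qed

lemma orthonormal_span_obtain:
  assumes "finite B"
  obtains G where "finite G" "orthonormal G" "card G \<le> card B" "cspan G = cspan B"
proof -
  obtain G where G: "finite G" "orthonormal G" "cspan G = cspan B"
    using orthonormal_extend[OF assms orthonormal_empty] by auto
  have "card G \<le> card B"
    by (rule orthonormal_card_le(2)[OF G(2) assms]) (use G(3) complex_vector.span_superset[of G] in auto)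
  then show ?thesis using that G by blast
qed

text \<open>The dimension count behind the variational principle: an \<open>n\<close>-dimensional space contains a
  unit vector orthogonal to any given set of fewer than \<open>n\<close> vectors. It suffices to avoid the
  projections of these vectors onto the space.\<close>

lemma exists_unit_in_span_orth:
  assumes E: "orthonormal E" "finite E" and F: "finite F" "card F < card E"
  obtains v where "norm v = 1" "v \<in> cspan E" "v \<in> orth F"
proof -
  have "card (onproj E ` F) < card E" using card_image_le[OF F(1), of "onproj E"] F by simp
  then obtain G where G: "finite G" "orthonormal G" "card G < card E" "cspan G = cspan (onproj E ` F)"
    using orthonormal_span_obtain[of "onproj E ` F"] F(1) by (metis finite_imageI le_less_trans)
  have "\<not> E \<subseteq> cspan G" using orthonormal_card_le[OF E(1) G(1)] G(3) by auto
  then obtain e where e: "e \<in> E" "e \<notin> cspan G" by blast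
  define w where "w = e - onproj G e"
  define v where "v = complex_of_real (1 / norm w) *\<^sub>C w"
  have w0: "w \<noteq> 0" using e onproj_in_span[of G e] by (auto simp: w_def)
  have "cspan G \<subseteq> cspan E" unfolding G(4)
    using onproj_in_span by (intro complex_vector.span_minimal complex_vector.subspace_span) auto
  then have "w \<in> cspan E" unfolding w_def using onproj_in_span[of G e] e complex_vector.span_base
    by (intro complex_vector.span_diff) auto
  have worth: "w \<in> orth G" unfolding w_def by (rule diff_onproj_orth[OF G(2,1)])
  have "cinner f w = 0" if "f \<in> F" for f
  proof -
    have "onproj E f \<in> cspan G"
      unfolding G(4) using that by (intro complex_vector.span_base) simp
    then have "cinner (onproj E f) w = 0" by (rule orth_span[OF worth])
    then have "cinner f (onproj E w) = 0" using symmetric_op_cinner[OF symmetric_op_onproj, of E f w] by simp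
    then show ?thesis using onproj_id_on_span[OF E \<open>w \<in> cspan E\<close>] by simp
  qed
  then have "v \<in> orth F" by (simp add: v_def orth_def cinner_simps)
  moreover have "norm v = 1" using w0 by (simp add: v_def norm_scaleC norm_divide)
  moreover have "v \<in> cspan E"
    unfolding v_def by (intro complex_vector.span_scale \<open>w \<in> cspan E\<close>)
  ultimately show ?thesis using that by blast
qed

subsection \<open>Orthonormal bases\<close>

lemma orthonormal_basis_iff:
  "orthonormal_basis B \<longleftrightarrow> orthonormal B \<and> closure (cspan B) = UNIV"
  by (simp add: orthonormal_basis_def orthonormal_def)

lemma csubspace_imp_subspace: "complex_vector.subspace V \<Longrightarrow> subspace V"
  by (auto simp: complex_vector.subspace_def subspace_def simp flip: scaleC_of_real)

text \<open>A maximal orthonormal set has dense span, since a vector outside the closure of the span has a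
  nonzero component orthogonal to it. Existence of a basis makes the choice in the definition of the
  trace meaningful.\<close>

lemma orthonormal_basis_exists: "\<exists>B :: 'h::complex_hilbert_space set. orthonormal_basis B"
proof -
  have "\<exists>B\<in>{E :: 'h set. orthonormal E}. \<forall>X\<in>{E. orthonormal E}. B \<subseteq> X \<longrightarrow> X = B"
  proof (rule subset_Zorn')
    fix C :: "'h set set" assume C: "subset.chain {E. orthonormal E} C"
    have "cinner e f = 0" if ef: "e \<in> \<Union> C" "f \<in> \<Union> C" "e \<noteq> f" for e f
    proof -
      obtain X Y where XY: "X \<in> C" "Y \<in> C" "e \<in> X" "f \<in> Y" using ef by blast
      then have "X \<subseteq> Y \<or> Y \<subseteq> X" using C by (auto simp: subset_chain_def)
      then obtain Z where Z: "Z \<in> C" "e \<in> Z" "f \<in> Z" using XY by blast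
      then have "orthonormal Z" using C by (auto simp: subset_chain_def)
      then show ?thesis using orthonormal_cinner[OF _ Z(2,3)] ef by simp
    qed
    moreover have "norm e = 1" if "e \<in> \<Union> C" for e
      using that C by (auto simp: subset_chain_def orthonormal_def)
    ultimately show "\<Union> C \<in> {E. orthonormal E}" by (auto simp: orthonormal_def pairwise_def)
  qed
  then obtain B :: "'h set" where B: "orthonormal B"
    and max: "\<And>X. orthonormal X \<Longrightarrow> B \<subseteq> X \<Longrightarrow> X = B" by blast
  have "x \<in> closure (cspan B)" for x
  proof (rule ccontr)
    assume x: "x \<notin> closure (cspan B)"
    have "subspace (closure (cspan B))"
      by (intro subspace_closure csubspace_imp_subspace complex_vector.subspace_span)
    then obtain y where y: "y \<in> closure (cspan B)"
      and orth: "\<And>v. v \<in> closure (cspan B) \<Longrightarrow> inner (x - y) v = 0"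
      using orthogonal_projection_exists[of "closure (cspan B)" x] by auto
    define w where "w = x - y"
    have w0: "w \<noteq> 0" using x y by (auto simp: w_def)
    have span: "inner w v = 0" if "v \<in> cspan B" for v
      using orth that closure_subset by (auto simp: w_def)
    have "cinner w b = 0" if "b \<in> B" for b
    proof (rule complex_eqI)
      show "Re (cinner w b) = Re 0"
        using span[of b] that by (simp add: complex_vector.span_base inner_eq_Re_cinner)
      show "Im (cinner w b) = Im 0"
        using span[of "\<i> *\<^sub>C b"] that
        by (simp add: complex_vector.span_base complex_vector.span_scale Im_cinner)
    qed
    then have w: "w \<in> orth B" by (simp add: orth_def cinner_eq_0_commute)
    define u where "u = complex_of_real (1 / norm w) *\<^sub>C w"
    have "u \<in> orth B" using w by (simp add: u_def orth_def cinner_simps)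
    moreover have "norm u = 1" using w0 by (simp add: u_def norm_scaleC norm_divide)
    ultimately have "orthonormal (insert u B)" "u \<notin> B" using orthonormal_insert[OF B] by auto
    then show False using max[of "insert u B"] by auto
  qed
  then show ?thesis using B by (auto simp: orthonormal_basis_iff)
qed

lemma span_finite_subset:
  assumes "x \<in> cspan B"
  obtains F where "finite F" "F \<subseteq> B" "x \<in> cspan F"
proof -
  obtain F r where F: "finite F" "F \<subseteq> B" "x = (\<Sum>a\<in>F. r a *\<^sub>C a)"
    using assms by (auto simp: complex_vector.span_explicit)
  then have "x \<in> cspan F"
    by (auto intro: complex_vector.span_sum complex_vector.span_scale complex_vector.span_base)
  then show ?thesis using that F by blast
qed

lemma parseval:
  assumes B: "orthonormal_basis B"
  shows "(\<Sum>\<^sub>\<infinity>e\<in>B. ennreal ((cmod (cinner e x))\<^sup>2)) = ennreal ((norm x)\<^sup>2)"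
proof -
  have on: "orthonormal F" if "F \<subseteq> B" for F
    using that B orthonormal_subset by (auto simp: orthonormal_basis_iff)
  have sum_eq: "(\<Sum>e\<in>F. ennreal ((cmod (cinner e x))\<^sup>2)) = ennreal ((norm (onproj F x))\<^sup>2)"
    if "finite F" "F \<subseteq> B" for F
    by (simp add: norm_onproj[OF on[OF that(2)] that(1)])
  have "(SUP F\<in>{F. finite F \<and> F \<subseteq> B}. \<Sum>e\<in>F. ennreal ((cmod (cinner e x))\<^sup>2)) = ennreal ((norm x)\<^sup>2)"
  proof (rule antisym)
    show "(SUP F\<in>{F. finite F \<and> F \<subseteq> B}. \<Sum>e\<in>F. ennreal ((cmod (cinner e x))\<^sup>2)) \<le> ennreal ((norm x)\<^sup>2)"
    proof (rule SUP_least, clarify)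
      fix F assume F: "finite F" "F \<subseteq> B"
      show "(\<Sum>e\<in>F. ennreal ((cmod (cinner e x))\<^sup>2)) \<le> ennreal ((norm x)\<^sup>2)"
        unfolding sum_eq[OF F] by (intro ennreal_leI power_mono bessel on F) auto
    qed
    show "ennreal ((norm x)\<^sup>2) \<le> (SUP F\<in>{F. finite F \<and> F \<subseteq> B}. \<Sum>e\<in>F. ennreal ((cmod (cinner e x))\<^sup>2))"
    proof (rule ennreal_le_epsilon)
      fix d :: real assume d: "0 < d"
      have "x \<in> closure (cspan B)" using B by (simp add: orthonormal_basis_iff)
      then obtain y where y: "y \<in> cspan B" "dist y x < sqrt d"
        using d by (meson closure_approachable real_sqrt_gt_0_iff)
      then obtain F where F: "finite F" "F \<subseteq> B" "y \<in> cspan F" using span_finite_subset by blast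
      have "(x - y) - onproj F (x - y) = x - onproj F x"
        using onproj_id_on_span[OF on[OF F(2)] F(1,3)] by (simp add: blinfun.bilinear_simps)
      then have "(norm (x - onproj F x))\<^sup>2 = (norm ((x - y) - onproj F (x - y)))\<^sup>2" by (simp only:)
      also have "\<dots> \<le> (norm (x - y))\<^sup>2"
        using norm_diff_onproj[OF on[OF F(2)] F(1), of "x - y"] by simp
      also have "\<dots> \<le> (sqrt d)\<^sup>2" using y(2) by (intro power_mono) (auto simp: dist_norm norm_minus_commute)
      also have "\<dots> = d" using d by simp
      finally have "(norm x)\<^sup>2 \<le> (norm (onproj F x))\<^sup>2 + d"
        using norm_diff_onproj[OF on[OF F(2)] F(1), of x] by simp
      then have "ennreal ((norm x)\<^sup>2) \<le> ennreal ((norm (onproj F x))\<^sup>2) + ennreal d"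
        using d by (simp flip: ennreal_plus add: ennreal_leI)
      also have "\<dots> \<le> (SUP F\<in>{F. finite F \<and> F \<subseteq> B}. \<Sum>e\<in>F. ennreal ((cmod (cinner e x))\<^sup>2)) + ennreal d"
        unfolding sum_eq[OF F(1,2), symmetric] using F by (intro add_right_mono SUP_upper) auto
      finally show "ennreal ((norm x)\<^sup>2) \<le>
        (SUP F\<in>{F. finite F \<and> F \<subseteq> B}. \<Sum>e\<in>F. ennreal ((cmod (cinner e x))\<^sup>2)) + ennreal d" .
    qed
  qed
  then show ?thesis by (subst nonneg_infsum_complete) auto
qed

lemma op_trace_basis:
  obtains B :: "'h::complex_hilbert_space set" where "orthonormal_basis B"
    "\<And>T :: 'h \<Rightarrow>\<^sub>L 'h. op_trace T = (\<Sum>\<^sub>\<infinity>e\<in>B. ennreal (inner e (T e)))"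
  using someI_ex[OF orthonormal_basis_exists] by (auto simp: op_trace_def inner_eq_Re_cinner)

text \<open>The trace of the projection onto the span of \<open>G\<close> is its dimension, and a projection whose range
  contains \<open>G\<close> has at least this trace. Together they translate the condition \<open>Tr (1 - p) \<le> t\<close>
  into a bound on the number of vectors.\<close>

lemma op_trace_onproj:
  fixes G :: "'h::complex_hilbert_space set"
  assumes G: "orthonormal G" "finite G"
  shows "op_trace (onproj G) = of_nat (card G)"
proof -
  obtain B :: "'h set" where B: "orthonormal_basis B"
    "\<And>T :: 'h \<Rightarrow>\<^sub>L 'h. op_trace T = (\<Sum>\<^sub>\<infinity>e\<in>B. ennreal (inner e (T e)))" using op_trace_basis by metis
  have "(\<Sum>\<^sub>\<infinity>e\<in>B. \<Sum>g\<in>A. ennreal ((cmod (cinner g e))\<^sup>2)) = of_nat (card A)" if "A \<subseteq> G" for A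
    using finite_subset[OF that G(2)] that
  proof (induction A rule: finite_induct)
    case (insert g A)
    have "(\<Sum>\<^sub>\<infinity>e\<in>B. \<Sum>g\<in>insert g A. ennreal ((cmod (cinner g e))\<^sup>2))
      = (\<Sum>\<^sub>\<infinity>e\<in>B. ennreal ((cmod (cinner g e))\<^sup>2) + (\<Sum>g\<in>A. ennreal ((cmod (cinner g e))\<^sup>2)))"
      using insert by (simp del: sum_ennreal)
    also have "\<dots> = (\<Sum>\<^sub>\<infinity>e\<in>B. ennreal ((cmod (cinner e g))\<^sup>2)) +
        (\<Sum>\<^sub>\<infinity>e\<in>B. \<Sum>g\<in>A. ennreal ((cmod (cinner g e))\<^sup>2))"
      by (subst infsum_add) (auto intro!: nonneg_summable_on_complete arg_cong2[where f="(+)"] infsum_cong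
          simp: cinner_commute[of g] complex_mod_cnj)
    also have "\<dots> = 1 + of_nat (card A)"
      using insert G(1) by (simp add: parseval[OF B(1)] orthonormal_def)
    finally show ?case using insert by simp
  qed simp
  from this[of G] show ?thesis by (simp add: B(2) inner_onproj)
qed

lemma card_le_op_trace:
  fixes q :: "'h::complex_hilbert_space \<Rightarrow>\<^sub>L 'h"
  assumes q: "symmetric_op q" "q o\<^sub>L q = q" and G: "orthonormal G" "finite G" "G \<subseteq> {x. q x = x}"
  shows "of_nat (card G) \<le> op_trace q"
proof -
  obtain B :: "'h set" where B: "orthonormal_basis B"
    "\<And>T :: 'h \<Rightarrow>\<^sub>L 'h. op_trace T = (\<Sum>\<^sub>\<infinity>e\<in>B. ennreal (inner e (T e)))" using op_trace_basis by metis
  have "inner e (onproj G e) \<le> inner e (q e)" for e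
  proof -
    have "cinner g e = cinner g (q e)" if "g \<in> G" for g
      using symmetric_op_cinner[OF q(1), of g e] G that by auto
    then have "inner e (onproj G e) = (norm (onproj G (q e)))\<^sup>2"
      by (simp add: inner_onproj norm_onproj[OF G(1,2)])
    also have "\<dots> \<le> (norm (q e))\<^sup>2" by (intro power_mono bessel G) auto
    also have "\<dots> = inner e (q (q e))"
      by (simp add: power2_norm_eq_inner symmetric_op_inner[OF q(1)])
    also have "\<dots> = inner e (q e)" using q(2) by (metis blinfun_apply_blinfun_compose)
    finally show ?thesis .
  qed
  then have "op_trace (onproj G) \<le> op_trace q"
    unfolding B(2) by (intro infsum_mono ennreal_leI nonneg_summable_on_complete) auto
  then show ?thesis by (simp add: op_trace_onproj[OF G(1,2)])
qed

section \<open>Singular numbers\<close>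

text \<open>The projections in the definition of the singular value function are replaced by finite sets:
  \<open>snum n T\<close> is the infimum of all bounds for \<open>T\<close> on the orthogonal complement of a set of
  at most \<open>n\<close> vectors.\<close>

definition snum_bound :: "nat \<Rightarrow> ('h::complex_hilbert_space \<Rightarrow>\<^sub>L 'h) \<Rightarrow> real \<Rightarrow> bool" where
  "snum_bound n T c \<longleftrightarrow> 0 \<le> c \<and> (\<exists>F. finite F \<and> card F \<le> n \<and> (\<forall>x\<in>orth F. norm (T x) \<le> c * norm x))"

definition snum :: "nat \<Rightarrow> ('h::complex_hilbert_space \<Rightarrow>\<^sub>L 'h) \<Rightarrow> real" where
  "snum n T = Inf {c. snum_bound n T c}"

lemma snum_boundI:
  fixes T :: "'h::complex_hilbert_space \<Rightarrow>\<^sub>L 'h"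
  shows "0 \<le> c \<Longrightarrow> finite F \<Longrightarrow> card F \<le> n \<Longrightarrow> (\<And>x. x \<in> orth F \<Longrightarrow> norm (T x) \<le> c * norm x) \<Longrightarrow> snum_bound n T c"
  by (auto simp: snum_bound_def)

lemma snum_bound_norm: "snum_bound n T (norm T)"
  by (rule snum_boundI[of _ "{}"]) (auto intro: norm_blinfun)

lemma snum_bdd_below: "bdd_below {c. snum_bound n T c}"
  by (rule bdd_belowI[of _ 0]) (auto simp: snum_bound_def)

lemma snum_le: "snum_bound n T c \<Longrightarrow> snum n T \<le> c"
  unfolding snum_def by (rule cInf_lower[OF _ snum_bdd_below]) simp

lemma snum_greatest: "(\<And>c. snum_bound n T c \<Longrightarrow> a \<le> c) \<Longrightarrow> a \<le> snum n T"
  unfolding snum_def using snum_bound_norm by (intro cInf_greatest) auto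

lemma snum_nonneg: "0 \<le> snum n T"
  by (rule snum_greatest) (auto simp: snum_bound_def)

lemma snum_antimono: "m \<le> n \<Longrightarrow> snum n T \<le> snum m T"
  by (rule snum_greatest, rule snum_le) (auto simp: snum_bound_def)

text \<open>If \<open>F\<close> has at most \<open>t\<close> elements, the projection \<open>p\<close> onto \<open>F\<^sup>\<bottom>\<close> satisfies
  \<open>Tr (1 - p) \<le> t\<close>. Conversely, if \<open>Tr (1 - p) \<le> t\<close>, the range of \<open>1 - p\<close> is spanned by a maximal
  orthonormal set \<open>G\<close> in it, which has at most \<open>t\<close> elements, and \<open>p\<close> is the identity on \<open>G\<^sup>\<bottom>\<close>.\<close>

lemma sing_val_eq_snum:
  fixes T :: "'h::complex_hilbert_space \<Rightarrow>\<^sub>L 'h"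
  assumes t: "0 \<le> t"
  shows "sing_val t T = snum (nat \<lfloor>t\<rfloor>) T"
proof -
  define n where "n = nat \<lfloor>t\<rfloor>"
  have le_n: "k \<le> n \<longleftrightarrow> (of_nat k :: ennreal) \<le> ennreal t" for k
    using t by (simp add: n_def ennreal_of_nat_eq_real_of_nat le_nat_iff le_floor_iff)
  let ?P = "{norm (T o\<^sub>L p) | p. projection_op p \<and> op_trace (id_blinfun - p) \<le> ennreal t}"
  have proj_sym: "symmetric_op p" if "projection_op p" for p :: "'h \<Rightarrow>\<^sub>L 'h"
    using that inner_adjoint[of p] by (auto simp: projection_op_def symmetric_op_def)
  have 1: "\<exists>p. projection_op p \<and> op_trace (id_blinfun - p) \<le> ennreal t \<and> norm (T o\<^sub>L p) \<le> c"
    if bound: "snum_bound n T c" for c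
  proof -
    obtain F where F: "finite F" "card F \<le> n" "\<And>x. x \<in> orth F \<Longrightarrow> norm (T x) \<le> c * norm x" and c: "0 \<le> c"
      using bound by (auto simp: snum_bound_def)
    obtain G where G: "finite G" "orthonormal G" "card G \<le> card F" "cspan G = cspan F"
      using orthonormal_span_obtain[OF F(1)] .
    define p where "p = id_blinfun - onproj G"
    have p: "p x \<in> orth F" for x
    proof -
      have "p x \<in> orth G" using diff_onproj_orth[OF G(2,1)] by (simp add: p_def blinfun.bilinear_simps)
      then have "cinner f (p x) = 0" if "f \<in> F" for f
        using orth_span[of "p x" G f] G(4) that complex_vector.span_base[of f F] by simp
      then show ?thesis by (simp add: orth_def)
    qed
    have sym: "symmetric_op p" unfolding p_def
      by (intro symmetric_op_diff symmetric_op_id symmetric_op_onproj)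
    have "p o\<^sub>L p = p"
      by (intro blinfun_eqI)
        (simp add: p_def blinfun.bilinear_simps onproj_id_on_span[OF G(2,1) onproj_in_span])
    moreover have "adjoint p = p" using sym by (intro adjoint_eqI) (auto simp: symmetric_op_def)
    ultimately have "projection_op p" using sym by (simp add: projection_op_def symmetric_op_def)
    moreover have "op_trace (id_blinfun - p) \<le> ennreal t"
      using op_trace_onproj[OF G(2,1)] G(3) F(2) le_n[of "card G"] by (simp add: p_def)
    moreover have "norm (T o\<^sub>L p) \<le> c"
    proof (rule norm_blinfun_bound[OF c])
      fix x
      have "(norm (p x))\<^sup>2 \<le> (norm x)\<^sup>2"
        using norm_diff_onproj[OF G(2,1), of x] by (simp add: p_def blinfun.bilinear_simps)
      then have "norm (p x) \<le> norm x" by (rule power2_le_imp_le) simp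
      then show "norm ((T o\<^sub>L p) x) \<le> c * norm x"
        using F(3)[OF p, of x] mult_left_mono[OF _ c] by fastforce
    qed
    ultimately show ?thesis by blast
  qed
  have 2: "snum_bound n T (norm (T o\<^sub>L p))"
    if p: "projection_op p" and tr: "op_trace (id_blinfun - p) \<le> ennreal t" for p
  proof -
    define q where "q = id_blinfun - p"
    have pp: "p (p x) = p x" for x
      using p by (metis projection_op_def blinfun_apply_blinfun_compose)
    have q: "symmetric_op q" "q o\<^sub>L q = q"
      unfolding q_def using proj_sym[OF p]
      by (auto intro!: symmetric_op_diff symmetric_op_id blinfun_eqI simp: blinfun.bilinear_simps pp)
    have qq: "q (q x) = q x" for x using q(2) by (metis blinfun_apply_blinfun_compose)
    have sub: "complex_vector.subspace {x. q x = x}"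
      by (auto simp: complex_vector.subspace_def blinfun.bilinear_simps
          bounded_ops_scaleC[OF symmetric_op_bounded[OF q(1)]])
    define P where "P = (\<lambda>k. \<exists>G. finite G \<and> orthonormal G \<and> G \<subseteq> {x. q x = x} \<and> card G = k)"
    have P_le: "k \<le> n" if Pk: "P k" for k
    proof -
      obtain G where G: "finite G" "orthonormal G" "G \<subseteq> {x. q x = x}" "card G = k"
        using Pk by (auto simp: P_def)
      have "of_nat k \<le> op_trace q" using card_le_op_trace[OF q G(2,1,3)] G(4) by simp
      then show ?thesis using tr le_n by (simp add: q_def)
    qed
    have "P 0" unfolding P_def by (intro exI[of _ "{}"]) (simp add: orthonormal_empty)
    then obtain k where k: "P k" "\<And>j. P j \<Longrightarrow> j \<le> k"
      using Greatest_le_nat[of P _ n] GreatestI_nat[of P _ n] P_le by metis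
    then obtain G where G: "finite G" "orthonormal G" "G \<subseteq> {x. q x = x}" "card G = k"
      by (auto simp: P_def)
    have span: "q x \<in> cspan G" for x
    proof (rule ccontr)
      assume "q x \<notin> cspan G"
      then obtain u where u: "u \<notin> G" "orthonormal (insert u G)" "u \<in> cspan (insert (q x) G)"
        using gram_schmidt_step[OF G(2,1)] by blast
      have "cspan (insert (q x) G) \<subseteq> {x. q x = x}"
        using G(3) by (intro complex_vector.span_minimal sub) (auto simp: qq)
      then have "P (Suc k)" using u G unfolding P_def by (intro exI[of _ "insert u G"]) auto
      then show False using k(2)[of "Suc k"] by simp
    qed
    show ?thesis
    proof (rule snum_boundI[of _ G])
      fix x assume x: "x \<in> orth G"
      have "cinner (q x) x = 0" by (rule orth_span[OF x span])
      then have "inner (q x) (q x) = 0"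
        by (simp add: symmetric_op_inner[OF q(1)] qq) (metis cinner_eq_0_imp_inner inner_commute)
      then have "x = p x" by (simp add: q_def blinfun.bilinear_simps)
      then have "norm (T x) = norm ((T o\<^sub>L p) x)" by simp
      then show "norm (T x) \<le> norm (T o\<^sub>L p) * norm x" by (metis norm_blinfun)
    qed (use G P_le k in auto)
  qed
  have bdd: "bdd_below ?P" by (rule bdd_belowI[of _ 0]) auto
  show ?thesis unfolding n_def[symmetric]
  proof (rule antisym)
    show "sing_val t T \<le> snum n T"
    proof (rule snum_greatest)
      fix c assume "snum_bound n T c"
      then obtain p where p: "projection_op p" "op_trace (id_blinfun - p) \<le> ennreal t" "norm (T o\<^sub>L p) \<le> c"
        using 1 by blast
      then have "sing_val t T \<le> norm (T o\<^sub>L p)"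
        unfolding sing_val_def by (intro cInf_lower[OF _ bdd]) auto
      then show "sing_val t T \<le> c" using p by simp
    qed
    show "snum n T \<le> sing_val t T"
      unfolding sing_val_def
    proof (rule cInf_greatest)
      show "?P \<noteq> {}" using 1[OF snum_bound_norm] by blast
    qed (use 2 snum_le in blast)
  qed
qed

lemma snum_le_cmult:
  assumes "0 \<le> k" "\<And>c. snum_bound n T c \<Longrightarrow> snum_bound m S (k * c)"
  shows "snum m S \<le> k * snum n T"
proof (cases "k = 0")
  case True
  then show ?thesis using snum_le[OF assms(2)[OF snum_bound_norm]] by simp
next
  case False
  then have "k > 0" using assms by simp
  have "snum m S / k \<le> snum n T"
    by (rule snum_greatest) (use snum_le[OF assms(2)] \<open>k > 0\<close> in \<open>simp add: field_simps\<close>)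
  then show ?thesis using \<open>k > 0\<close> by (simp add: field_simps)
qed

lemma snum_le_snum:
  assumes "\<And>c. snum_bound n T c \<Longrightarrow> snum_bound m S c"
  shows "snum m S \<le> snum n T"
  using snum_le_cmult[of 1 n T m S] assms by simp

lemma snum_le_of_norm_le:
  fixes S T :: "'h::complex_hilbert_space \<Rightarrow>\<^sub>L 'h"
  assumes "0 \<le> k" "\<And>x. norm (S x) \<le> k * norm (T x)"
  shows "snum n S \<le> k * snum n T"
proof (rule snum_le_cmult[OF assms(1)])
  fix c assume "snum_bound n T c"
  then obtain F where F: "0 \<le> c" "finite F" "card F \<le> n" "\<And>x. x \<in> orth F \<Longrightarrow> norm (T x) \<le> c * norm x"
    by (auto simp: snum_bound_def)
  show "snum_bound n S (k * c)"
  proof (rule snum_boundI[of _ F])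
    fix x assume "x \<in> orth F"
    then have "k * norm (T x) \<le> k * (c * norm x)" using F(4) assms(1) by (intro mult_left_mono) auto
    then show "norm (S x) \<le> k * c * norm x" using assms(2)[of x] by (simp add: mult.assoc)
  qed (use F assms in auto)
qed

lemma snum_scaleR: "0 \<le> r \<Longrightarrow> snum n (r *\<^sub>R T) = r * snum n T"
proof (rule antisym)
  assume r: "0 \<le> r"
  show "snum n (r *\<^sub>R T) \<le> r * snum n T"
    using r by (intro snum_le_of_norm_le) (auto simp: blinfun.bilinear_simps)
  show "r * snum n T \<le> snum n (r *\<^sub>R T)"
  proof (cases "r = 0")
    case True
    then show ?thesis by (simp add: snum_nonneg)
  next
    case False
    then have "snum n T \<le> (1 / r) * snum n (r *\<^sub>R T)"
      using r by (intro snum_le_of_norm_le) (auto simp: blinfun.bilinear_simps)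
    then show ?thesis using False r by (simp add: field_simps)
  qed
qed

lemma snum_0: "snum n 0 = 0"
  using snum_scaleR[of 0 n 0] by simp

lemma snum_add:
  fixes S T :: "'h::complex_hilbert_space \<Rightarrow>\<^sub>L 'h"
  shows "snum (m + n) (S + T) \<le> snum m S + snum n T"
proof -
  have bound: "snum_bound (m + n) (S + T) (c + d)" if c: "snum_bound m S c" and d: "snum_bound n T d" for c d
  proof -
    obtain F where F: "0 \<le> c" "finite F" "card F \<le> m" "\<And>x. x \<in> orth F \<Longrightarrow> norm (S x) \<le> c * norm x"
      using c by (auto simp: snum_bound_def)
    obtain G where G: "0 \<le> d" "finite G" "card G \<le> n" "\<And>x. x \<in> orth G \<Longrightarrow> norm (T x) \<le> d * norm x"
      using d by (auto simp: snum_bound_def)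
    show ?thesis
    proof (rule snum_boundI[of _ "F \<union> G"])
      show "card (F \<union> G) \<le> m + n" using card_Un_le[of F G] F G by linarith
      fix x assume "x \<in> orth (F \<union> G)"
      then have "x \<in> orth F" "x \<in> orth G" by (auto simp: orth_def)
      then show "norm ((S + T) x) \<le> (c + d) * norm x"
        using F(4)[of x] G(4)[of x] norm_triangle_ineq[of "S x" "T x"]
        by (simp add: blinfun.bilinear_simps distrib_right)
    qed (use F G in auto)
  qed
  have "snum (m + n) (S + T) - d \<le> snum m S" if "snum_bound n T d" for d
    using snum_le[OF bound[OF _ that]] by (intro snum_greatest) fastforce
  then have "snum (m + n) (S + T) - snum m S \<le> snum n T"
    by (intro snum_greatest) fastforce
  then show ?thesis by simp
qed

lemma snum_contractions:
  fixes X Y T :: "'h::complex_hilbert_space \<Rightarrow>\<^sub>L 'h"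
  assumes Y: "Y \<in> bounded_ops" and le: "\<And>x. norm (X x) \<le> norm x" "\<And>x. norm (Y x) \<le> norm x"
  shows "snum n (X o\<^sub>L T o\<^sub>L Y) \<le> snum n T"
proof (rule snum_le_snum)
  fix c assume "snum_bound n T c"
  then obtain F where F: "0 \<le> c" "finite F" "card F \<le> n" "\<And>x. x \<in> orth F \<Longrightarrow> norm (T x) \<le> c * norm x"
    by (auto simp: snum_bound_def)
  show "snum_bound n (X o\<^sub>L T o\<^sub>L Y) c"
  proof (rule snum_boundI[of _ "adjoint Y ` F"])
    show "card (adjoint Y ` F) \<le> n" using card_image_le[OF F(2), of "adjoint Y"] F by linarith
    fix x assume x: "x \<in> orth (adjoint Y ` F)"
    then have "Y x \<in> orth F" by (simp add: orth_def cinner_adjoint[OF Y])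
    then have "norm (T (Y x)) \<le> c * norm (Y x)" by (rule F)
    also have "\<dots> \<le> c * norm x" by (intro mult_left_mono le F)
    finally show "norm ((X o\<^sub>L T o\<^sub>L Y) x) \<le> c * norm x" using le(1)[of "T (Y x)"] by simp
  qed (use F in auto)
qed

text \<open>If \<open>T\<close> is bounded by \<open>c\<close> on \<open>F\<^sup>\<bottom>\<close>, then \<open>T\<^sup>*\<close> maps \<open>(T F)\<^sup>\<bottom>\<close> into \<open>F\<^sup>\<bottom>\<close> and is bounded by \<open>c\<close> there.\<close>

lemma snum_adjoint_le:
  fixes T :: "'h::complex_hilbert_space \<Rightarrow>\<^sub>L 'h"
  assumes T: "T \<in> bounded_ops"
  shows "snum n (adjoint T) \<le> snum n T"
proof (rule snum_le_snum)
  fix c assume "snum_bound n T c"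
  then obtain F where F: "0 \<le> c" "finite F" "card F \<le> n" "\<And>x. x \<in> orth F \<Longrightarrow> norm (T x) \<le> c * norm x"
    by (auto simp: snum_bound_def)
  show "snum_bound n (adjoint T) c"
  proof (rule snum_boundI[of _ "T ` F"])
    show "card (T ` F) \<le> n" using card_image_le[OF F(2), of T] F by linarith
    fix x assume x: "x \<in> orth (T ` F)"
    have "adjoint T x \<in> orth F"
      using x by (auto simp: orth_def cinner_adjoint[OF T] cinner_eq_0_commute[of _ "adjoint T x"]
          cinner_eq_0_commute[of x])
    then have le: "norm (T (adjoint T x)) \<le> c * norm (adjoint T x)" by (rule F)
    have "norm (adjoint T x) * norm (adjoint T x) = inner x (T (adjoint T x))"
      using inner_adjoint[OF T, of x "adjoint T x"] by (simp add: power2_norm_eq_inner flip: power2_eq_square)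
    also have "\<dots> \<le> norm x * norm (T (adjoint T x))" by (rule norm_cauchy_schwarz)
    also have "\<dots> \<le> norm x * (c * norm (adjoint T x))" by (intro mult_left_mono le) auto
    finally show "norm (adjoint T x) \<le> c * norm x"
      using F(1) by (cases "norm (adjoint T x) = 0") (auto simp: mult_ac)
  qed (use F in auto)
qed

subsection \<open>Positive operators: the variational form\<close>

text \<open>For positive \<open>T = A\<^sup>2\<close> the norm \<open>\<parallel>T x\<parallel>\<close> may be replaced by the quadratic form
  \<open>\<langle>x, T x\<rangle> = \<parallel>A x\<parallel>\<^sup>2\<close>: if the form is bounded by \<open>c\<close> on \<open>F\<^sup>\<bottom>\<close>, then \<open>\<parallel>T x\<parallel> \<le> c \<parallel>x\<parallel>\<close> on
  \<open>(A F)\<^sup>\<bottom>\<close>.\<close>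

lemma snum_bound_positive_iff:
  fixes T :: "'h::complex_hilbert_space \<Rightarrow>\<^sub>L 'h"
  assumes T: "positive_op T"
  shows "snum_bound n T c \<longleftrightarrow>
    0 \<le> c \<and> (\<exists>F. finite F \<and> card F \<le> n \<and> (\<forall>x\<in>orth F. inner x (T x) \<le> c * (norm x)\<^sup>2))"
proof
  assume "snum_bound n T c"
  then obtain F where F: "0 \<le> c" "finite F" "card F \<le> n" "\<And>x. x \<in> orth F \<Longrightarrow> norm (T x) \<le> c * norm x"
    by (auto simp: snum_bound_def)
  have "inner x (T x) \<le> c * (norm x)\<^sup>2" if "x \<in> orth F" for x
  proof -
    have "inner x (T x) \<le> norm x * norm (T x)" by (rule norm_cauchy_schwarz)
    also have "\<dots> \<le> norm x * (c * norm x)" by (intro mult_left_mono F that) auto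
    finally show ?thesis by (simp add: power2_eq_square mult_ac)
  qed
  then show "0 \<le> c \<and> (\<exists>F. finite F \<and> card F \<le> n \<and> (\<forall>x\<in>orth F. inner x (T x) \<le> c * (norm x)\<^sup>2))"
    using F by blast
next
  assume "0 \<le> c \<and> (\<exists>F. finite F \<and> card F \<le> n \<and> (\<forall>x\<in>orth F. inner x (T x) \<le> c * (norm x)\<^sup>2))"
  then obtain F where F: "0 \<le> c" "finite F" "card F \<le> n"
    "\<And>x. x \<in> orth F \<Longrightarrow> inner x (T x) \<le> c * (norm x)\<^sup>2" by blast
  obtain A where A: "positive_op A" "A o\<^sub>L A = T" using positive_sqrt_exists[OF T] by metis
  have AA: "T x = A (A x)" for x using A(2) by (metis blinfun_apply_blinfun_compose)
  note symA = positive_op_symmetric[OF A(1)]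
  have form: "norm (A x) \<le> sqrt c * norm x" if "x \<in> orth F" for x
  proof (rule power2_le_imp_le)
    show "(norm (A x))\<^sup>2 \<le> (sqrt c * norm x)\<^sup>2"
      using F(4)[OF that] F(1) symmetric_op_inner[OF symA, of x "A x"]
      by (simp add: power_mult_distrib AA power2_norm_eq_inner)
  qed (use F in auto)
  show "snum_bound n T c"
  proof (rule snum_boundI[of _ "A ` F"])
    show "card (A ` F) \<le> n" using card_image_le[OF F(2), of A] F by linarith
    fix x assume x: "x \<in> orth (A ` F)"
    have "A x \<in> orth F"
      unfolding orth_def using x symmetric_op_cinner[OF symA] by (auto simp: orth_def)
    then have le: "norm (A (A x)) \<le> sqrt c * norm (A x)" by (rule form)
    have "norm (A x) * norm (A x) = inner x (A (A x))"
      by (simp add: symmetric_op_inner[OF symA, symmetric] flip: power2_norm_eq_inner power2_eq_square)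
    also have "\<dots> \<le> norm x * norm (A (A x))" by (rule norm_cauchy_schwarz)
    also have "\<dots> \<le> norm x * (sqrt c * norm (A x))" by (intro mult_left_mono le) auto
    finally have "norm (A x) \<le> sqrt c * norm x"
      using F(1) by (cases "norm (A x) = 0") (auto simp: mult_ac)
    then have "sqrt c * norm (A x) \<le> sqrt c * (sqrt c * norm x)" using F(1) by (intro mult_left_mono) auto
    then show "norm (T x) \<le> c * norm x" using le F(1) by (simp add: AA flip: mult.assoc)
  qed (use F in auto)
qed

lemma snum_mono_op_le:
  fixes S T :: "'h::complex_hilbert_space \<Rightarrow>\<^sub>L 'h"
  assumes S: "positive_op S" and le: "positive_op (T - S)"
  shows "snum n S \<le> snum n T"
proof (rule snum_le_snum)
  have T: "positive_op T" using positive_op_add[OF S le] by simp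
  have *: "inner x (S x) \<le> inner x (T x)" for x
    using positive_op_nonneg[OF le, of x] by (simp add: blinfun.bilinear_simps inner_simps)
  fix c assume "snum_bound n T c"
  then show "snum_bound n S c"
    unfolding snum_bound_positive_iff[OF S] snum_bound_positive_iff[OF T] using * order.trans by blast
qed

subsection \<open>Partial sums of singular numbers\<close>

text \<open>The sum of the first \<open>n\<close> singular numbers.\<close>

definition snum_sum :: "nat \<Rightarrow> ('h::complex_hilbert_space \<Rightarrow>\<^sub>L 'h) \<Rightarrow> real" where
  "snum_sum n T = (\<Sum>k<n. snum k T)"

text \<open>The sum of the diagonal entries of \<open>T\<close> on a finite orthonormal set.\<close>

definition partial_trace :: "'h::complex_hilbert_space set \<Rightarrow> ('h \<Rightarrow>\<^sub>L 'h) \<Rightarrow> real" where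
  "partial_trace E T = (\<Sum>e\<in>E. inner e (T e))"

lemma partial_trace_add: "partial_trace E (S + T) = partial_trace E S + partial_trace E T"
  by (simp add: partial_trace_def blinfun.bilinear_simps inner_add_right sum.distrib)

text \<open>The trace over a finite orthonormal set depends only on its span.\<close>

lemma partial_trace_basis_independent:
  fixes T :: "'h::complex_hilbert_space \<Rightarrow>\<^sub>L 'h"
  assumes T: "T \<in> bounded_ops" and E: "orthonormal E" "finite E" and G: "orthonormal G" "finite G"
    and span: "cspan E = cspan G"
  shows "partial_trace E T = partial_trace G T"
proof -
  have e: "onproj G e = e" if "e \<in> E" for e
    using onproj_id_on_span[OF G, of e] complex_vector.span_base[OF that] span by simp
  have g: "onproj E g = g" if "g \<in> G" for g
    using onproj_id_on_span[OF E, of g] complex_vector.span_base[OF that] span by simp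
  have "(\<Sum>e\<in>E. cinner e (T e)) = (\<Sum>e\<in>E. cinner e (T (onproj G e)))"
    by (intro sum.cong refl) (simp add: e)
  also have "\<dots> = (\<Sum>e\<in>E. \<Sum>g\<in>G. cinner g e * cinner e (T g))"
    by (simp add: onproj_apply blinfun.sum_right cinner_sum_right cinner_scaleC_right bounded_ops_scaleC[OF T])
  also have "\<dots> = (\<Sum>g\<in>G. \<Sum>e\<in>E. cinner g e * cinner e (T g))" by (rule sum.swap)
  also have "\<dots> = (\<Sum>g\<in>G. cinner g (onproj E (T g)))"
    by (simp add: onproj_apply cinner_sum_right cinner_scaleC_right mult.commute)
  also have "\<dots> = (\<Sum>g\<in>G. cinner g (T g))"
    by (intro sum.cong refl) (simp add: g flip: symmetric_op_cinner[OF symmetric_op_onproj])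
  finally have "Re (\<Sum>e\<in>E. cinner e (T e)) = Re (\<Sum>g\<in>G. cinner g (T g))" by simp
  then show ?thesis by (simp add: partial_trace_def inner_eq_Re_cinner)
qed

text \<open>Induction on \<open>n\<close>: if the form of \<open>T\<close> is bounded by \<open>c\<close> on the complement of \<open>n\<close> vectors, then
  the span of \<open>n + 1\<close> orthonormal vectors contains a unit vector orthogonal to these \<open>n\<close> vectors.
  It is made the first element of another orthonormal basis of the span; the remaining \<open>n\<close> elements
  are covered by the induction hypothesis.\<close>

lemma partial_trace_le_snum_sum:
  fixes T :: "'h::complex_hilbert_space \<Rightarrow>\<^sub>L 'h"
  assumes T: "positive_op T"
  shows "orthonormal E \<Longrightarrow> finite E \<Longrightarrow> card E \<le> n \<Longrightarrow> partial_trace E T \<le> snum_sum n T"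
proof (induction n arbitrary: E)
  case 0
  then show ?case by (simp add: partial_trace_def snum_sum_def)
next
  case (Suc n)
  note E = Suc.prems
  show ?case
  proof (cases "card E \<le> n")
    case True
    then show ?thesis using Suc.IH[OF E(1,2)] snum_nonneg[of n T] by (simp add: snum_sum_def)
  next
    case False
    then have card: "card E = Suc n" using E by simp
    have "partial_trace E T - snum_sum n T \<le> snum n T"
    proof (rule snum_greatest)
      fix c assume "snum_bound n T c"
      then obtain F where F: "finite F" "card F \<le> n" "\<And>x. x \<in> orth F \<Longrightarrow> inner x (T x) \<le> c * (norm x)\<^sup>2"
        unfolding snum_bound_positive_iff[OF T] by blast
      obtain v where v: "norm v = 1" "v \<in> cspan E" "v \<in> orth F"
        using exists_unit_in_span_orth[OF E(1,2) F(1)] F(2) card by auto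
      have "orthonormal {v}" using v by (simp add: orthonormal_def)
      then obtain G where G: "finite G" "orthonormal G" "{v} \<subseteq> G" "cspan G = cspan E"
        using orthonormal_extend[OF E(2), of "{v}"] v by auto
      have "card G = Suc n" using orthonormal_card_eq[OF G(2) E(1) G(1) E(2) G(4)] card by simp
      then have "partial_trace (G - {v}) T \<le> snum_sum n T"
        using G by (intro Suc.IH orthonormal_subset[OF G(2)]) auto
      moreover have "inner v (T v) \<le> c" using F(3)[OF v(3)] v(1) by simp
      moreover have "partial_trace E T = inner v (T v) + partial_trace (G - {v}) T"
        using partial_trace_basis_independent[OF positive_op_bounded[OF T] E(1,2) G(2,1) G(4)[symmetric]] G
        by (simp add: partial_trace_def sum.remove)
      ultimately show "partial_trace E T - snum_sum n T \<le> c" by simp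
    qed
    then show ?thesis by (simp add: snum_sum_def)
  qed
qed

text \<open>Conversely, near-maximizers of the quadratic form chosen greedily attain the sum approximately.\<close>

lemma snum_sum_le_partial_trace:
  fixes T :: "'h::complex_hilbert_space \<Rightarrow>\<^sub>L 'h" and d :: real
  assumes T: "positive_op T" and d: "0 < d"
  shows "\<exists>E. orthonormal E \<and> finite E \<and> card E \<le> n \<and> snum_sum n T \<le> partial_trace E T + n * d"
proof (induction n)
  case 0
  then show ?case by (intro exI[of _ "{}"]) (simp add: snum_sum_def partial_trace_def orthonormal_empty)
next
  case (Suc n)
  then obtain E where E: "orthonormal E" "finite E" "card E \<le> n" "snum_sum n T \<le> partial_trace E T + n * d"
    by blast
  show ?case
  proof (cases "snum n T \<le> d")
    case True
    then show ?thesis using E by (intro exI[of _ E]) (auto simp: snum_sum_def algebra_simps)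
  next
    case False
    have "\<not> snum_bound n T (snum n T - d)" using snum_le[of n T "snum n T - d"] d by auto
    then obtain x where x: "x \<in> orth E" "(snum n T - d) * (norm x)\<^sup>2 < inner x (T x)"
      unfolding snum_bound_positive_iff[OF T] using False E by force
    then have x0: "x \<noteq> 0" by auto
    define u where "u = (1 / norm x) *\<^sub>R x"
    have u: "norm u = 1" "u \<in> orth E" using x x0 by (auto simp: u_def orth_def cinner_simps)
    have "inner u (T u) = inner x (T x) / (norm x)\<^sup>2"
      by (simp add: u_def blinfun.bilinear_simps power2_eq_square)
    then have "inner x (T x) = inner u (T u) * (norm x)\<^sup>2" using x0 by simp
    then have le: "snum n T - d \<le> inner u (T u)"
      using x(2) mult_right_less_imp_less[of "snum n T - d" "(norm x)\<^sup>2" "inner u (T u)"] by simp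
    note ins = orthonormal_insert[OF E(1) u]
    have "partial_trace (insert u E) T = inner u (T u) + partial_trace E T"
      using E ins by (simp add: partial_trace_def)
    then have "snum_sum (Suc n) T \<le> partial_trace (insert u E) T + Suc n * d"
      using E(4) le by (simp add: snum_sum_def algebra_simps)
    then show ?thesis using ins E by (intro exI[of _ "insert u E"]) auto
  qed
qed

lemma le_of_le_add_epsilon_mult:
  fixes x y :: real
  assumes "\<And>d. 0 < d \<Longrightarrow> x \<le> y + k * d" "0 \<le> k"
  shows "x \<le> y"
proof (rule field_le_epsilon)
  fix e :: real assume "0 < e"
  then have "x \<le> y + k * (e / (k + 1))" using assms(2) by (intro assms(1)) simp
  also have "k * (e / (k + 1)) \<le> e" using assms(2) \<open>0 < e\<close> by (simp add: field_simps)
  finally show "x \<le> y + e" by simp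
qed

lemma snum_sum_subadditive:
  assumes S: "positive_op S" and T: "positive_op T"
  shows "snum_sum n (S + T) \<le> snum_sum n S + snum_sum n T"
proof (rule le_of_le_add_epsilon_mult[where k = n])
  fix d :: real assume "0 < d"
  then obtain E where E: "orthonormal E" "finite E" "card E \<le> n"
    "snum_sum n (S + T) \<le> partial_trace E (S + T) + n * d"
    using snum_sum_le_partial_trace[OF positive_op_add[OF S T]] by blast
  then show "snum_sum n (S + T) \<le> snum_sum n S + snum_sum n T + n * d"
    using partial_trace_le_snum_sum[OF S E(1-3)] partial_trace_le_snum_sum[OF T E(1-3)]
    by (simp add: partial_trace_add)
qed simp

lemma partial_trace_mono_span:
  assumes T: "positive_op T" and E: "orthonormal E" and B: "finite B" "E \<subseteq> cspan B" "orthonormal B"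
  shows "partial_trace E T \<le> partial_trace B T"
proof -
  obtain G where G: "finite G" "orthonormal G" "E \<subseteq> G" "cspan G = cspan B"
    using orthonormal_extend[OF B(1) E B(2)] .
  have "partial_trace E T \<le> partial_trace G T"
    unfolding partial_trace_def using G positive_op_nonneg[OF T] by (intro sum_mono2) auto
  also have "\<dots> = partial_trace B T"
    by (rule partial_trace_basis_independent[OF positive_op_bounded[OF T] G(2,1) B(3,1) G(4)])
  finally show ?thesis .
qed

text \<open>Near-maximizers for \<open>S\<close> and for \<open>T\<close>, of at most \<open>n\<close> vectors each, lie in a common span of dimension
  at most \<open>2 n\<close>. Positivity of the forms makes the partial traces increase with the span.\<close>

lemma snum_sum_superadditive:
  assumes S: "positive_op S" and T: "positive_op T"
  shows "snum_sum n S + snum_sum n T \<le> snum_sum (2 * n) (S + T)"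
proof (rule le_of_le_add_epsilon_mult[where k = "2 * n"])
  fix d :: real assume d: "0 < d"
  obtain E where E: "orthonormal E" "finite E" "card E \<le> n" "snum_sum n S \<le> partial_trace E S + n * d"
    using snum_sum_le_partial_trace[OF S d] by blast
  obtain F where F: "orthonormal F" "finite F" "card F \<le> n" "snum_sum n T \<le> partial_trace F T + n * d"
    using snum_sum_le_partial_trace[OF T d] by blast
  have "finite (E \<union> F)" using E F by simp
  from orthonormal_span_obtain[OF this] obtain B where B: "finite B" "orthonormal B" "card B \<le> card (E \<union> F)" "cspan B = cspan (E \<union> F)" .
  have sub: "E \<subseteq> cspan B" "F \<subseteq> cspan B"
    using complex_vector.span_superset[of "E \<union> F"] B(4) by auto
  have "card B \<le> 2 * n" using B(3) card_Un_le[of E F] E F by linarith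
  then have "partial_trace B (S + T) \<le> snum_sum (2 * n) (S + T)"
    by (rule partial_trace_le_snum_sum[OF positive_op_add[OF S T] B(2,1)])
  then show "snum_sum n S + snum_sum n T \<le> snum_sum (2 * n) (S + T) + 2 * n * d"
    using E(4) F(4) partial_trace_mono_span[OF S E(1) B(1) sub(1) B(2)]
      partial_trace_mono_span[OF T F(1) B(1) sub(2) B(2)]
    by (simp add: partial_trace_add)
qed simp

text \<open>This cruder estimate does not need positivity; it shows that the ideal is closed under addition.\<close>

lemma snum_sum_add_general: "snum_sum (2 * n) (S + T) \<le> 2 * (snum_sum n S + snum_sum n T)"
proof (induction n)
  case (Suc n)
  have "snum (2 * n) (S + T) \<le> snum n S + snum n T" using snum_add[of n n S T] by (simp add: mult_2)
  moreover have "snum (Suc (2 * n)) (S + T) \<le> snum (2 * n) (S + T)" by (rule snum_antimono) simp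
  ultimately show ?case using Suc by (simp add: snum_sum_def)
qed (simp add: snum_sum_def)

subsection \<open>The integrated singular value function\<close>

text \<open>The function \<open>\<Phi>\<^sub>T(t) = \<integral>\<^sub>0\<^sup>t \<mu>(s, T) ds\<close>; it is \<open>0\<close> for \<open>t \<le> 0\<close>.\<close>

definition sing_int :: "('h::complex_hilbert_space \<Rightarrow>\<^sub>L 'h) \<Rightarrow> real \<Rightarrow> real" where
  "sing_int T t = integral {0..t} (\<lambda>s. sing_val s T)"

lemma log_mean_eq: "log_mean T t = sing_int T t / ln (1 + t)"
  by (simp add: log_mean_def sing_int_def)

lemma sing_val_nonneg: "0 \<le> t \<Longrightarrow> 0 \<le> sing_val t T"
  by (simp add: sing_val_eq_snum snum_nonneg)

lemma sing_val_antimono: "0 \<le> s \<Longrightarrow> s \<le> t \<Longrightarrow> sing_val t T \<le> sing_val s T"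
  by (auto simp: sing_val_eq_snum intro!: snum_antimono nat_mono floor_mono)

lemma sing_val_integrable: "(\<lambda>s. sing_val s T) integrable_on {0..t}"
proof -
  have "mono_on {0..t} (\<lambda>s. - sing_val s T)"
    by (rule mono_onI) (auto intro: sing_val_antimono)
  then have "(\<lambda>s. - sing_val s T) integrable_on {0..t}" by (rule integrable_on_mono_on)
  then show ?thesis by (simp add: integrable_neg_iff)
qed

lemma sing_int_0: "t \<le> 0 \<Longrightarrow> sing_int T t = 0"
  by (cases "t = 0") (auto simp: sing_int_def)

lemma sing_int_mono: "s \<le> t \<Longrightarrow> sing_int T s \<le> sing_int T t"
  unfolding sing_int_def
  by (intro integral_subset_le sing_val_integrable) (auto intro: sing_val_nonneg)

lemma sing_int_nonneg: "0 \<le> sing_int T t"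
  using sing_int_mono[of "min 0 t" t T] sing_int_0[of "min 0 t" T] by simp

text \<open>On \<open>[n, n + 1)\<close> the singular value function is the constant \<open>snum n T\<close>.\<close>

lemma sing_int_nat: "sing_int T (real n) = snum_sum n T"
proof (induction n)
  case 0
  then show ?case by (simp add: sing_int_0 snum_sum_def)
next
  case (Suc n)
  have "((\<lambda>s. sing_val s T) has_integral snum n T * (real (Suc n) - real n)) {real n..real (Suc n)}"
  proof (rule has_integral_spike_finite)
    show "((\<lambda>s. snum n T) has_integral snum n T * (real (Suc n) - real n)) {real n..real (Suc n)}"
      using has_integral_const_real[of "snum n T" "real n" "real (Suc n)"] by simp
    fix s assume s: "s \<in> {real n..real (Suc n)} - {real (Suc n)}"
    then have "\<lfloor>s\<rfloor> = int n" by (intro floor_unique) auto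
    then show "sing_val s T = snum n T" using s by (simp add: sing_val_eq_snum)
  qed simp
  then have "integral {real n..real (Suc n)} (\<lambda>s. sing_val s T) = snum n T"
    by (simp add: integral_unique)
  moreover have "sing_int T (real n) + integral {real n..real (Suc n)} (\<lambda>s. sing_val s T) = sing_int T (real (Suc n))"
    unfolding sing_int_def by (intro Henstock_Kurzweil_Integration.integral_combine sing_val_integrable) auto
  ultimately show ?case using Suc by (simp add: snum_sum_def)
qed

lemma sing_int_le_snum_sum:
  assumes "0 \<le> t"
  shows "sing_int T t \<le> snum_sum (Suc (nat \<lfloor>t\<rfloor>)) T"
    and "snum_sum (Suc (nat \<lfloor>t\<rfloor>)) T \<le> sing_int T (t + 1)"
    and "snum_sum (2 * Suc (nat \<lfloor>t\<rfloor>)) T \<le> sing_int T (2 * t + 2)"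
proof -
  have "t \<le> real (Suc (nat \<lfloor>t\<rfloor>))" "real (Suc (nat \<lfloor>t\<rfloor>)) \<le> t + 1"
    using assms by linarith+
  then show "sing_int T t \<le> snum_sum (Suc (nat \<lfloor>t\<rfloor>)) T"
    "snum_sum (Suc (nat \<lfloor>t\<rfloor>)) T \<le> sing_int T (t + 1)"
    "snum_sum (2 * Suc (nat \<lfloor>t\<rfloor>)) T \<le> sing_int T (2 * t + 2)"
    unfolding sing_int_nat[symmetric] by (auto intro!: sing_int_mono)
qed

lemma sing_int_le_cmult:
  assumes "\<And>n. snum n S \<le> k * snum n T"
  shows "sing_int S t \<le> k * sing_int T t"
proof -
  have "sing_int S t \<le> integral {0..t} (\<lambda>s. k * sing_val s T)"
    unfolding sing_int_def
    by (intro integral_le sing_val_integrable integrable_on_mult_right)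
       (use assms in \<open>auto simp: sing_val_eq_snum\<close>)
  then show ?thesis by (simp add: sing_int_def)
qed

lemma sing_int_subadditive:
  assumes "positive_op S" "positive_op T" "0 \<le> t"
  shows "sing_int (S + T) t \<le> sing_int S (t + 1) + sing_int T (t + 1)"
  using sing_int_le_snum_sum(1)[OF assms(3), of "S + T"] sing_int_le_snum_sum(2)[OF assms(3), of S]
    sing_int_le_snum_sum(2)[OF assms(3), of T] snum_sum_subadditive[OF assms(1,2), of "Suc (nat \<lfloor>t\<rfloor>)"]
  by linarith

lemma sing_int_superadditive:
  assumes "positive_op S" "positive_op T" "0 \<le> t"
  shows "sing_int S t + sing_int T t \<le> sing_int (S + T) (2 * t + 2)"
  using sing_int_le_snum_sum(3)[OF assms(3), of "S + T"] sing_int_le_snum_sum(1)[OF assms(3), of S]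
    sing_int_le_snum_sum(1)[OF assms(3), of T] snum_sum_superadditive[OF assms(1,2), of "Suc (nat \<lfloor>t\<rfloor>)"]
  by linarith

lemma sing_int_add_general:
  assumes "0 \<le> t"
  shows "sing_int (S + T) t \<le> 2 * (sing_int S (t + 1) + sing_int T (t + 1))"
proof -
  have "sing_int (S + T) t \<le> snum_sum (Suc (nat \<lfloor>t\<rfloor>)) (S + T)" by (rule sing_int_le_snum_sum[OF assms])
  also have "\<dots> \<le> snum_sum (2 * Suc (nat \<lfloor>t\<rfloor>)) (S + T)"
    unfolding snum_sum_def by (intro sum_mono2) (auto simp: snum_nonneg)
  also have "\<dots> \<le> 2 * (snum_sum (Suc (nat \<lfloor>t\<rfloor>)) S + snum_sum (Suc (nat \<lfloor>t\<rfloor>)) T)"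
    by (rule snum_sum_add_general)
  also have "\<dots> \<le> 2 * (sing_int S (t + 1) + sing_int T (t + 1))"
    by (intro mult_left_mono add_mono sing_int_le_snum_sum(2)[OF assms]) simp
  finally show ?thesis .
qed

section \<open>The Dixmier ideal\<close>

lemma ln_ge_half: "t / 2 \<le> ln (1 + t)" if "0 \<le> t" "t \<le> 1" for t :: real
proof -
  have "ln (1 / (1 + t)) \<le> 1 / (1 + t) - 1" using that by (intro ln_le_minus_one) simp
  then have "1 - 1 / (1 + t) \<le> ln (1 + t)" using that by (simp add: ln_div)
  moreover have "t / 2 \<le> 1 - 1 / (1 + t)"
    using that mult_left_mono[of t 1 t] by (simp add: field_simps)
  ultimately show ?thesis by simp
qed

text \<open>Only large arguments matter: near \<open>0\<close> the logarithmic mean is bounded by \<open>2 \<mu>(0, T)\<close>.\<close>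

lemma dixmier_ideal_iff:
  "T \<in> dixmier_ideal \<longleftrightarrow> T \<in> bounded_ops \<and> (\<exists>C. \<forall>t\<ge>1. sing_int T t \<le> C * ln (1 + t))"
proof
  assume T: "T \<in> dixmier_ideal"
  then obtain C where C: "\<And>t. t > 0 \<Longrightarrow> log_mean T t \<le> C"
    by (auto simp: dixmier_ideal_def bdd_above_def)
  have "sing_int T t \<le> C * ln (1 + t)" if "t \<ge> 1" for t
    using C[of t] that by (simp add: log_mean_eq divide_le_eq)
  then show "T \<in> bounded_ops \<and> (\<exists>C. \<forall>t\<ge>1. sing_int T t \<le> C * ln (1 + t))"
    using T by (auto simp: dixmier_ideal_def)
next
  assume "T \<in> bounded_ops \<and> (\<exists>C. \<forall>t\<ge>1. sing_int T t \<le> C * ln (1 + t))"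
  then obtain C where T: "T \<in> bounded_ops" and C: "\<And>t. t \<ge> 1 \<Longrightarrow> sing_int T t \<le> C * ln (1 + t)" by blast
  have small: "sing_int T t \<le> snum 0 T * t" if "0 \<le> t" for t
  proof -
    have "sing_int T t \<le> integral {0..t} (\<lambda>s. snum 0 T)"
      unfolding sing_int_def
      by (intro integral_le sing_val_integrable) (auto simp: sing_val_eq_snum snum_antimono)
    then show ?thesis using that by (simp add: mult.commute)
  qed
  have "log_mean T t \<le> max C (2 * snum 0 T)" if t: "t > 0" for t
  proof (cases "t \<ge> 1")
    case True
    then have "log_mean T t \<le> C" using C[OF True] by (simp add: log_mean_eq divide_le_eq)
    then show ?thesis by simp
  next
    case False
    have "snum 0 T * t \<le> snum 0 T * (2 * ln (1 + t))"
      using ln_ge_half[of t] t False by (intro mult_left_mono snum_nonneg) auto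
    then have "log_mean T t \<le> 2 * snum 0 T"
      using small[of t] t by (simp add: log_mean_eq divide_le_eq)
    then show ?thesis by simp
  qed
  then show "T \<in> dixmier_ideal"
    unfolding dixmier_ideal_def using T by (auto intro!: bdd_aboveI2)
qed

lemma dixmier_ideal_bounded: "T \<in> dixmier_ideal \<Longrightarrow> T \<in> bounded_ops"
  by (simp add: dixmier_ideal_def)

lemma dixmier_ideal_add:
  assumes "S \<in> dixmier_ideal" "T \<in> dixmier_ideal"
  shows "S + T \<in> dixmier_ideal"
proof -
  obtain C D where C: "\<And>t. t \<ge> 1 \<Longrightarrow> sing_int S t \<le> C * ln (1 + t)"
    and D: "\<And>t. t \<ge> 1 \<Longrightarrow> sing_int T t \<le> D * ln (1 + t)"
    using assms unfolding dixmier_ideal_iff by blast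
  have C0: "0 \<le> C" using order.trans[OF sing_int_nonneg C[of 1]] by (simp add: zero_le_mult_iff)
  have D0: "0 \<le> D" using order.trans[OF sing_int_nonneg D[of 1]] by (simp add: zero_le_mult_iff)
  have "sing_int (S + T) t \<le> (4 * (C + D)) * ln (1 + t)" if t: "t \<ge> 1" for t
  proof -
    have "ln (1 + (t + 1)) \<le> ln ((1 + t) * (1 + t))"
      using t mult_mono[of 1 t 1 t] by (subst ln_le_cancel_iff) (auto simp: algebra_simps)
    also have "\<dots> = 2 * ln (1 + t)" using t by (simp add: ln_mult)
    finally have l: "ln (1 + (t + 1)) \<le> 2 * ln (1 + t)" .
    have "sing_int (S + T) t \<le> 2 * (sing_int S (t + 1) + sing_int T (t + 1))"
      by (rule sing_int_add_general) (use t in simp)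
    also have "\<dots> \<le> 2 * (C * ln (1 + (t + 1)) + D * ln (1 + (t + 1)))"
      using t by (intro mult_left_mono add_mono C D) auto
    also have "\<dots> = 2 * (C + D) * ln (1 + (t + 1))" by (simp add: algebra_simps)
    also have "\<dots> \<le> 2 * (C + D) * (2 * ln (1 + t))" using C0 D0 by (intro mult_left_mono l) auto
    finally show ?thesis by (simp add: algebra_simps)
  qed
  then show ?thesis
    using assms bounded_ops_add dixmier_ideal_bounded unfolding dixmier_ideal_iff by blast
qed

lemma dixmier_ideal_snum_le:
  assumes "T \<in> dixmier_ideal" "S \<in> bounded_ops" "\<And>n. snum n S \<le> k * snum n T" "0 \<le> k"
  shows "S \<in> dixmier_ideal"
proof -
  obtain C where C: "\<And>t. t \<ge> 1 \<Longrightarrow> sing_int T t \<le> C * ln (1 + t)"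
    using assms(1) unfolding dixmier_ideal_iff by blast
  have "sing_int S t \<le> (k * C) * ln (1 + t)" if "t \<ge> 1" for t
    using sing_int_le_cmult[OF assms(3), of t] mult_left_mono[OF C[OF that] assms(4)] by (simp add: mult.assoc)
  then show ?thesis using assms(2) unfolding dixmier_ideal_iff by blast
qed

lemma dixmier_ideal_scaleC_op: "T \<in> dixmier_ideal \<Longrightarrow> scaleC_op c T \<in> dixmier_ideal"
  by (rule dixmier_ideal_snum_le[of T _ "cmod c"])
     (auto intro!: bounded_ops_scaleC_op snum_le_of_norm_le simp: dixmier_ideal_bounded norm_scaleC)

lemma dixmier_ideal_scaleR: "T \<in> dixmier_ideal \<Longrightarrow> r *\<^sub>R T \<in> dixmier_ideal"
  by (rule dixmier_ideal_snum_le[of T _ "\<bar>r\<bar>"])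
     (auto intro!: bounded_ops_scaleR snum_le_of_norm_le simp: dixmier_ideal_bounded blinfun.bilinear_simps)

lemma dixmier_ideal_diff: "S \<in> dixmier_ideal \<Longrightarrow> T \<in> dixmier_ideal \<Longrightarrow> S - T \<in> dixmier_ideal"
  using dixmier_ideal_add[of S "(-1) *\<^sub>R T"] dixmier_ideal_scaleR[of T "-1"] by simp

lemma dixmier_ideal_0: "0 \<in> dixmier_ideal"
proof -
  have "sing_int 0 t \<le> 0 * sing_int 0 t" for t
    by (rule sing_int_le_cmult) (simp add: snum_0)
  then show ?thesis unfolding dixmier_ideal_iff by (auto simp: bounded_ops_0 intro!: exI[of _ 0])
qed

lemma dixmier_ideal_adjoint: "T \<in> dixmier_ideal \<Longrightarrow> adjoint T \<in> dixmier_ideal"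
  by (rule dixmier_ideal_snum_le[of T _ 1])
     (auto intro!: adjoint_in_bounded_ops snum_adjoint_le simp: dixmier_ideal_bounded)

text \<open>A self-adjoint operator \<open>T\<close> of the ideal is the difference of the positive operators
  \<open>\<bar>T\<bar>\<close> and \<open>\<bar>T\<bar> - T\<close> of the ideal.\<close>

lemma symmetric_op_decomposition:
  assumes T: "symmetric_op T" "T \<in> dixmier_ideal"
  obtains A B where "positive_op A" "positive_op B" "A \<in> dixmier_ideal" "B \<in> dixmier_ideal" "T = A - B"
proof -
  obtain A where A: "positive_op A" "positive_op (A - T)" "\<And>x. norm (A x) = norm (T x)"
    using absolute_value_exists[OF T(1)] by blast
  have "A \<in> dixmier_ideal"
    by (rule dixmier_ideal_snum_le[OF T(2) positive_op_bounded[OF A(1)], of 1])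
       (use A(3) snum_le_of_norm_le[of 1 A T] in auto)
  then show ?thesis using that[of A "A - T"] A T dixmier_ideal_diff by auto
qed

section \<open>Exponentiation invariant generalized limits\<close>

lemma L_inftyI:
  assumes "f \<in> borel_measurable borel" "\<And>t. t > 0 \<Longrightarrow> \<bar>f t\<bar> \<le> C"
  shows "f \<in> L_infty"
proof -
  have "f \<in> borel_measurable lebesgue" using assms(1) by (simp add: measurable_completion)
  then have "f \<in> borel_measurable (lebesgue_on {0<..})" by (rule measurable_restrict_space1)
  moreover have "bounded (f ` {0<..})" using assms(2) by (auto simp: bounded_iff)
  ultimately show ?thesis by (simp add: L_infty_def)
qed

lemma L_infty_bound: "f \<in> L_infty \<Longrightarrow> \<exists>C. \<forall>t>0. \<bar>f t\<bar> \<le> C"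
  by (auto simp: L_infty_def bounded_iff)

lemma L_infty_add:
  assumes "f \<in> L_infty" "g \<in> L_infty"
  shows "(\<lambda>t. f t + g t) \<in> L_infty"
proof -
  obtain C D where "\<And>t. t > 0 \<Longrightarrow> \<bar>f t\<bar> \<le> C" "\<And>t. t > 0 \<Longrightarrow> \<bar>g t\<bar> \<le> D"
    using L_infty_bound assms by metis
  then have "\<bar>f t + g t\<bar> \<le> C + D" if "t > 0" for t using that by (smt (verit))
  then have "bounded ((\<lambda>t. f t + g t) ` {0<..})" by (auto simp: bounded_iff)
  then show ?thesis using assms by (simp add: L_infty_def borel_measurable_add)
qed

lemma L_infty_cmult:
  assumes "f \<in> L_infty"
  shows "(\<lambda>t. c * f t) \<in> L_infty"
proof -
  obtain C where "\<And>t. t > 0 \<Longrightarrow> \<bar>f t\<bar> \<le> C" using L_infty_bound assms by metis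
  then have "\<bar>c * f t\<bar> \<le> \<bar>c\<bar> * C" if "t > 0" for t using that by (simp add: abs_mult mult_left_mono)
  then have "bounded ((\<lambda>t. c * f t) ` {0<..})" by (auto simp: bounded_iff)
  then show ?thesis using assms by (simp add: L_infty_def borel_measurable_times)
qed

lemma L_infty_max0:
  assumes "f \<in> L_infty"
  shows "(\<lambda>t. max 0 (f t)) \<in> L_infty"
proof -
  obtain C where C: "\<And>t. t > 0 \<Longrightarrow> \<bar>f t\<bar> \<le> C" using L_infty_bound assms by metis
  have "\<bar>max 0 (f t)\<bar> \<le> C" if "t > 0" for t using C[OF that] by linarith
  then have "bounded ((\<lambda>t. max 0 (f t)) ` {0<..})" by (auto simp: bounded_iff)
  then show ?thesis using assms by (simp add: L_infty_def borel_measurable_max)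
qed

text \<open>Generalized limits ignore the values of a function on bounded sets.\<close>

lemma generalized_limit_mono:
  assumes \<omega>: "generalized_limit \<omega>" and f: "f \<in> L_infty" and g: "g \<in> L_infty"
    and le: "\<forall>\<^sub>F t in at_top. f t \<le> g t"
  shows "\<omega> f \<le> \<omega> g"
proof -
  have add: "\<And>x y. x \<in> L_infty \<Longrightarrow> y \<in> L_infty \<Longrightarrow> \<omega> (\<lambda>t. x t + y t) = \<omega> x + \<omega> y"
    and cmult: "\<And>c x. x \<in> L_infty \<Longrightarrow> \<omega> (\<lambda>t. c * x t) = c * \<omega> x"
    and pos: "\<And>x. x \<in> L_infty \<Longrightarrow> (\<And>t. 0 \<le> x t) \<Longrightarrow> 0 \<le> \<omega> x"
    and lim: "\<And>x l. x \<in> L_infty \<Longrightarrow> (x \<longlongrightarrow> l) at_top \<Longrightarrow> \<omega> x = l"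
    using \<omega> by (auto simp: generalized_limit_def)
  define d where "d = (\<lambda>t. g t + (-1) * f t)"
  define n where "n = (\<lambda>t. max 0 ((-1) * d t))"
  have d: "d \<in> L_infty" unfolding d_def by (intro L_infty_add L_infty_cmult f g)
  have n: "n \<in> L_infty" unfolding n_def by (intro L_infty_max0 L_infty_cmult d)
  have "\<forall>\<^sub>F t in at_top. n t = 0" using le by eventually_elim (simp add: n_def d_def)
  then have "(n \<longlongrightarrow> 0) at_top" by (rule tendsto_eventually)
  then have "\<omega> n = 0" using lim n by blast
  moreover have "0 \<le> \<omega> (\<lambda>t. d t + n t)"
    by (rule pos[OF L_infty_add[OF d n]]) (simp add: n_def)
  moreover have "\<omega> (\<lambda>t. d t + n t) = \<omega> d + \<omega> n" by (rule add[OF d n])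
  moreover have "\<omega> d = \<omega> g - \<omega> f"
    unfolding d_def using add[OF g L_infty_cmult[OF f, of "-1"]] cmult[OF f, of "-1"] by simp
  ultimately show ?thesis by simp
qed

lemma generalized_limit_nonneg:
  assumes \<omega>: "generalized_limit \<omega>" and f: "f \<in> L_infty" and le: "\<forall>\<^sub>F t in at_top. 0 \<le> f t"
  shows "0 \<le> \<omega> f"
proof -
  have c: "(\<lambda>t. 0) \<in> L_infty" by (rule L_inftyI[of _ 0]) auto
  then have "\<omega> (\<lambda>t. 0) = 0" using \<omega> by (auto simp: generalized_limit_def)
  then show ?thesis using generalized_limit_mono[OF \<omega> c f le] by simp
qed

text \<open>The key property of exponentiation invariant limits. Replacing \<open>t\<close> by \<open>2 t + 2\<close> in the
  numerator has no influence on the limit of a logarithmic mean, because \<open>2 t + 2 \<le> t\<^sup>1\<^sup>+\<^sup>\<epsilon>\<close>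
  eventually while \<open>ln (1 + t\<^sup>1\<^sup>+\<^sup>\<epsilon>) \<le> (1 + 2 \<epsilon>) ln (1 + t)\<close>.\<close>

lemma exponentiation_invariant_le:
  fixes \<Phi> \<Psi> :: "real \<Rightarrow> real"
  defines "f \<equiv> (\<lambda>t. \<Psi> t / ln (1 + t))" and "g \<equiv> (\<lambda>t. \<Phi> t / ln (1 + t))"
  assumes \<omega>: "generalized_limit \<omega>" "exponentiation_invariant \<omega>"
    and f: "f \<in> L_infty" and g: "g \<in> borel_measurable borel" "\<And>t. t > 0 \<Longrightarrow> g t \<le> C"
    and \<Phi>: "mono \<Phi>" "\<And>t. 0 \<le> \<Phi> t" and le: "\<And>t. t \<ge> 0 \<Longrightarrow> \<Psi> t \<le> \<Phi> (2 * t + 2)"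
  shows "\<omega> f \<le> \<omega> g"
proof (rule le_of_le_add_epsilon_mult[where k = "2 * \<omega> g"])
  have g0: "0 \<le> g t" if "t > 0" for t using that \<Phi>(2)[of t] by (simp add: g_def)
  have gC: "\<bar>g t\<bar> \<le> C" if "t > 0" for t using g0[OF that] g(2)[OF that] by simp
  have gL: "g \<in> L_infty" by (rule L_inftyI[OF g(1) gC])
  have "\<forall>\<^sub>F t in at_top. 0 \<le> g t"
    using eventually_gt_at_top[of 0] by eventually_elim (rule g0)
  then show "0 \<le> 2 * \<omega> g" using generalized_limit_nonneg[OF \<omega>(1) gL] by simp
  fix d :: real assume d: "0 < d"
  define a where "a = 1 + d"
  have ga: "(\<lambda>t. g (t powr a)) \<in> L_infty"
  proof (rule L_inftyI)
    show "(\<lambda>t. g (t powr a)) \<in> borel_measurable borel"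
      by (rule measurable_compose[OF _ g(1)]) simp
    show "\<bar>g (t powr a)\<bar> \<le> C" if "t > 0" for t using that by (intro gC) simp
  qed
  have "\<omega> f \<le> \<omega> (\<lambda>t. (1 + 2 * d) * g (t powr a))"
  proof (rule generalized_limit_mono[OF \<omega>(1) f L_infty_cmult[OF ga]])
    show "\<forall>\<^sub>F t in at_top. f t \<le> (1 + 2 * d) * g (t powr a)"
      using eventually_ge_at_top[of "max 1 (4 powr (1 / d))"]
    proof eventually_elim
      case (elim t)
      then have t: "1 \<le> t" by simp
      \<comment> \<open>The threshold for \<open>t\<close> ensures \<open>t\<^sup>d \<ge> 4\<close>, where \<open>4\<close> comes from \<open>2 t + 2 \<le> 4 t\<close>.\<close>
      have "(4 powr (1 / d)) powr d \<le> t powr d" using elim d by (intro powr_mono2) auto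
      then have t4: "4 \<le> t powr d" using d by (simp add: powr_powr)
      have ta: "t powr a = t * t powr d" using t by (simp add: a_def powr_add)
      then have "t * 4 \<le> t powr a" using t t4 by (simp add: mult_left_mono)
      then have big: "2 * t + 2 \<le> t powr a" using t by linarith
      have "1 + t powr a \<le> t powr d * t powr a"
        using big t mult_right_mono[OF t4, of "t powr a"] by linarith
      also have "\<dots> = t powr (d + a)" by (simp add: powr_add)
      finally have "ln (1 + t powr a) \<le> ln (t powr (d + a))"
        using t by (subst ln_le_cancel_iff) (auto intro: add_pos_nonneg)
      also have "\<dots> = (1 + 2 * d) * ln t" using t by (simp add: ln_powr a_def)
      also have "\<dots> \<le> (1 + 2 * d) * ln (1 + t)" using t d by (intro mult_left_mono) auto
      finally have lnle: "ln (1 + t powr a) \<le> (1 + 2 * d) * ln (1 + t)" .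
      have pos: "0 < ln (1 + t)" "0 < ln (1 + t powr a)" using t big by auto
      have "f t \<le> \<Phi> (t powr a) / ln (1 + t)"
        unfolding f_def using le[of t] monoD[OF \<Phi>(1) big] t pos by (intro divide_right_mono) auto
      also have "\<dots> = g (t powr a) * (ln (1 + t powr a) / ln (1 + t))"
        using pos by (simp add: g_def)
      also have "\<dots> \<le> g (t powr a) * (1 + 2 * d)"
        using t pos lnle by (intro mult_left_mono g0) (auto simp: divide_le_eq)
      finally show "f t \<le> (1 + 2 * d) * g (t powr a)" by (simp add: mult.commute)
    qed
  qed
  also have "\<dots> = (1 + 2 * d) * \<omega> (\<lambda>t. g (t powr a))"
    using \<omega>(1) ga by (simp add: generalized_limit_def)
  also have "\<omega> (\<lambda>t. g (t powr a)) = \<omega> g"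
    using \<omega>(2) gL d by (simp add: exponentiation_invariant_def a_def)
  finally show "\<omega> f \<le> \<omega> g + 2 * \<omega> g * d" by (simp add: algebra_simps)
qed

section \<open>The weight on positive operators\<close>

lemma log_mean_nonneg: "0 < t \<Longrightarrow> 0 \<le> log_mean T t"
  by (simp add: log_mean_eq sing_int_nonneg)

lemma mono_sing_int: "mono (sing_int T)"
  by (rule monoI) (rule sing_int_mono)

lemma log_mean_measurable: "log_mean T \<in> borel_measurable borel"
proof -
  have [measurable]: "sing_int T \<in> borel_measurable borel" by (rule borel_measurable_mono[OF mono_sing_int])
  have "(\<lambda>t. sing_int T t / ln (1 + t)) \<in> borel_measurable borel" by measurable
  then show ?thesis by (simp add: log_mean_eq[abs_def])
qed

lemma log_mean_bounded:
  assumes "T \<in> dixmier_ideal"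
  shows "\<exists>C. \<forall>t>0. log_mean T t \<le> C"
  using assms by (auto simp: dixmier_ideal_def bdd_above_def)

lemma log_mean_L_infty:
  assumes "T \<in> dixmier_ideal"
  shows "log_mean T \<in> L_infty"
proof -
  obtain C where "\<And>t. t > 0 \<Longrightarrow> log_mean T t \<le> C" using log_mean_bounded[OF assms] by blast
  then show ?thesis using log_mean_nonneg[of _ T] by (intro L_inftyI[OF log_mean_measurable, of _ C]) simp
qed

lemma log_mean_cong: "(\<And>n. snum n S = snum n T) \<Longrightarrow> log_mean S = log_mean T"
proof
  fix t assume "\<And>n. snum n S = snum n T"
  then have "integral {0..t} (\<lambda>s. sing_val s S) = integral {0..t} (\<lambda>s. sing_val s T)"
    by (intro Henstock_Kurzweil_Integration.integral_cong) (simp add: sing_val_eq_snum)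
  then show "log_mean S t = log_mean T t" by (simp add: log_mean_def)
qed

lemma log_mean_scaleR:
  assumes "0 \<le> r"
  shows "log_mean (r *\<^sub>R T) = (\<lambda>t. r * log_mean T t)"
proof
  fix t
  have "integral {0..t} (\<lambda>s. sing_val s (r *\<^sub>R T)) = integral {0..t} (\<lambda>s. r * sing_val s T)"
    by (intro Henstock_Kurzweil_Integration.integral_cong) (simp add: sing_val_eq_snum snum_scaleR assms)
  then show "log_mean (r *\<^sub>R T) t = r * log_mean T t" by (simp add: log_mean_def)
qed

lemma Tr_weight_nonneg:
  assumes "generalized_limit \<omega>" "T \<in> dixmier_ideal"
  shows "0 \<le> Tr_weight \<omega> T"
  unfolding Tr_weight_def
proof (rule generalized_limit_nonneg[OF assms(1) log_mean_L_infty[OF assms(2)]])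
  show "\<forall>\<^sub>F t in at_top. 0 \<le> log_mean T t"
    using eventually_gt_at_top[of 0] by eventually_elim (rule log_mean_nonneg)
qed

lemma Tr_weight_scaleR:
  assumes "generalized_limit \<omega>" "T \<in> dixmier_ideal" "0 \<le> r"
  shows "Tr_weight \<omega> (r *\<^sub>R T) = r * Tr_weight \<omega> T"
  using assms log_mean_L_infty[OF assms(2)] by (simp add: Tr_weight_def log_mean_scaleR generalized_limit_def)

lemma Tr_weight_add:
  assumes \<omega>: "generalized_limit \<omega>" "exponentiation_invariant \<omega>"
    and S: "positive_op S" "S \<in> dixmier_ideal" and T: "positive_op T" "T \<in> dixmier_ideal"
  shows "Tr_weight \<omega> (S + T) = Tr_weight \<omega> S + Tr_weight \<omega> T"
proof -
  \<comment> \<open>Both inequalities are instances of \<open>exponentiation_invariant_le\<close>, with \<open>\<Phi>\<close> and \<open>\<Psi>\<close> exchanged.\<close>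
  let ?\<Phi> = "\<lambda>t. sing_int S t + sing_int T t"
  have eq: "(\<lambda>t. ?\<Phi> t / ln (1 + t)) = (\<lambda>t. log_mean S t + log_mean T t)"
    by (simp add: log_mean_eq add_divide_distrib fun_eq_iff)
  have eq': "(\<lambda>t. sing_int (S + T) t / ln (1 + t)) = log_mean (S + T)"
    by (simp add: log_mean_eq fun_eq_iff)
  have L: "log_mean (S + T) \<in> L_infty" "(\<lambda>t. log_mean S t + log_mean T t) \<in> L_infty"
    by (intro L_infty_add log_mean_L_infty dixmier_ideal_add S T)+
  have sum: "\<omega> (\<lambda>t. log_mean S t + log_mean T t) = \<omega> (log_mean S) + \<omega> (log_mean T)"
    using \<omega>(1) log_mean_L_infty[OF S(2)] log_mean_L_infty[OF T(2)] by (simp add: generalized_limit_def)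
  obtain C D E where C: "\<And>t. t > 0 \<Longrightarrow> log_mean S t \<le> C" and D: "\<And>t. t > 0 \<Longrightarrow> log_mean T t \<le> D"
    and E: "\<And>t. t > 0 \<Longrightarrow> log_mean (S + T) t \<le> E"
    using log_mean_bounded S T dixmier_ideal_add by metis
  have "\<omega> (\<lambda>t. sing_int (S + T) t / ln (1 + t)) \<le> \<omega> (\<lambda>t. ?\<Phi> t / ln (1 + t))"
  proof (rule exponentiation_invariant_le[OF \<omega>, where C = "C + D"])
    show "(\<lambda>t. sing_int (S + T) t / ln (1 + t)) \<in> L_infty" unfolding eq' by (rule L)
    show "(\<lambda>t. ?\<Phi> t / ln (1 + t)) \<in> borel_measurable borel"
      unfolding eq by (intro borel_measurable_add log_mean_measurable)
    show "?\<Phi> t / ln (1 + t) \<le> C + D" if "t > 0" for t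
      using C[OF that] D[OF that] by (simp add: log_mean_eq add_divide_distrib)
    show "mono ?\<Phi>" by (intro monoI add_mono sing_int_mono)
    show "0 \<le> ?\<Phi> t" for t by (simp add: sing_int_nonneg)
    show "sing_int (S + T) t \<le> ?\<Phi> (2 * t + 2)" if "t \<ge> 0" for t
      using sing_int_subadditive[OF S(1) T(1) that] that
        sing_int_mono[of "t + 1" "2 * t + 2" S] sing_int_mono[of "t + 1" "2 * t + 2" T] by simp
  qed
  moreover have "\<omega> (\<lambda>t. ?\<Phi> t / ln (1 + t)) \<le> \<omega> (\<lambda>t. sing_int (S + T) t / ln (1 + t))"
  proof (rule exponentiation_invariant_le[OF \<omega>, where C = E])
    show "(\<lambda>t. ?\<Phi> t / ln (1 + t)) \<in> L_infty" unfolding eq by (rule L)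
    show "(\<lambda>t. sing_int (S + T) t / ln (1 + t)) \<in> borel_measurable borel"
      unfolding eq' by (rule log_mean_measurable)
    show "sing_int (S + T) t / ln (1 + t) \<le> E" if "t > 0" for t
      using E[OF that] by (simp add: log_mean_eq)
  qed (use mono_sing_int sing_int_nonneg sing_int_superadditive[OF S(1) T(1)] in auto)
  ultimately show ?thesis unfolding eq eq' sum Tr_weight_def by simp
qed

lemma Tr_weight_0: "generalized_limit \<omega> \<Longrightarrow> Tr_weight \<omega> 0 = 0"
  using Tr_weight_scaleR[of \<omega> 0 0] dixmier_ideal_0 by simp

lemma
  assumes "unitary_op U"
  shows unitary_op_bounded: "U \<in> bounded_ops"
    and unitary_op_adjoint_apply: "adjoint U (U x) = x" "U (adjoint U x) = x"
    and norm_unitary_op: "norm (U x) = norm x" "norm (adjoint U x) = norm x"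
proof -
  show U: "U \<in> bounded_ops" using assms by (simp add: unitary_op_def)
  have "(adjoint U o\<^sub>L U) y = y" "(U o\<^sub>L adjoint U) y = y" for y
    using assms by (simp_all add: unitary_op_def)
  then show inv: "adjoint U (U x) = x" "U (adjoint U x) = x" for x by simp_all
  have "inner (U x) (U x) = inner x x" for x using inner_adjoint[OF U, of "U x" x] by (simp add: inv)
  then show n: "norm (U x) = norm x" for x by (simp add: norm_eq_sqrt_inner)
  show "norm (adjoint U x) = norm x" using n[of "adjoint U x"] by (simp add: inv)
qed

lemma snum_unitary:
  assumes U: "unitary_op U"
  shows "snum n (adjoint U o\<^sub>L T o\<^sub>L U) = snum n T"
proof (rule antisym)
  note bU = unitary_op_bounded[OF U]
  show "snum n (adjoint U o\<^sub>L T o\<^sub>L U) \<le> snum n T"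
    by (rule snum_contractions) (simp_all add: bU norm_unitary_op[OF U])
  have "T = U o\<^sub>L (adjoint U o\<^sub>L T o\<^sub>L U) o\<^sub>L adjoint U"
    by (intro blinfun_eqI) (simp add: unitary_op_adjoint_apply[OF U])
  moreover have "snum n (U o\<^sub>L (adjoint U o\<^sub>L T o\<^sub>L U) o\<^sub>L adjoint U) \<le> snum n (adjoint U o\<^sub>L T o\<^sub>L U)"
    by (rule snum_contractions) (simp_all add: adjoint_in_bounded_ops[OF bU] norm_unitary_op[OF U])
  ultimately show "snum n T \<le> snum n (adjoint U o\<^sub>L T o\<^sub>L U)" by simp
qed

section \<open>Linear extension to the ideal\<close>

text \<open>The positive cone of the ideal.\<close>

definition ideal_pos :: "('h::complex_hilbert_space \<Rightarrow>\<^sub>L 'h) set" where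
  "ideal_pos = {T \<in> dixmier_ideal. positive_op T}"

text \<open>\<open>trace_value \<omega> T z\<close> says that \<open>z\<close> is the value at \<open>T\<close> of the linear extension of the weight,
  computed from some representation \<open>T = A - B + \<i> (C - D)\<close> with positive \<open>A, B, C, D\<close> in the ideal.\<close>

definition trace_value ::
  "((real \<Rightarrow> real) \<Rightarrow> real) \<Rightarrow> ('h::complex_hilbert_space \<Rightarrow>\<^sub>L 'h) \<Rightarrow> complex \<Rightarrow> bool" where
  "trace_value \<omega> T z \<longleftrightarrow> (\<exists>A\<in>ideal_pos. \<exists>B\<in>ideal_pos. \<exists>C\<in>ideal_pos. \<exists>D\<in>ideal_pos.
     T = A - B + scaleC_op \<i> (C - D) \<and>
     z = Complex (Tr_weight \<omega> A - Tr_weight \<omega> B) (Tr_weight \<omega> C - Tr_weight \<omega> D))"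

lemma trace_valueI:
  assumes "A \<in> ideal_pos" "B \<in> ideal_pos" "C \<in> ideal_pos" "D \<in> ideal_pos"
    and "T = A - B + scaleC_op \<i> (C - D)"
    and "z = Complex (Tr_weight \<omega> A - Tr_weight \<omega> B) (Tr_weight \<omega> C - Tr_weight \<omega> D)"
  shows "trace_value \<omega> T z"
  using assms unfolding trace_value_def by blast

text \<open>The value is unique and exists for every \<open>T\<close> in the ideal; outside of the ideal this is an
  arbitrary number.\<close>

definition linear_extension ::
  "((real \<Rightarrow> real) \<Rightarrow> real) \<Rightarrow> ('h::complex_hilbert_space \<Rightarrow>\<^sub>L 'h) \<Rightarrow> complex" where
  "linear_extension \<omega> T = (THE z. trace_value \<omega> T z)"

lemma ideal_pos_add: "S \<in> ideal_pos \<Longrightarrow> T \<in> ideal_pos \<Longrightarrow> S + T \<in> ideal_pos"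
  by (simp add: ideal_pos_def dixmier_ideal_add positive_op_add)

lemma ideal_pos_scaleR: "T \<in> ideal_pos \<Longrightarrow> 0 \<le> r \<Longrightarrow> r *\<^sub>R T \<in> ideal_pos"
  by (simp add: ideal_pos_def dixmier_ideal_scaleR positive_op_scaleR)

lemma ideal_pos_0: "0 \<in> ideal_pos"
  by (simp add: ideal_pos_def dixmier_ideal_0 positive_op_0)

lemma ideal_pos_unitary:
  assumes U: "unitary_op U" and T: "T \<in> ideal_pos"
  shows "adjoint U o\<^sub>L T o\<^sub>L U \<in> ideal_pos"
proof -
  note bU = unitary_op_bounded[OF U]
  have pos: "positive_op T" using T by (simp add: ideal_pos_def)
  have b: "adjoint U o\<^sub>L T o\<^sub>L U \<in> bounded_ops"
    by (intro bounded_ops_compose adjoint_in_bounded_ops bU positive_op_bounded pos)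
  have "adjoint U o\<^sub>L T o\<^sub>L U \<in> dixmier_ideal"
    by (rule dixmier_ideal_snum_le[of T _ 1]) (use T b in \<open>auto simp: ideal_pos_def snum_unitary[OF U]\<close>)
  moreover have "positive_op (adjoint U o\<^sub>L T o\<^sub>L U)"
    using b symmetric_op_inner[OF positive_op_symmetric[OF pos]] positive_op_nonneg[OF pos]
    by (simp add: positive_op_iff symmetric_op_def inner_adjoint[OF bU] inner_adjoint'[OF bU])
  ultimately show ?thesis by (simp add: ideal_pos_def)
qed

lemma scaleC_op_simps:
  "scaleC_op c (S + T) = scaleC_op c S + scaleC_op c T"
  "scaleC_op c (S - T) = scaleC_op c S - scaleC_op c T"
  "scaleC_op (c + d) T = scaleC_op c T + scaleC_op d T"
  "scaleC_op c (scaleC_op d T) = scaleC_op (c * d) T"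
  "scaleC_op (complex_of_real r) T = r *\<^sub>R T"
  "scaleC_op c 0 = 0"
  by (intro blinfun_eqI; simp add: blinfun.bilinear_simps scaleC_add_right scaleC_add_left scaleC_scaleC
      scaleC_of_real complex_vector.scale_right_diff_distrib)+

text \<open>The real and imaginary parts of an operator are unique.\<close>

lemma symmetric_eq_imaginary:
  assumes X: "symmetric_op X" and Y: "symmetric_op Y" and eq: "X = scaleC_op \<i> Y"
  shows "X = 0" "Y = 0"
proof -
  have app: "X x = \<i> *\<^sub>C Y x" for x using eq by simp
  have "inner (X x) y = - inner (X x) y" for x y
  proof -
    have "inner (X x) y = inner x (X y)" by (rule symmetric_op_inner[OF X])
    also have "\<dots> = inner x (Y (\<i> *\<^sub>C y))"
      by (simp add: app bounded_ops_scaleC[OF symmetric_op_bounded[OF Y]])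
    also have "\<dots> = inner (Y x) (\<i> *\<^sub>C y)" by (simp add: symmetric_op_inner[OF Y])
    also have "\<dots> = - inner (\<i> *\<^sub>C Y x) y"
      by (simp add: inner_scaleC_swap)
    finally show ?thesis by (simp add: app)
  qed
  then have "inner (X x) (X x) = 0" for x by (metis equal_neg_zero)
  then have X0: "X x = 0" for x by simp
  then show "X = 0" by (intro blinfun_eqI) simp
  have "Y x = 0" for x using X0[of x] app[of x] norm_scaleC[of \<i> "Y x"] by simp
  then show "Y = 0" by (intro blinfun_eqI) simp
qed

context
  fixes \<omega> :: "(real \<Rightarrow> real) \<Rightarrow> real"
  assumes \<omega>: "generalized_limit \<omega>" "exponentiation_invariant \<omega>"
begin

lemma Tr_weight_diff_cong:
  assumes "A \<in> ideal_pos" "B \<in> ideal_pos" "A' \<in> ideal_pos" "B' \<in> ideal_pos" "A - B = A' - B'"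
  shows "Tr_weight \<omega> A - Tr_weight \<omega> B = Tr_weight \<omega> A' - Tr_weight \<omega> B'"
proof -
  have "A + B' = A' + B" using assms(5) by (simp add: algebra_simps)
  moreover have "Tr_weight \<omega> (A + B') = Tr_weight \<omega> A + Tr_weight \<omega> B'"
    "Tr_weight \<omega> (A' + B) = Tr_weight \<omega> A' + Tr_weight \<omega> B"
    using assms by (intro Tr_weight_add[OF \<omega>]; simp add: ideal_pos_def)+
  ultimately show ?thesis by simp
qed

lemma trace_value_unique:
  assumes "trace_value \<omega> T z" "trace_value \<omega> T w"
  shows "z = w"
proof -
  obtain A B C D where 1: "A \<in> ideal_pos" "B \<in> ideal_pos" "C \<in> ideal_pos" "D \<in> ideal_pos"
    "T = A - B + scaleC_op \<i> (C - D)"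
    "z = Complex (Tr_weight \<omega> A - Tr_weight \<omega> B) (Tr_weight \<omega> C - Tr_weight \<omega> D)"
    using assms(1) unfolding trace_value_def by blast
  obtain A' B' C' D' where 2: "A' \<in> ideal_pos" "B' \<in> ideal_pos" "C' \<in> ideal_pos" "D' \<in> ideal_pos"
    "T = A' - B' + scaleC_op \<i> (C' - D')"
    "w = Complex (Tr_weight \<omega> A' - Tr_weight \<omega> B') (Tr_weight \<omega> C' - Tr_weight \<omega> D')"
    using assms(2) unfolding trace_value_def by blast
  let ?X = "(A - B) - (A' - B')" and ?Y = "(C' - D') - (C - D)"
  have sym: "symmetric_op S" if "S \<in> ideal_pos" for S
    using that positive_op_symmetric by (auto simp: ideal_pos_def)
  have "?X = scaleC_op \<i> ?Y"
    unfolding scaleC_op_simps(2)[of _ "C' - D'"] using 1(5) 2(5) by (simp add: algebra_simps)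
  moreover have "symmetric_op ?X" "symmetric_op ?Y"
    by (intro symmetric_op_diff sym 1 2)+
  ultimately have "?X = 0" "?Y = 0" using symmetric_eq_imaginary by blast+
  then have "A - B = A' - B'" "C - D = C' - D'" by (simp_all only: eq_iff_diff_eq_0[symmetric])
  then show ?thesis using Tr_weight_diff_cong 1 2 by metis
qed

lemma trace_value_pos: "T \<in> ideal_pos \<Longrightarrow> trace_value \<omega> T (complex_of_real (Tr_weight \<omega> T))"
  by (intro trace_valueI[of T 0 0 0])
     (auto simp: ideal_pos_0 scaleC_op_simps Tr_weight_0[OF \<omega>(1)] complex_of_real_def)

lemma trace_value_add:
  assumes "trace_value \<omega> S z" "trace_value \<omega> T w"
  shows "trace_value \<omega> (S + T) (z + w)"
proof -
  obtain A B C D where 1: "A \<in> ideal_pos" "B \<in> ideal_pos" "C \<in> ideal_pos" "D \<in> ideal_pos"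
    "S = A - B + scaleC_op \<i> (C - D)"
    "z = Complex (Tr_weight \<omega> A - Tr_weight \<omega> B) (Tr_weight \<omega> C - Tr_weight \<omega> D)"
    using assms(1) unfolding trace_value_def by blast
  obtain A' B' C' D' where 2: "A' \<in> ideal_pos" "B' \<in> ideal_pos" "C' \<in> ideal_pos" "D' \<in> ideal_pos"
    "T = A' - B' + scaleC_op \<i> (C' - D')"
    "w = Complex (Tr_weight \<omega> A' - Tr_weight \<omega> B') (Tr_weight \<omega> C' - Tr_weight \<omega> D')"
    using assms(2) unfolding trace_value_def by blast
  have add: "Tr_weight \<omega> (P + Q) = Tr_weight \<omega> P + Tr_weight \<omega> Q"
    if "P \<in> ideal_pos" "Q \<in> ideal_pos" for P Q
    using that by (intro Tr_weight_add[OF \<omega>]) (auto simp: ideal_pos_def)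
  show ?thesis
    by (intro trace_valueI[of "A + A'" "B + B'" "C + C'" "D + D'"])
       (use 1 2 in \<open>simp_all add: ideal_pos_add add scaleC_op_simps complex_eq_iff\<close>)
qed

lemma trace_value_pos_scaleR:
  assumes "trace_value \<omega> T z" "0 \<le> r"
  shows "trace_value \<omega> (r *\<^sub>R T) (complex_of_real r * z)"
proof -
  obtain A B C D where 1: "A \<in> ideal_pos" "B \<in> ideal_pos" "C \<in> ideal_pos" "D \<in> ideal_pos"
    "T = A - B + scaleC_op \<i> (C - D)"
    "z = Complex (Tr_weight \<omega> A - Tr_weight \<omega> B) (Tr_weight \<omega> C - Tr_weight \<omega> D)"
    using assms(1) unfolding trace_value_def by blast
  have sc: "Tr_weight \<omega> (r *\<^sub>R P) = r * Tr_weight \<omega> P" if "P \<in> ideal_pos" for P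
    using that assms(2) by (intro Tr_weight_scaleR[OF \<omega>(1)]) (auto simp: ideal_pos_def)
  have "r *\<^sub>R T = r *\<^sub>R A - r *\<^sub>R B + scaleC_op \<i> (r *\<^sub>R C - r *\<^sub>R D)"
    by (intro blinfun_eqI) (simp add: 1(5) blinfun.bilinear_simps scaleC_scaleR scaleR_add_right
        scaleR_diff_right complex_vector.scale_right_diff_distrib)
  then show ?thesis
    by (intro trace_valueI[of "r *\<^sub>R A" "r *\<^sub>R B" "r *\<^sub>R C" "r *\<^sub>R D"])
       (use 1 assms(2) in \<open>simp_all add: ideal_pos_scaleR sc complex_eq_iff right_diff_distrib\<close>)
qed

lemma trace_value_imag:
  assumes "trace_value \<omega> T z"
  shows "trace_value \<omega> (scaleC_op \<i> T) (\<i> * z)"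
proof -
  obtain A B C D where 1: "A \<in> ideal_pos" "B \<in> ideal_pos" "C \<in> ideal_pos" "D \<in> ideal_pos"
    "T = A - B + scaleC_op \<i> (C - D)"
    "z = Complex (Tr_weight \<omega> A - Tr_weight \<omega> B) (Tr_weight \<omega> C - Tr_weight \<omega> D)"
    using assms(1) unfolding trace_value_def by blast
  have "scaleC_op (-1) P = - P" for P :: "'a::complex_hilbert_space \<Rightarrow>\<^sub>L 'a"
    using scaleC_op_simps(5)[of "-1" P] by simp
  then have "scaleC_op \<i> T = D - C + scaleC_op \<i> (A - B)"
    by (simp add: 1(5) scaleC_op_simps)
  then show ?thesis
    by (intro trace_valueI[of D C A B])
       (use 1 in \<open>simp_all add: complex_eq_iff\<close>)
qed

lemma trace_value_scaleC_op:
  assumes "trace_value \<omega> T z"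
  shows "trace_value \<omega> (scaleC_op c T) (c * z)"
proof -
  have neg: "trace_value \<omega> (- S) (- w)" if "trace_value \<omega> S w" for S :: "'a::complex_hilbert_space \<Rightarrow>\<^sub>L 'a" and w
    using trace_value_imag[OF trace_value_imag[OF that]] scaleC_op_simps(5)[of "-1" S]
    by (simp add: scaleC_op_simps(4) flip: mult.assoc)
  have real: "trace_value \<omega> (r *\<^sub>R S) (complex_of_real r * w)" if "trace_value \<omega> S w"
    for r and S :: "'a::complex_hilbert_space \<Rightarrow>\<^sub>L 'a" and w
  proof (cases "0 \<le> r")
    case False
    then show ?thesis using neg[OF trace_value_pos_scaleR[OF that, of "- r"]] by simp
  qed (rule trace_value_pos_scaleR[OF that])
  have "scaleC_op c T = Re c *\<^sub>R T + scaleC_op \<i> (Im c *\<^sub>R T)"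
    by (simp flip: scaleC_op_simps(5) add: scaleC_op_simps(4)) (simp flip: scaleC_op_simps(3) complex_eq)
  moreover have "c * z = complex_of_real (Re c) * z + \<i> * (complex_of_real (Im c) * z)"
    by (simp add: complex_eq_iff algebra_simps)
  ultimately show ?thesis
    using trace_value_add[OF real[OF assms] trace_value_imag[OF real[OF assms]]] by metis
qed

lemma trace_value_unitary:
  assumes "trace_value \<omega> T z" and U: "unitary_op U"
  shows "trace_value \<omega> (adjoint U o\<^sub>L T o\<^sub>L U) z"
proof -
  obtain A B C D where 1: "A \<in> ideal_pos" "B \<in> ideal_pos" "C \<in> ideal_pos" "D \<in> ideal_pos"
    "T = A - B + scaleC_op \<i> (C - D)"
    "z = Complex (Tr_weight \<omega> A - Tr_weight \<omega> B) (Tr_weight \<omega> C - Tr_weight \<omega> D)"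
    using assms(1) unfolding trace_value_def by blast
  have inv: "Tr_weight \<omega> (adjoint U o\<^sub>L P o\<^sub>L U) = Tr_weight \<omega> P" for P
    unfolding Tr_weight_def by (simp add: log_mean_cong[OF snum_unitary[OF U]])
  let ?c = "\<lambda>P. adjoint U o\<^sub>L P o\<^sub>L U"
  have "?c T = ?c A - ?c B + scaleC_op \<i> (?c C - ?c D)"
    by (intro blinfun_eqI)
      (simp add: 1(5) blinfun.bilinear_simps complex_vector.scale_right_diff_distrib
        bounded_ops_scaleC[OF adjoint_in_bounded_ops[OF unitary_op_bounded[OF U]]])
  then show ?thesis
    by (intro trace_valueI[of "?c A" "?c B" "?c C" "?c D"])
       (use 1 U in \<open>simp_all add: ideal_pos_unitary inv\<close>)
qed

text \<open>The real part \<open>(T + T\<^sup>*) / 2\<close> and the imaginary part \<open>(T - T\<^sup>*) / (2 \<i>)\<close> lie in the ideal.\<close>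

lemma trace_value_exists:
  fixes T :: "'h::complex_hilbert_space \<Rightarrow>\<^sub>L 'h"
  assumes T: "T \<in> dixmier_ideal"
  shows "\<exists>z. trace_value \<omega> T z"
proof -
  have dec: "\<exists>A\<in>ideal_pos. \<exists>B\<in>ideal_pos. S = A - B" if "symmetric_op S" "S \<in> dixmier_ideal"
    for S :: "'h \<Rightarrow>\<^sub>L 'h"
    using symmetric_op_decomposition[OF that] unfolding ideal_pos_def by blast
  note bT = dixmier_ideal_bounded[OF T] and iT = dixmier_ideal_adjoint[OF T]
  define R where "R = (1/2) *\<^sub>R (T + adjoint T)"
  define J where "J = scaleC_op (- \<i> / 2) (T - adjoint T)"
  have R: "R \<in> dixmier_ideal" unfolding R_def by (intro dixmier_ideal_scaleR dixmier_ideal_add T iT)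
  have J: "J \<in> dixmier_ideal" unfolding J_def by (intro dixmier_ideal_scaleC_op dixmier_ideal_diff T iT)
  have "symmetric_op R"
    using dixmier_ideal_bounded[OF R]
    by (simp add: symmetric_op_def R_def blinfun.bilinear_simps inner_simps inner_adjoint[OF bT] inner_adjoint'[OF bT])
  moreover have "symmetric_op J"
  proof -
    have "inner (J x) y = inner x (J y)" for x y
    proof -
      have "cinner (J x) y = \<i> / 2 * (cinner (T x) y - cinner (adjoint T x) y)"
        by (simp add: J_def cinner_simps blinfun.bilinear_simps)
      also have "\<dots> = - \<i> / 2 * (cinner x (T y) - cinner x (adjoint T y))"
        using cinner_adjoint[OF bT, of x y] cinner_adjoint[OF bT, of y x]
          cinner_commute[of "T x" y] cinner_commute[of x "adjoint T y"]
        by (simp add: algebra_simps)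
      also have "\<dots> = cinner x (J y)" by (simp add: J_def cinner_simps blinfun.bilinear_simps)
      finally show ?thesis by (simp add: inner_eq_Re_cinner)
    qed
    then show ?thesis using dixmier_ideal_bounded[OF J] by (simp add: symmetric_op_def)
  qed
  moreover have "T = R + scaleC_op \<i> J"
  proof -
    have "scaleC_op \<i> J = (1/2) *\<^sub>R (T - adjoint T)"
      using scaleC_op_simps(5)[of "1/2" "T - adjoint T"] by (simp add: J_def scaleC_op_simps(4))
    then have "R + scaleC_op \<i> J = (1/2) *\<^sub>R (T + T)"
      by (simp add: R_def scaleR_add_right scaleR_diff_right)
    then show ?thesis by simp
  qed
  ultimately show ?thesis using dec R J unfolding trace_value_def by metis
qed

lemma linear_extension_eq: "trace_value \<omega> T z \<Longrightarrow> linear_extension \<omega> T = z"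
  unfolding linear_extension_def using trace_value_unique by (intro the_equality)

lemma trace_value_linear_extension:
  "T \<in> dixmier_ideal \<Longrightarrow> trace_value \<omega> T (linear_extension \<omega> T)"
  using trace_value_exists linear_extension_eq by metis

lemma linear_extension_pos:
  "T \<in> dixmier_ideal \<Longrightarrow> positive_op T \<Longrightarrow> linear_extension \<omega> T = complex_of_real (Tr_weight \<omega> T)"
  by (intro linear_extension_eq trace_value_pos) (simp add: ideal_pos_def)

lemma dixmier_ideal_trace_linear_extension: "dixmier_ideal_trace (linear_extension \<omega>)"
  unfolding dixmier_ideal_trace_def
proof (intro conjI ballI allI impI)
  note val = trace_value_linear_extension
  fix S T :: "'a::complex_hilbert_space \<Rightarrow>\<^sub>L 'a" and c U
  assume T: "T \<in> dixmier_ideal"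
  show "linear_extension \<omega> (S + T) = linear_extension \<omega> S + linear_extension \<omega> T" if "S \<in> dixmier_ideal"
    by (intro linear_extension_eq trace_value_add val T that)
  show "linear_extension \<omega> (scaleC_op c T) = c * linear_extension \<omega> T"
    by (intro linear_extension_eq trace_value_scaleC_op val T)
  show "linear_extension \<omega> T \<in> \<real>\<^sub>\<ge>\<^sub>0" if "positive_op T"
    using linear_extension_pos[OF T that] Tr_weight_nonneg[OF \<omega>(1) T] by simp
  show "linear_extension \<omega> (adjoint U o\<^sub>L T o\<^sub>L U) = linear_extension \<omega> T" if "unitary_op U"
    by (intro linear_extension_eq trace_value_unitary val T that)
qed

end

section \<open>Non-normality\<close>

text \<open>In infinite dimensions an orthonormal basis is infinite, since a finite one spans the whole
  space.\<close>

lemma orthonormal_sequence_exists: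
  assumes "\<not> (\<exists>B :: 'h::complex_hilbert_space set. finite B \<and> complex_vector.span B = UNIV)"
  shows "\<exists>e :: nat \<Rightarrow> 'h. inj e \<and> orthonormal (range e)"
proof -
  obtain B :: "'h set" where B: "orthonormal_basis B" using orthonormal_basis_exists by blast
  then have on: "orthonormal B" by (simp add: orthonormal_basis_iff)
  have "infinite B"
  proof
    assume fin: "finite B"
    have "closed {x. onproj B x = x}" by (intro closed_Collect_eq continuous_intros)
    moreover have "cspan B \<subseteq> {x. onproj B x = x}" using onproj_id_on_span[OF on fin] by blast
    ultimately have "closure (cspan B) \<subseteq> {x. onproj B x = x}" by (intro closure_minimal)
    then have "onproj B x = x" for x using B by (auto simp: orthonormal_basis_iff)
    then have "cspan B = UNIV" using onproj_in_span[of B] by (metis UNIV_eq_I)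
    then show False using assms fin by blast
  qed
  then obtain e :: "nat \<Rightarrow> 'h" where "inj e" "range e \<subseteq> B" using infinite_countable_subset by blast
  then show ?thesis using orthonormal_subset[OF on] by blast
qed

text \<open>The truncation of the diagonal operator with eigenvalues \<open>1, 1/2, 1/3, \<dots>\<close> for the eigenvectors
  \<open>e\<^sub>0, e\<^sub>1, e\<^sub>2, \<dots>\<close>.\<close>

definition harmonic_op :: "(nat \<Rightarrow> 'h::complex_hilbert_space) \<Rightarrow> nat \<Rightarrow> 'h \<Rightarrow>\<^sub>L 'h" where
  "harmonic_op e n = (\<Sum>k<n. (1 / real (Suc k)) *\<^sub>R rank_one (e k))"

context
  fixes e :: "nat \<Rightarrow> 'h::complex_hilbert_space"
  assumes inj: "inj e" and on: "orthonormal (range e)"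
begin

lemma symmetric_op_harmonic: "symmetric_op (harmonic_op e n)"
  unfolding harmonic_op_def
  by (induction n) (auto intro: symmetric_op_0 symmetric_op_add symmetric_op_scaleR symmetric_op_rank_one)

lemma inner_harmonic: "inner x (harmonic_op e n x) = (\<Sum>k<n. (cmod (cinner (e k) x))\<^sup>2 / real (Suc k))"
  by (simp add: harmonic_op_def blinfun.sum_left blinfun.scaleR_left inner_sum_right inner_rank_one)

lemma bessel_sequence: "(\<Sum>k\<in>{n..<m}. (cmod (cinner (e k) x))\<^sup>2) \<le> (norm x)\<^sup>2"
proof -
  have fin: "finite (e ` {n..<m})" by simp
  have on': "orthonormal (e ` {n..<m})" by (rule orthonormal_subset[OF on]) auto
  have "(\<Sum>k\<in>{n..<m}. (cmod (cinner (e k) x))\<^sup>2) = (norm (onproj (e ` {n..<m}) x))\<^sup>2"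
    unfolding norm_onproj[OF on' fin] by (subst sum.reindex) (use inj in \<open>auto simp: inj_on_def inj_def\<close>)
  also have "\<dots> \<le> (norm x)\<^sup>2" by (intro power_mono bessel on' fin) auto
  finally show ?thesis .
qed

lemma inner_harmonic_diff:
  assumes "n \<le> m"
  shows "inner x ((harmonic_op e m - harmonic_op e n) x) = (\<Sum>k\<in>{n..<m}. (cmod (cinner (e k) x))\<^sup>2 / real (Suc k))"
  using assms sum_diff_nat_ivl[of 0 n m "\<lambda>k. (cmod (cinner (e k) x))\<^sup>2 / real (Suc k)"]
  by (simp add: blinfun.diff_left inner_diff_right inner_harmonic atLeast0LessThan)

lemma positive_op_harmonic_diff: "n \<le> m \<Longrightarrow> positive_op (harmonic_op e m - harmonic_op e n)"
  unfolding positive_op_iff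
  by (auto simp: inner_harmonic_diff intro!: symmetric_op_diff symmetric_op_harmonic sum_nonneg)

lemma positive_op_harmonic: "positive_op (harmonic_op e n)"
  using positive_op_harmonic_diff[of 0 n] by (simp add: harmonic_op_def)

lemma norm_harmonic_diff:
  assumes "n \<le> m"
  shows "norm (harmonic_op e m - harmonic_op e n) \<le> 1 / real (Suc n)"
proof (rule norm_blinfun_bound)
  fix x
  show "norm ((harmonic_op e m - harmonic_op e n) x) \<le> 1 / real (Suc n) * norm x"
  proof (rule norm_le_of_quadratic_form[OF positive_op_harmonic_diff[OF assms]])
    fix x
    have "(\<Sum>k\<in>{n..<m}. (cmod (cinner (e k) x))\<^sup>2 / real (Suc k))
        \<le> (\<Sum>k\<in>{n..<m}. 1 / real (Suc n) * (cmod (cinner (e k) x))\<^sup>2)"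
    proof (intro sum_mono)
      fix k assume "k \<in> {n..<m}"
      then have "1 / real (Suc k) \<le> 1 / real (Suc n)" by (intro divide_left_mono) auto
      from mult_right_mono[OF this, of "(cmod (cinner (e k) x))\<^sup>2"]
      show "(cmod (cinner (e k) x))\<^sup>2 / real (Suc k) \<le> 1 / real (Suc n) * (cmod (cinner (e k) x))\<^sup>2"
        by simp
    qed
    also have "\<dots> \<le> 1 / real (Suc n) * (norm x)\<^sup>2"
      unfolding sum_distrib_left[symmetric] by (intro mult_left_mono bessel_sequence) auto
    finally show "inner x ((harmonic_op e m - harmonic_op e n) x) \<le> 1 / real (Suc n) * (norm x)\<^sup>2"
      by (simp add: inner_harmonic_diff[OF assms])
  qed
qed simp

lemma harmonic_op_orth: "x \<in> orth (e ` {..<n}) \<Longrightarrow> harmonic_op e n x = 0"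
  by (simp add: harmonic_op_def blinfun.sum_left blinfun.scaleR_left rank_one.rep_eq orth_def)

text \<open>The diagonal operator itself exists as a norm limit, although the norms of the summands are not
  summable.\<close>

lemma harmonic_op_limit_exists: "\<exists>T. harmonic_op e \<longlonglongrightarrow> T"
proof -
  have "Cauchy (harmonic_op e)"
  proof (rule metric_CauchyI)
    fix r :: real assume "0 < r"
    then obtain N where N: "1 / real (Suc N) < r" using nat_approx_posE by blast
    have *: "dist (harmonic_op e m) (harmonic_op e n) < r" if "n \<ge> N" "n \<le> m" for m n
    proof -
      have "dist (harmonic_op e m) (harmonic_op e n) \<le> 1 / real (Suc n)"
        unfolding dist_norm by (rule norm_harmonic_diff[OF that(2)])
      also have "\<dots> \<le> 1 / real (Suc N)" using that by (intro divide_left_mono) auto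
      finally show ?thesis using N by simp
    qed
    have "dist (harmonic_op e m) (harmonic_op e n) < r" if "m \<ge> N" "n \<ge> N" for m n
      using *[of n m] *[of m n] that by (cases "n \<le> m") (auto simp: dist_commute)
    then show "\<exists>M. \<forall>m\<ge>M. \<forall>n\<ge>M. dist (harmonic_op e m) (harmonic_op e n) < r" by blast
  qed
  then show ?thesis using Cauchy_convergent_iff convergent_def by blast
qed

lemma snum_harmonic_op_eq_0:
  assumes "n \<le> k"
  shows "snum k (harmonic_op e n) = 0"
proof (rule antisym[OF snum_le snum_nonneg])
  show "snum_bound k (harmonic_op e n) 0"
  proof (rule snum_boundI[of _ "e ` {..<n}"])
    show "card (e ` {..<n}) \<le> k" using card_image_le[of "{..<n}" e] assms by simp
  qed (simp_all add: harmonic_op_orth)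
qed

lemma sing_int_harmonic_op_le: "sing_int (harmonic_op e n) t \<le> snum_sum n (harmonic_op e n)"
proof -
  define N where "N = nat \<lceil>max t n\<rceil>"
  have N: "t \<le> real N" "n \<le> N" unfolding N_def by linarith+
  have "sing_int (harmonic_op e n) t \<le> snum_sum N (harmonic_op e n)"
    using sing_int_mono[OF N(1)] by (simp add: sing_int_nat)
  also have "\<dots> = snum_sum n (harmonic_op e n)"
    unfolding snum_sum_def using N(2) by (intro sum.mono_neutral_right) (auto simp: snum_harmonic_op_eq_0)
  finally show ?thesis .
qed

context
  fixes T :: "'h \<Rightarrow>\<^sub>L 'h"
  assumes T: "harmonic_op e \<longlonglongrightarrow> T"
begin

lemma harmonic_limit_diff_form: "0 \<le> inner x ((T - harmonic_op e n) x)"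
proof (rule quadratic_form_limit_nonneg)
  show "(\<lambda>m. harmonic_op e m - harmonic_op e n) \<longlonglongrightarrow> T - harmonic_op e n"
    by (intro tendsto_intros T)
  show "\<forall>\<^sub>F m in sequentially. 0 \<le> inner x ((harmonic_op e m - harmonic_op e n) x)"
    using eventually_ge_at_top[of n]
    by eventually_elim (intro positive_op_nonneg positive_op_harmonic_diff)
qed

lemma symmetric_op_harmonic_limit: "symmetric_op T"
  by (rule symmetric_op_limit[OF symmetric_op_harmonic T])

lemma positive_op_harmonic_limit_diff: "positive_op (T - harmonic_op e n)"
  using harmonic_limit_diff_form symmetric_op_harmonic_limit symmetric_op_harmonic
  by (simp add: positive_op_iff symmetric_op_diff)

lemma positive_op_harmonic_limit: "positive_op T"
  using positive_op_harmonic_limit_diff[of 0] by (simp add: harmonic_op_def)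

lemma snum_harmonic_limit_le: "snum n T \<le> 1 / real (Suc n)"
proof (rule snum_le, rule snum_boundI[of _ "e ` {..<n}"])
  show "card (e ` {..<n}) \<le> n" using card_image_le[of "{..<n}" e] by simp
  have "(\<lambda>m. norm (harmonic_op e m - harmonic_op e n)) \<longlonglongrightarrow> norm (T - harmonic_op e n)"
    by (intro tendsto_intros T)
  then have le: "norm (T - harmonic_op e n) \<le> 1 / real (Suc n)"
    by (rule LIMSEQ_le_const2) (use norm_harmonic_diff in blast)
  fix x assume "x \<in> orth (e ` {..<n})"
  then have "T x = (T - harmonic_op e n) x" by (simp add: blinfun.diff_left harmonic_op_orth)
  then have "norm (T x) \<le> norm (T - harmonic_op e n) * norm x" using norm_blinfun by metis
  also have "\<dots> \<le> 1 / real (Suc n) * norm x" by (intro mult_right_mono le) auto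
  finally show "norm (T x) \<le> 1 / real (Suc n) * norm x" .
qed simp_all

lemma snum_sum_harmonic_limit_le: "snum_sum n T \<le> harm n"
  unfolding snum_sum_def harm_altdef
  by (intro sum_mono) (use snum_harmonic_limit_le in \<open>simp add: inverse_eq_divide\<close>)

lemma harm_le_snum_sum_harmonic_limit: "harm n \<le> snum_sum n T"
proof -
  have on': "orthonormal (e ` {..<n})" by (rule orthonormal_subset[OF on]) auto
  have "harm n = (\<Sum>k<n. 1 / real (Suc k))" by (simp add: harm_altdef inverse_eq_divide)
  also have "\<dots> \<le> (\<Sum>k<n. inner (e k) (T (e k)))"
  proof (rule sum_mono)
    fix k assume k: "k \<in> {..<n}"
    have "1 / real (Suc k) = (cmod (cinner (e k) (e k)))\<^sup>2 / real (Suc k)"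
      using on by (simp add: cinner_self orthonormal_def)
    also have "\<dots> \<le> inner (e k) (harmonic_op e n (e k))"
      unfolding inner_harmonic
      by (rule member_le_sum[OF k, of "\<lambda>j. (cmod (cinner (e j) (e k)))\<^sup>2 / real (Suc j)"]) auto
    also have "\<dots> \<le> inner (e k) (T (e k))"
      using harmonic_limit_diff_form[of "e k" n] by (simp add: blinfun.diff_left inner_diff_right)
    finally show "1 / real (Suc k) \<le> inner (e k) (T (e k))" .
  qed
  also have "\<dots> = partial_trace (e ` {..<n}) T"
    unfolding partial_trace_def by (subst sum.reindex) (use inj in \<open>auto simp: inj_on_def inj_def\<close>)
  also have "\<dots> \<le> snum_sum n T"
    using card_image_le[of "{..<n}" e]
    by (intro partial_trace_le_snum_sum[OF positive_op_harmonic_limit on']) auto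
  finally show ?thesis .
qed

lemma harmonic_limit_in_dixmier_ideal: "T \<in> dixmier_ideal"
proof -
  have "sing_int T t \<le> 3 * ln (1 + t)" if t: "1 \<le> t" for t
  proof -
    define n where "n = Suc (nat \<lfloor>t\<rfloor>)"
    have n: "real n \<le> 1 + t" "n \<ge> 1" unfolding n_def using t by linarith+
    have "sing_int T t \<le> snum_sum n T" unfolding n_def by (rule sing_int_le_snum_sum) (use t in simp)
    also have "\<dots> \<le> harm n" by (rule snum_sum_harmonic_limit_le)
    also have "\<dots> \<le> 1 + ln (real n)"
      using euler_mascheroni_sequence_decreasing[of 1 n] n by (simp add: harm_expand)
    finally have "sing_int T t \<le> 1 + ln (real n)" .
    moreover have "ln (real n) \<le> ln (1 + t)" using n by (subst ln_le_cancel_iff) auto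
    moreover have "1 \<le> 2 * ln (1 + t)"
    proof -
      have "ln (1 + 1) \<le> ln (1 + t)" using t by (subst ln_le_cancel_iff) auto
      then show ?thesis using ln_ge_half[of 1] by simp
    qed
    ultimately show ?thesis by simp
  qed
  then show ?thesis
    using symmetric_op_bounded[OF symmetric_op_harmonic_limit] unfolding dixmier_ideal_iff by blast
qed

lemma harmonic_op_in_dixmier_ideal: "harmonic_op e n \<in> dixmier_ideal"
  by (rule dixmier_ideal_snum_le[OF harmonic_limit_in_dixmier_ideal, of _ 1])
     (use positive_op_bounded[OF positive_op_harmonic]
        snum_mono_op_le[OF positive_op_harmonic positive_op_harmonic_limit_diff] in auto)

text \<open>The harmonic numbers dominate the logarithm, so the logarithmic means do not tend to \<open>0\<close>.\<close>

lemma log_mean_harmonic_limit_ge: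
  assumes t: "2 \<le> t"
  shows "1 / 2 \<le> log_mean T t"
proof -
  have "ln (1 + t) \<le> ln (t * t)"
  proof (subst ln_le_cancel_iff)
    show "1 + t \<le> t * t" using t mult_right_mono[of 2 t t] by linarith
  qed (use t in auto)
  then have "ln (1 + t) / 2 \<le> ln t" using t by (simp add: ln_mult)
  also have "\<dots> \<le> ln (real (nat \<lfloor>t\<rfloor>) + 1)"
    using t by (subst ln_le_cancel_iff) linarith+
  also have "\<dots> \<le> harm (nat \<lfloor>t\<rfloor>)" by (rule ln_le_harm)
  also have "\<dots> \<le> sing_int T (real (nat \<lfloor>t\<rfloor>))"
    unfolding sing_int_nat by (rule harm_le_snum_sum_harmonic_limit)
  also have "\<dots> \<le> sing_int T t" by (rule sing_int_mono) (use t in linarith)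
  finally show ?thesis using t by (simp add: log_mean_eq field_simps)
qed

lemma Tr_weight_harmonic_limit_pos:
  assumes \<omega>: "generalized_limit \<omega>"
  shows "0 < Tr_weight \<omega> T"
proof -
  have c: "(\<lambda>t. 1 / 2) \<in> L_infty" by (rule L_inftyI[of _ 1]) simp_all
  have "\<omega> (\<lambda>t. 1 / 2) = 1 / 2"
    using \<omega> c tendsto_const[of "1 / 2 :: real"] unfolding generalized_limit_def by blast
  moreover have "\<omega> (\<lambda>t. 1 / 2) \<le> \<omega> (log_mean T)"
  proof (rule generalized_limit_mono[OF \<omega> c log_mean_L_infty[OF harmonic_limit_in_dixmier_ideal]])
    show "\<forall>\<^sub>F t in at_top. 1 / 2 \<le> log_mean T t"
      using eventually_ge_at_top[of 2] by eventually_elim (rule log_mean_harmonic_limit_ge)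
  qed
  ultimately show ?thesis by (simp add: Tr_weight_def)
qed

lemma Tr_weight_harmonic_op:
  assumes \<omega>: "generalized_limit \<omega>"
  shows "Tr_weight \<omega> (harmonic_op e n) = 0"
proof -
  let ?K = "snum_sum n (harmonic_op e n)"
  have "(log_mean (harmonic_op e n) \<longlongrightarrow> 0) at_top"
  proof (rule tendsto_sandwich[where f = "\<lambda>t. 0"])
    have "filterlim (\<lambda>t::real. 1 + t) at_top at_top"
      by (intro filterlim_tendsto_add_at_top[OF tendsto_const] filterlim_ident)
    then have "filterlim (\<lambda>t::real. ln (1 + t)) at_top at_top"
      by (rule filterlim_compose[OF ln_at_top])
    then show "((\<lambda>t. ?K / ln (1 + t)) \<longlongrightarrow> 0) at_top"
      by (intro tendsto_divide_0[OF tendsto_const] filterlim_at_top_imp_at_infinity)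
    show "\<forall>\<^sub>F t in at_top. 0 \<le> log_mean (harmonic_op e n) t"
      using eventually_gt_at_top[of 0] by eventually_elim (rule log_mean_nonneg)
    show "\<forall>\<^sub>F t in at_top. log_mean (harmonic_op e n) t \<le> ?K / ln (1 + t)"
      using eventually_gt_at_top[of 0]
      by eventually_elim (auto simp: log_mean_eq intro!: divide_right_mono sing_int_harmonic_op_le)
  qed simp
  then show ?thesis
    using \<omega> log_mean_L_infty[OF harmonic_op_in_dixmier_ideal]
    unfolding generalized_limit_def Tr_weight_def by blast
qed

text \<open>Upper bounds of the truncations are upper bounds of their norm limit.\<close>

lemma op_supremum_harmonic: "op_supremum (range (harmonic_op e)) T"
  unfolding op_supremum_def
proof (intro conjI ballI impI)
  show "T \<in> bounded_ops" by (rule symmetric_op_bounded[OF symmetric_op_harmonic_limit])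
  show "op_le S T" if "S \<in> range (harmonic_op e)" for S
    using that positive_op_harmonic_limit_diff by (auto simp: op_le_def)
  fix R assume R: "R \<in> bounded_ops" "\<forall>S\<in>range (harmonic_op e). op_le S R"
  then have pos: "positive_op (R - harmonic_op e n)" for n by (auto simp: op_le_def)
  have lim: "(\<lambda>n. R - harmonic_op e n) \<longlonglongrightarrow> R - T" by (intro tendsto_intros T)
  have "symmetric_op (R - T)" by (rule symmetric_op_limit[OF positive_op_symmetric[OF pos] lim])
  moreover have "0 \<le> inner x ((R - T) x)" for x
    by (rule quadratic_form_limit_nonneg[OF _ lim]) (simp add: positive_op_nonneg[OF pos])
  ultimately show "op_le T R" by (simp add: op_le_def positive_op_iff)
qed

end

end

lemma not_normal_linear_extension:
  assumes "\<not> (\<exists>B :: 'h::complex_hilbert_space set. finite B \<and> complex_vector.span B = UNIV)"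
    and \<omega>: "generalized_limit \<omega>" "exponentiation_invariant \<omega>"
  shows "\<not> normal_functional (linear_extension \<omega> :: ('h \<Rightarrow>\<^sub>L 'h) \<Rightarrow> complex)"
proof
  assume normal: "normal_functional (linear_extension \<omega> :: ('h \<Rightarrow>\<^sub>L 'h) \<Rightarrow> complex)"
  obtain e :: "nat \<Rightarrow> 'h" where e: "inj e" "orthonormal (range e)"
    using orthonormal_sequence_exists[OF assms(1)] by blast
  obtain T where T: "harmonic_op e \<longlonglongrightarrow> T" using harmonic_op_limit_exists[OF e] by blast
  let ?D = "range (harmonic_op e)"
  note ideal = harmonic_op_in_dixmier_ideal[OF e T] harmonic_limit_in_dixmier_ideal[OF e T]
  have "\<exists>Q\<in>?D. op_le R Q \<and> op_le S Q" if "R \<in> ?D" "S \<in> ?D" for R S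
  proof -
    obtain m n where "R = harmonic_op e m" "S = harmonic_op e n"
      using \<open>R \<in> ?D\<close> \<open>S \<in> ?D\<close> by auto
    then have "op_le R (harmonic_op e (max m n)) \<and> op_le S (harmonic_op e (max m n))"
      by (simp add: op_le_def positive_op_harmonic_diff[OF e])
    then show ?thesis by blast
  qed
  then have dir: "\<forall>R\<in>?D. \<forall>S\<in>?D. \<exists>Q\<in>?D. op_le R Q \<and> op_le S Q" by blast
  have ne: "?D \<noteq> {}" and sub: "?D \<subseteq> dixmier_ideal" and pos: "\<forall>S\<in>?D. positive_op S"
    using ideal(1) positive_op_harmonic[OF e] by auto
  have "linear_extension \<omega> T = complex_of_real (SUP S\<in>?D. Re (linear_extension \<omega> S))"
    by (rule normal[unfolded normal_functional_def, rule_format, OF ne sub _ _ op_supremum_harmonic[OF e T] ideal(2)])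
       (use pos dir in blast)+
  moreover have "linear_extension \<omega> (harmonic_op e n) = 0" for n
    using linear_extension_pos[OF \<omega> ideal(1) positive_op_harmonic[OF e]]
    by (simp add: Tr_weight_harmonic_op[OF e T \<omega>(1)])
  then have "(\<lambda>S. Re (linear_extension \<omega> S)) ` ?D = {0}" by (simp add: image_image image_constant_conv)
  ultimately have "linear_extension \<omega> T = 0" by simp
  moreover have "linear_extension \<omega> T = complex_of_real (Tr_weight \<omega> T)"
    by (rule linear_extension_pos[OF \<omega> ideal(2) positive_op_harmonic_limit[OF e T]])
  ultimately show False using Tr_weight_harmonic_limit_pos[OF e T \<omega>(1)] by simp
qed

theorem proposition5:
  fixes \<omega> :: "(real \<Rightarrow> real) \<Rightarrow> real"
  assumes "separable_space (euclidean :: 'h::complex_hilbert_space topology)"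
    and "\<not> (\<exists>B :: 'h set. finite B \<and> complex_vector.span B = UNIV)"
    and "generalized_limit \<omega>"
    and "exponentiation_invariant \<omega>"
  shows "\<exists>\<phi> :: ('h \<Rightarrow>\<^sub>L 'h) \<Rightarrow> complex.
           dixmier_ideal_trace \<phi> \<and> \<not> normal_functional \<phi> \<and>
           (\<forall>T\<in>dixmier_ideal. positive_op T \<longrightarrow> \<phi> T = complex_of_real (Tr_weight \<omega> T))"
proof (intro exI conjI ballI impI)
  show "dixmier_ideal_trace (linear_extension \<omega> :: ('h \<Rightarrow>\<^sub>L 'h) \<Rightarrow> complex)"
    by (rule dixmier_ideal_trace_linear_extension[OF assms(3,4)])
  show "\<not> normal_functional (linear_extension \<omega> :: ('h \<Rightarrow>\<^sub>L 'h) \<Rightarrow> complex)"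
    by (rule not_normal_linear_extension[OF assms(2-4)])
  show "linear_extension \<omega> T = complex_of_real (Tr_weight \<omega> T)"
    if "T \<in> dixmier_ideal" "positive_op T" for T :: "'h \<Rightarrow>\<^sub>L 'h"
    by (rule linear_extension_pos[OF assms(3,4) that])
qed

end
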